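(* (a) Let $\hat F$ be a probability measure on $\mathbb{R}_+$ with positive min, and let $t_0>0$. Then there is a weak solution $F$ for min-driven clustering on $[t_0,\infty)$ with $F_{t_0}=\hat F$. Moreover, the min $\ell(t)$ of $F_t$ satisfies $$\frac{\ell(t)}{\ell(t_0)}\ge\frac12\Big(\frac{t}{t_0}\Big)^{(\log2)/Q_1},\qquad t\ge t_0.$$ (b) The solution in (a) is unique on $[t_0,t_1]$ for any $t_1>t_0$. (c) Let $\hat F^{(n)}$ be a sequence of probability measures on $\mathbb{R}_+$ with positive min, and $F^{(n)}$ the weak solutions on $[t_0,\infty)$ with $F^{(n)}_{t_0}=\hat F^{(n)}$. Assume $\hat F^{(n)}\to\hat F$ weakly and that $\hat F$ has positive min, and let $F$ be the weak solution with $F_{t_0}=\hat F$. Then $F^{(n)}_t\to F_t$ weakly for every $t>t_0$.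
   Context: Fix numbers $p_k\ge 0$ ($k\ge1$) with $\sum_kp_k=1$ and $Q_1:=\sum_k kp_k<\infty$. Probability measures $F$ on $\mathbb{R}_+=[0,\infty)$ are identified with their distribution functions $F(x)=F([0,x])$; the min of $F$ is $\inf\{x:F(x)>0\}$. $C_0(\mathbb{R}_+)$ is the space of continuous functions on $\mathbb{R}_+$ tending to $0$ at infinity. For an interval $J\subset(0,\infty)$, a weak solution for min-driven clustering on $J$ is a map $t\mapsto F_t$ from $J$ to probability measures on $\mathbb{R}_+$ such that: (1) $t\mapsto\int a\,dF_t$ is measurable for each $a\in C_0(\mathbb{R}_+)$; (2) the min $\ell(t)$ of $F_t$ is positive and increasing (nondecreasing); (3) for each $a\in C_0(\mathbb{R}_+)$ and $t_0,t\in J$, $$\int a\,dF_t-\int a\,dF_{t_0}=\int_{t_0}^t\sum_{k\ge1}p_k\int_{\mathbb{R}_+^k}\Big[a\Big(\ell(s)+\sum_{i=1}^k y_i\Big)-a(\ell(s))\Big]\prod_{i=1}^kF_s(dy_i)\,\frac{ds}{Q_1 s}.$$ Weak convergence of probability measures is convergence of distribution functions at points of continuity of the limit. *)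

theory Defs
  imports "HOL-Probability.Probability"
begin

definition prob_Rplus :: "real measure \<Rightarrow> bool" where
  "prob_Rplus M \<longleftrightarrow> real_distribution M \<and> measure M {..<0} = 0"

definition pmin :: "real measure \<Rightarrow> real" where
  "pmin M = Inf {x. 0 < measure M {0..x}}"

text \<open>Test functions C_0(R_+): continuous, tending to 0 at infinity. Since all measures
  live on [0,inf), only the values on [0,inf) matter; every continuous function on
  [0,inf) extends continuously to the whole line, so we take continuous functions on
  the reals.\<close>
definition C0 :: "(real \<Rightarrow> real) set" where
  "C0 = {a. continuous_on UNIV a \<and> (a \<longlongrightarrow> 0) at_top}"

definition Q1 :: "(nat \<Rightarrow> real) \<Rightarrow> real" where
  "Q1 p = (\<Sum>k. real (Suc k) * p (Suc k))"

definition clust_rhs :: "(nat \<Rightarrow> real) \<Rightarrow> (real \<Rightarrow> real measure) \<Rightarrow> (real \<Rightarrow> real) \<Rightarrow> real \<Rightarrow> real" where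
  "clust_rhs p F a s =
     (\<Sum>k. p (Suc k) *
        (LINT y|PiM {..<Suc k} (\<lambda>_. F s).
            a (pmin (F s) + (\<Sum>i<Suc k. y i)) - a (pmin (F s))))
     / (Q1 p * s)"

definition weak_solution :: "(nat \<Rightarrow> real) \<Rightarrow> real set \<Rightarrow> (real \<Rightarrow> real measure) \<Rightarrow> bool" where
  "weak_solution p J F \<longleftrightarrow>
     (\<forall>t\<in>J. prob_Rplus (F t)) \<and>
     (\<forall>a\<in>C0. (\<lambda>t. LINT y|F t. a y) \<in> borel_measurable (restrict_space borel J)) \<and>
     (\<forall>t\<in>J. 0 < pmin (F t)) \<and>
     mono_on J (\<lambda>t. pmin (F t)) \<and>
     (\<forall>a\<in>C0. \<forall>t0\<in>J. \<forall>t\<in>J.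
        interval_lebesgue_integrable lborel (ereal t0) (ereal t) (clust_rhs p F a) \<and>
        (LINT y|F t. a y) - (LINT y|F t0. a y) = (LBINT s=t0..t. clust_rhs p F a s))"

end

(* Write phi(z) for the integral of 1 / (1 - Q) from 0 to z, where Q is the generating function of p. Along a
   weak solution with min l the Laplace transform L satisfies dL = - exp (- q l) (1 - Q(L)) dt / (Q1 t), so
   that phi(L) decreases exactly by the integral of exp (- q l) dt / (Q1 t).

   Uniqueness: since phi(z) = z + O(z^2), the sum of F_t and the image of the clock dt / (Q1 t) under l is
   determined by the initial measure below twice the min of F_t. This is made quantitative with the kernel
   1 - exp (- exp (N (x - y))), a series of exponentials in y that approximates the indicator of y < x.

   Compactness: min paths are monotone, so by Helly's theorem they converge along a subsequence, and the
   separated equation then forces convergence of the Laplace transforms. The limit has no defect because a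
   finite mean makes phi blow up at 1. This gives continuous dependence on the data, and existence once
   approximate solutions are available. The latter are explicit Euler schemes on lattices, for which
   positivity is automatic. *)

theory Submission
  imports Defs
begin

section \<open>Laplace transforms of probability measures on the half line\<close>

text \<open>Two difficulties shape the proof. The min is not continuous under weak convergence,
  since the little mass that marks it may vanish in a limit, and as a function of time it may jump.
  The separated equation meets both. The min enters it only through an integral over time, so
  convergence outside countably many times suffices. Moreover the equation keeps the limiting path
  from lying below the min of the limit measure: clock time spent at levels below x after time t
  requires a Laplace transform at t of order at least exp (- q x).

  In the uniqueness argument one equation ties two unknowns together, the Laplace transform and the
  min path. They are told apart by position: the image of the clock up to t lies at or below l(t),
  whereas F_t lies at or above it. All of this is read off from rates of exponential decay as q
  tends to infinity.\<close>

definition lap :: "real measure \<Rightarrow> real \<Rightarrow> real" where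
  "lap M q = (LINT x|M. exp (- q * x))"

lemma prob_RplusD:
  assumes "prob_Rplus M"
  shows "real_distribution M" "prob_space M" "sets M = sets borel" "space M = UNIV" "AE x in M. 0 \<le> x"
proof -
  show M: "real_distribution M"
    using assms by (simp add: prob_Rplus_def)
  then interpret real_distribution M .
  show "prob_space M" "sets M = sets borel" "space M = UNIV"
    by (auto simp: prob_space_axioms)
  have "emeasure M {..<0} = 0"
    using assms by (simp add: prob_Rplus_def emeasure_eq_measure)
  then show "AE x in M. 0 \<le> x"
    by (intro AE_I[where N="{..<0}"]) auto
qed

lemma lap_integrable:
  assumes "prob_Rplus M" "0 \<le> q"
  shows "integrable M (\<lambda>x. exp (- q * x))"
proof -
  interpret real_distribution M by (rule prob_RplusD[OF assms(1)])
  show ?thesis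
    by (rule integrable_const_bound[where B=1])
      (use prob_RplusD(5)[OF assms(1)] assms(2) in \<open>auto elim!: eventually_mono\<close>)
qed

lemma lap_pos:
  assumes "prob_Rplus M" "0 \<le> q"
  shows "0 < lap M q"
proof -
  interpret real_distribution M by (rule prob_RplusD[OF assms(1)])
  show ?thesis
    unfolding lap_def by (rule expectation_greater[OF lap_integrable[OF assms]]) auto
qed

lemma lap_le_exp:
  assumes "prob_Rplus M" "0 \<le> q" "AE x in M. m \<le> x"
  shows "lap M q \<le> exp (- q * m)"
proof -
  interpret real_distribution M by (rule prob_RplusD[OF assms(1)])
  have "lap M q \<le> (LINT x|M. exp (- q * m))"
    unfolding lap_def
    by (intro integral_mono_AE lap_integrable assms)
      (use assms(2,3) in \<open>auto elim!: eventually_mono intro!: mult_left_mono\<close>)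
  also have "\<dots> = exp (- q * m)"
    by (simp add: prob_space[unfolded space_eq_univ])
  finally show ?thesis .
qed

lemma lap_le_1: "prob_Rplus M \<Longrightarrow> 0 \<le> q \<Longrightarrow> lap M q \<le> 1"
  using lap_le_exp[of M q 0] prob_RplusD(5)[of M] by simp

lemma lap_tendsto_1:
  assumes "prob_Rplus M"
  shows "(lap M \<longlongrightarrow> 1) (at_right 0)"
proof (rule tendsto_at_right_sequentially[where b=1])
  interpret real_distribution M by (rule prob_RplusD[OF assms(1)])
  fix S :: "nat \<Rightarrow> real" assume S: "\<And>n. 0 < S n" "S \<longlonglongrightarrow> 0"
  have "(\<lambda>n. LINT x|M. exp (- S n * x)) \<longlonglongrightarrow> (LINT x|M. 1)"
  proof (rule integral_dominated_convergence[where w="\<lambda>_. 1"])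
    have "(\<lambda>n. exp (- S n * x)) \<longlonglongrightarrow> exp (- 0 * x)" for x
      by (intro tendsto_intros S)
    then show "AE x in M. (\<lambda>n. exp (- S n * x)) \<longlonglongrightarrow> 1"
      by simp
    show "AE x in M. norm (exp (- S n * x)) \<le> 1" for n
      using prob_RplusD(5)[OF assms(1)] S(1)[of n] by (auto elim!: eventually_mono)
  qed auto
  then show "(\<lambda>n. lap M (S n)) \<longlonglongrightarrow> 1"
    by (simp add: lap_def prob_space[unfolded space_eq_univ])
qed simp

section \<open>The min and its recovery from the decay of the Laplace transform\<close>

lemma bdd_below_pmin: "bdd_below {x. 0 < measure M {0..x::real}}"
proof (rule bdd_belowI)
  fix x assume "x \<in> {x. 0 < measure M {0..x::real}}"
  then have "{0..x} \<noteq> {}" by (intro notI) simp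
  then show "0 \<le> x" by simp
qed

lemma pmin_AE:
  assumes "prob_Rplus M"
  shows "AE x in M. pmin M \<le> x"
proof -
  interpret real_distribution M by (rule prob_RplusD[OF assms(1)])
  \<comment> \<open>The levels stop short of \<open>pmin M\<close> itself, where there may be an
    atom; countably many of them exhaust what lies below.\<close>
  have *: "AE x in M. \<not> (0 \<le> x \<and> x \<le> pmin M - 1 / Suc n)" for n
  proof (rule AE_I)
    have "pmin M - 1 / Suc n \<notin> {x. 0 < measure M {0..x}}"
    proof
      assume "pmin M - 1 / Suc n \<in> {x. 0 < measure M {0..x}}"
      then have "pmin M \<le> pmin M - 1 / Suc n"
        unfolding pmin_def by (rule cInf_lower[OF _ bdd_below_pmin])
      then show False by (simp add: field_simps)
    qed
    then show "emeasure M {0..pmin M - 1 / Suc n} = 0"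
      by (simp add: emeasure_eq_measure zero_less_measure_iff)
  qed auto
  then have "AE x in M. \<forall>n. \<not> (0 \<le> x \<and> x \<le> pmin M - 1 / Suc n)"
    unfolding AE_all_countable by blast
  with prob_RplusD(5)[OF assms] show ?thesis
  proof eventually_elim
    case (elim x)
    show ?case
    proof (rule ccontr)
      assume "\<not> pmin M \<le> x"
      then obtain n where "1 / real (Suc n) < pmin M - x"
        using reals_Archimedean[of "pmin M - x"] by (auto simp: inverse_eq_divide)
      then show False
        using elim(1) elim(2)[rule_format, of n] by simp
    qed
  qed
qed

lemma measure_pmin_pos:
  assumes "prob_Rplus M" "pmin M < x"
  shows "0 < measure M {0..x}"
proof -
  interpret real_distribution M by (rule prob_RplusD[OF assms(1)])
  \<comment> \<open>The set whose \<open>Inf\<close> defines \<open>pmin\<close> must be known to be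
    nonempty, because \<open>Inf\<close> of the empty set carries no information.\<close>
  have "\<exists>y. 0 < measure M {0..y}"
  proof (rule ccontr)
    assume "\<not> ?thesis"
    then have "measure M {0..real n} = 0" for n
      by (simp add: zero_less_measure_iff)
    then have "AE x in M. \<not> (0 \<le> x \<and> x \<le> real n)" for n
      by (intro AE_I[where N="{0..real n}"]) (auto simp: emeasure_eq_measure)
    then have "AE x in M. \<forall>n. \<not> (0 \<le> x \<and> x \<le> real n)"
      unfolding AE_all_countable by blast
    with prob_RplusD(5)[OF assms(1)] have "AE x in M. False"
      by eventually_elim (use real_arch_simple in blast)
    then show False
      by simp
  qed
  then have "{x. 0 < measure M {0..x}} \<noteq> {}" by blast
  from cInf_lessD[OF this assms(2)[unfolded pmin_def]]
  obtain y where y: "0 < measure M {0..y}" "y < x"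
    by auto
  have "measure M {0..y} \<le> measure M {0..x}"
    using y by (intro finite_measure_mono) auto
  with y show ?thesis by simp
qed

lemma pmin_nonneg:
  assumes "prob_Rplus M"
  shows "0 \<le> pmin M"
proof (rule ccontr)
  assume "\<not> 0 \<le> pmin M"
  then show False
    using measure_pmin_pos[OF assms, of "pmin M / 2"] by simp
qed

lemma lap_le_pmin: "prob_Rplus M \<Longrightarrow> 0 \<le> q \<Longrightarrow> lap M q \<le> exp (- q * pmin M)"
  by (intro lap_le_exp pmin_AE)

lemma lap_less_1: "prob_Rplus M \<Longrightarrow> 0 < q \<Longrightarrow> 0 < pmin M \<Longrightarrow> lap M q < 1"
  using lap_le_pmin[of M q] by (smt (verit) exp_less_one_iff mult_minus_left mult_pos_pos)

lemma exp_real_tendsto_0: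
  assumes "0 < d"
  shows "(\<lambda>n. exp (- real n * d)) \<longlonglongrightarrow> 0"
proof -
  have "filterlim (\<lambda>n. d * real n) at_top sequentially"
    using assms filterlim_real_sequentially
    by (intro filterlim_tendsto_pos_mult_at_top[OF tendsto_const])
  then have "(\<lambda>n. exp (- (d * real n))) \<longlonglongrightarrow> 0"
    by (intro filterlim_compose[OF exp_at_bot]) (simp add: filterlim_uminus_at_bot)
  then show ?thesis by (simp add: mult.commute)
qed

text \<open>The common end of the arguments on decay rates in \<open>q\<close>. Only
  \<open>q\<close> at least 1 is asked for, because the constants \<open>C\<close> in the
  applications are uniform only away from 0.\<close>

lemma le_0_if_le_exp:
  fixes c :: real
  assumes "\<And>q. 1 \<le> q \<Longrightarrow> c \<le> C * exp (- q * d)" "0 < d"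
  shows "c \<le> 0"
proof -
  have "(\<lambda>n. C * exp (- real n * d)) \<longlonglongrightarrow> C * 0"
    using assms(2) by (intro tendsto_intros exp_real_tendsto_0)
  then have "c \<le> C * 0"
    by (rule tendsto_lowerbound) (use assms(1) in \<open>auto intro!: eventually_sequentiallyI[of 1]\<close>)
  then show ?thesis by simp
qed

lemma (in real_distribution) integrable_indicator_borel:
  "A \<in> sets borel \<Longrightarrow> integrable M (indicator A :: real \<Rightarrow> real)"
  by (intro integrable_real_indicator) (auto simp: less_top[symmetric])

text \<open>Mass c in \<open>{0..y}\<close> alone contributes c exp (- q y), which for y < x
  eventually exceeds any multiple of exp (- q x). With \<open>lap_le_pmin\<close> this identifies
  the min as the decay rate of the Laplace transform.\<close>

lemma le_pminI:
  assumes M: "prob_Rplus M" and *: "\<And>q. 1 \<le> q \<Longrightarrow> lap M q \<le> C * exp (- q * x)"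
  shows "x \<le> pmin M"
proof (rule ccontr)
  interpret real_distribution M by (rule prob_RplusD[OF M])
  assume "\<not> x \<le> pmin M"
  then obtain y where y: "pmin M < y" "y < x"
    using dense by (auto simp: not_le)
  define c where "c = measure M {0..y}"
  have c: "0 < c"
    unfolding c_def by (rule measure_pmin_pos[OF M y(1)])
  have le: "c \<le> C * exp (- q * (x - y))" if q: "1 \<le> q" for q
  proof -
    have "c * exp (- q * y) = (LINT z|M. indicator {0..y} z * exp (- q * y))"
      by (simp add: c_def)
    also have "\<dots> \<le> lap M q"
      unfolding lap_def
      by (intro integral_mono lap_integrable M integrable_mult_left integrable_indicator_borel)
        (use q in \<open>auto simp: indicator_def\<close>)
    also have "\<dots> \<le> C * exp (- q * x)"
      by (rule *) (use q in auto)
    finally show ?thesis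
      by (simp add: algebra_simps exp_diff exp_add exp_minus field_simps)
  qed
  from le_0_if_le_exp[OF le] y have "c \<le> 0" by simp
  with c show False by simp
qed

section \<open>The inversion kernel and uniqueness of Laplace transforms\<close>

text \<open>The kernel of the Phragmen-Doetsch inversion formula. Expanding the outer exponential
  gives a series in exp (- k N y) with k at least 1, so integrals of the kernel are computed from
  Laplace transforms at positive multiples of N.\<close>

definition mik :: "real \<Rightarrow> real \<Rightarrow> real \<Rightarrow> real" where
  "mik N x y = 1 - exp (- exp (N * (x - y)))"

lemma one_minus_exp_sums: "(\<lambda>k. (-1) ^ k / fact (Suc k) * u ^ Suc k) sums (1 - exp (- u))" for u :: real
proof -
  have "(\<lambda>n. (- u) ^ n /\<^sub>R fact n) sums exp (- u)"
    by (rule exp_converges)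
  then have "(\<lambda>n. (- u) ^ Suc n /\<^sub>R fact (Suc n)) sums (exp (- u) - 1)"
    by (subst sums_Suc_iff) simp
  then have "(\<lambda>n. - ((- u) ^ Suc n /\<^sub>R fact (Suc n))) sums - (exp (- u) - 1)"
    by (rule sums_minus)
  moreover have "- ((- u) ^ Suc n /\<^sub>R fact (Suc n)) = (-1) ^ n / fact (Suc n) * u ^ Suc n" for n
    by (subst power_minus) (simp add: divide_simps)
  ultimately show ?thesis by simp
qed

lemma exp_minus_one_sums: "(\<lambda>k. u ^ Suc k / fact (Suc k)) sums (exp u - 1)" for u :: real
proof -
  have "(\<lambda>n. u ^ n /\<^sub>R fact n) sums exp u"
    by (rule exp_converges)
  then have "(\<lambda>n. u ^ Suc n /\<^sub>R fact (Suc n)) sums (exp u - 1)"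
    by (subst sums_Suc_iff) simp
  then show ?thesis by (simp add: divide_inverse mult.commute)
qed

lemma mik_bounds: "0 \<le> mik N x y" "mik N x y \<le> 1"
  by (auto simp: mik_def)

lemma mik_ge: "0 \<le> N \<Longrightarrow> y \<le> c \<Longrightarrow> mik N x c \<le> mik N x y"
  by (auto simp: mik_def intro!: mult_left_mono)

lemma mik_le:
  assumes "0 \<le> N" "c \<le> y"
  shows "mik N x y \<le> exp (- N * (c - x))"
proof -
  have "mik N x y \<le> exp (N * (x - y))"
    unfolding mik_def using exp_ge_add_one_self[of "- exp (N * (x - y))"] by simp
  also have "\<dots> \<le> exp (- N * (c - x))"
    using mult_left_mono[OF assms(2,1)] by (simp add: algebra_simps)
  finally show ?thesis .
qed

lemma mik_tendsto_1:
  assumes "c < x"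
  shows "(\<lambda>n. mik (real n) x c) \<longlonglongrightarrow> 1"
proof -
  have "filterlim (\<lambda>n. (x - c) * real n) at_top sequentially"
    by (rule filterlim_tendsto_pos_mult_at_top[OF tendsto_const])
      (use assms filterlim_real_sequentially in auto)
  then have "filterlim (\<lambda>n. - exp (real n * (x - c))) at_bot sequentially"
    by (simp add: filterlim_uminus_at_bot mult.commute filterlim_compose[OF exp_at_top])
  then have "(\<lambda>n. 1 - exp (- exp (real n * (x - c)))) \<longlonglongrightarrow> 1 - 0"
    by (intro tendsto_intros filterlim_compose[OF exp_at_bot])
  then show ?thesis by (simp add: mik_def)
qed

text \<open>Termwise integration is justified by \<open>f\<close> being nonnegative: the series is
  dominated by that of exp u - 1 with u = exp (N x). The function \<open>f\<close> is general so
  that one statement serves the measures, with \<open>f\<close> the identity, and the clock, with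
  \<open>f\<close> the min path.\<close>

lemma mik_integral_sums:
  assumes "finite_measure M" and f[measurable]: "f \<in> borel_measurable M"
    and nn: "AE w in M. 0 \<le> f w" and N: "0 \<le> N"
  shows "(\<lambda>k. (-1) ^ k / fact (Suc k) * (exp (real (Suc k) * N * x) *
            (LINT w|M. exp (- (real (Suc k) * N) * f w)))) sums (LINT w|M. mik N x (f w))"
proof -
  interpret finite_measure M by fact
  define h where "h k w = (-1) ^ k / fact (Suc k) * (exp (real (Suc k) * N * x) *
            exp (- (real (Suc k) * N) * f w))" for k w
  have bound: "AE w in M. norm (exp (- (real (Suc k) * N) * f w)) \<le> 1" for k
    using nn by eventually_elim (use N in auto)
  have int: "integrable M (\<lambda>w. exp (- (real (Suc k) * N) * f w))" for k
    by (rule integrable_const_bound[OF bound]) auto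
  have h_eq: "h k w = (-1) ^ k / fact (Suc k) * exp (N * (x - f w)) ^ Suc k" for k w
    unfolding h_def exp_of_nat_mult[symmetric] exp_add[symmetric]
    by (simp add: algebra_simps)
  have h_sums: "(\<lambda>k. h k w) sums mik N x (f w)" for w
    unfolding h_eq mik_def by (rule one_minus_exp_sums)
  have "(\<lambda>k. LINT w|M. h k w) sums (LINT w|M. (\<Sum>k. h k w))"
  proof (rule sums_integral)
    show "integrable M (h k)" for k
      unfolding h_def using int[of k] by auto
    have "summable (\<lambda>k. norm (h k w))" for w
      using exp_minus_one_sums[of "exp (N * (x - f w))"]
      by (simp add: h_eq abs_mult power_abs sums_iff)
    then show "AE w in M. summable (\<lambda>k. norm (h k w))" by simp
    have "summable (\<lambda>k. exp (N * x) ^ Suc k / fact (Suc k) * measure M (space M))"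
      using exp_minus_one_sums[of "exp (N * x)"] by (intro summable_mult2) (simp add: sums_iff)
    moreover have "norm (LINT w|M. norm (h k w)) \<le> exp (N * x) ^ Suc k / fact (Suc k) * measure M (space M)" for k
    proof -
      have "norm (LINT w|M. norm (h k w)) = (LINT w|M. norm (h k w))"
        by simp
      also have "\<dots> \<le> (LINT w|M. exp (N * x) ^ Suc k / fact (Suc k))"
      proof (rule integral_mono_AE)
        show "integrable M (\<lambda>w. norm (h k w))"
          unfolding h_def using int[of k] by (intro integrable_norm) auto
        show "AE w in M. norm (h k w) \<le> exp (N * x) ^ Suc k / fact (Suc k)"
          using bound[of k]
        proof eventually_elim
          case (elim w)
          have "norm (h k w) = exp (real (Suc k) * N * x) / fact (Suc k) * exp (- (real (Suc k) * N) * f w)"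
            by (simp add: h_def abs_mult)
          also have "\<dots> \<le> exp (real (Suc k) * N * x) / fact (Suc k) * 1"
            using elim by (intro mult_left_mono) auto
          also have "\<dots> = exp (N * x) ^ Suc k / fact (Suc k)"
            by (simp only: exp_of_nat_mult[symmetric] mult.assoc mult_1_right)
          finally show ?case .
        qed
      qed auto
      also have "\<dots> = exp (N * x) ^ Suc k / fact (Suc k) * measure M (space M)"
        by (simp only: lebesgue_integral_const real_scaleR_def mult.commute)
      finally show ?thesis .
    qed
    ultimately show "summable (\<lambda>k. LINT w|M. norm (h k w))"
      by (rule summable_comparison_test'[where N=0])
  qed
  moreover have "(\<Sum>k. h k w) = mik N x (f w)" for w
    using h_sums by (simp add: sums_iff)
  ultimately show ?thesis
    by (simp add: h_def del: of_nat_Suc fact_Suc)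
qed

text \<open>A perturbation of Laplace transforms of size exp (- q L) is invisible below
  \<open>L\<close>: with u = exp (- N (L - x)) the terms are bounded by those of C (exp u - 1), and
  u tends to 0.\<close>

lemma mik_diff_tendsto_0:
  assumes bound: "\<And>q. 1 \<le> q \<Longrightarrow> \<bar>d q\<bar> \<le> C * exp (- q * L)" and x: "x < L"
    and D: "\<And>N. (\<lambda>k. (-1) ^ k / fact (Suc k) * (exp (real (Suc k) * real N * x) *
            d (real (Suc k) * real N))) sums D N"
  shows "D \<longlonglongrightarrow> 0"
proof (rule Lim_null_comparison)
  show "\<forall>\<^sub>F N in sequentially. norm (D N) \<le> C * (exp (exp (- real N * (L - x))) - 1)"
  proof (rule eventually_sequentiallyI[of 1])
    fix N :: nat assume N: "1 \<le> N"
    define u where "u = exp (- real N * (L - x))"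
    define a where "a k = (-1) ^ k / fact (Suc k) * (exp (real (Suc k) * real N * x) *
            d (real (Suc k) * real N))" for k
    have a_le: "norm (a k) \<le> C * (u ^ Suc k / fact (Suc k))" for k
    proof -
      have "norm (a k) = exp (real (Suc k) * real N * x) / fact (Suc k) * \<bar>d (real (Suc k) * real N)\<bar>"
        by (simp add: a_def abs_mult)
      also have "\<dots> \<le> exp (real (Suc k) * real N * x) / fact (Suc k) * (C * exp (- (real (Suc k) * real N) * L))"
      proof (intro mult_left_mono bound)
        have "1 * 1 \<le> real (Suc k) * real N"
          using N by (intro mult_mono) auto
        then show "1 \<le> real (Suc k) * real N" by simp
      qed auto
      also have "\<dots> = C * (exp (real (Suc k) * real N * x + - (real (Suc k) * real N) * L) / fact (Suc k))"
        by (simp add: exp_add[symmetric])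
      also have "real (Suc k) * real N * x + - (real (Suc k) * real N) * L = real (Suc k) * (- real N * (L - x))"
        by (simp add: algebra_simps)
      also have "exp \<dots> = u ^ Suc k"
        by (simp only: exp_of_nat_mult u_def)
      finally show ?thesis .
    qed
    have sm: "(\<lambda>k. C * (u ^ Suc k / fact (Suc k))) sums (C * (exp u - 1))"
      by (intro sums_mult exp_minus_one_sums)
    have "summable (\<lambda>k. norm (a k))"
      by (rule summable_comparison_test'[OF sums_summable[OF sm], of 0]) (use a_le in auto)
    then have "norm (suminf a) \<le> (\<Sum>k. norm (a k))"
      by (rule summable_norm)
    also have "\<dots> \<le> (\<Sum>k. C * (u ^ Suc k / fact (Suc k)))"
      by (intro suminf_le a_le \<open>summable (\<lambda>k. norm (a k))\<close> sums_summable[OF sm])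
    also have "\<dots> = C * (exp u - 1)"
      using sm by (simp add: sums_iff)
    also have "suminf a = D N"
      using D[of N] unfolding a_def by (rule sums_unique[symmetric])
    finally show "norm (D N) \<le> C * (exp (exp (- real N * (L - x))) - 1)"
      by (simp add: u_def)
  qed
  have "(\<lambda>N. C * (exp (exp (- real N * (L - x))) - 1)) \<longlonglongrightarrow> C * (exp 0 - 1)"
    using x by (intro tendsto_intros exp_real_tendsto_0) auto
  then show "(\<lambda>N. C * (exp (exp (- real N * (L - x))) - 1)) \<longlonglongrightarrow> 0"
    by simp
qed

text \<open>The kernel integrals of both measures agree. At a level z strictly between y and x the
  kernel tends to 1 at y and to 0 beyond x, which compares the masses of \<open>{..y}\<close> and
  \<open>{..x}\<close>; right continuity of the distribution function closes the gap between y and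
  x.\<close>

lemma lap_unique:
  assumes M: "prob_Rplus M" and N: "prob_Rplus N" and eq: "\<And>q. 0 < q \<Longrightarrow> lap M q = lap N q"
  shows "M = N"
proof -
  have le: "measure M {..y} \<le> measure N {..x}"
    if M: "prob_Rplus M" and N: "prob_Rplus N" and eq: "\<And>q. 0 < q \<Longrightarrow> lap M q = lap N q" and "y < x"
    for M N x y
  proof -
    interpret M: real_distribution M by (rule prob_RplusD[OF M])
    interpret N: real_distribution N by (rule prob_RplusD[OF N])
    obtain z where z: "y < z" "z < x"
      using \<open>y < x\<close> dense by blast
    have [measurable]: "mik n z \<in> borel_measurable borel" for n
      unfolding mik_def by measurable
    have int: "integrable M (mik n z)" "integrable N (mik n z)" for n
      by (rule M.integrable_const_bound[where B=1] N.integrable_const_bound[where B=1]; simp add: mik_bounds)+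
    have "measure M {..y} * mik (real n) z y \<le> measure N {..x} + exp (- real n * (x - z))" if n: "1 \<le> n" for n
    proof -
      have "measure M {..y} * mik (real n) z y = (LINT w|M. indicator {..y} w * mik (real n) z y)"
        by simp
      also have "\<dots> \<le> (LINT w|M. mik (real n) z w)"
        by (intro integral_mono int integrable_mult_left M.integrable_indicator_borel)
          (auto simp: indicator_def mik_bounds intro!: mik_ge)
      also have "\<dots> = (LINT w|N. mik (real n) z w)"
      proof -
        have *: "lap M (real (Suc k) * real n) = lap N (real (Suc k) * real n)" for k
          using n by (intro eq mult_pos_pos) auto
        have "(\<lambda>k. (-1) ^ k / fact (Suc k) * (exp (real (Suc k) * real n * z) *
            lap M (real (Suc k) * real n))) sums (LINT w|M. mik (real n) z w)"
          using mik_integral_sums[OF M.finite_measure_axioms _ prob_RplusD(5)[OF M], of "real n" z]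
          by (simp add: lap_def)
        moreover have "(\<lambda>k. (-1) ^ k / fact (Suc k) * (exp (real (Suc k) * real n * z) *
            lap N (real (Suc k) * real n))) sums (LINT w|N. mik (real n) z w)"
          using mik_integral_sums[OF N.finite_measure_axioms _ prob_RplusD(5)[OF N], of "real n" z]
          by (simp add: lap_def)
        ultimately show ?thesis
          unfolding * by (rule sums_unique2)
      qed
      also have "\<dots> \<le> (LINT w|N. indicator {..x} w + exp (- real n * (x - z)))"
      proof (intro integral_mono int Bochner_Integration.integrable_add N.integrable_indicator_borel N.integrable_const)
        show "mik (real n) z w \<le> indicator {..x} w + exp (- real n * (x - z))" for w
          using mik_bounds(2)[of "real n" z w] mik_le[of "real n" x w z]
          by (cases "w \<le> x") (simp_all add: add_increasing2)
      qed simp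
      also have "\<dots> = measure N {..x} + exp (- real n * (x - z))"
        by (subst Bochner_Integration.integral_add[OF N.integrable_indicator_borel N.integrable_const])
          (simp_all add: N.prob_space[unfolded N.space_eq_univ])
      finally show ?thesis .
    qed
    moreover have "(\<lambda>n. measure M {..y} * mik (real n) z y) \<longlonglongrightarrow> measure M {..y} * 1"
      using z by (intro tendsto_intros mik_tendsto_1)
    moreover have "(\<lambda>n. measure N {..x} + exp (- real n * (x - z))) \<longlonglongrightarrow> measure N {..x} + 0"
      using z by (intro tendsto_intros exp_real_tendsto_0) auto
    ultimately have "measure M {..y} * 1 \<le> measure N {..x} + 0"
      using LIMSEQ_le by blast
    then show ?thesis by simp
  qed
  have le2: "cdf M y \<le> cdf N y"
    if M: "prob_Rplus M" and N: "prob_Rplus N" and eq: "\<And>q. 0 < q \<Longrightarrow> lap M q = lap N q"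
    for M N y
  proof -
    interpret N: real_distribution N by (rule prob_RplusD[OF N])
    have "(cdf N \<longlongrightarrow> cdf N y) (at_right y)"
      using N.cdf_is_right_cont by (simp add: continuous_within)
    moreover have "\<forall>\<^sub>F x in at_right y. cdf M y \<le> cdf N x"
      using eventually_at_right_less[of y]
      by eventually_elim (use le[OF M N eq] in \<open>simp add: cdf_def\<close>)
    ultimately show ?thesis
      by (rule tendsto_lowerbound) simp
  qed
  show ?thesis
  proof (rule cdf_unique)
    show "cdf M = cdf N"
      using le2[OF M N] le2[OF N M] eq by (intro ext antisym) auto
  qed (use prob_RplusD(1) M N in blast)+
qed

section \<open>Weak convergence and the continuity theorem\<close>

lemma weak_conv_integral:
  assumes "\<And>n. prob_Rplus (M n)" "real_distribution N" "weak_conv_m M N"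
    and "continuous_on UNIV f" "\<And>x. \<bar>f x\<bar> \<le> B"
  shows "(\<lambda>n. LINT x|M n. f x) \<longlonglongrightarrow> (LINT x|N. f (x::real) :: real)"
  by (rule weak_conv_imp_bdd_ae_continuous_conv[OF prob_RplusD(1)[OF assms(1)] assms(2,3), where B=B])
    (use assms(4,5) in \<open>auto simp: continuous_on_eq_continuous_at intro: borel_measurable_continuous_onI\<close>)

lemma weak_limit_prob_Rplus:
  assumes M: "\<And>n. prob_Rplus (M n)" and N: "real_distribution N" and conv: "weak_conv_m M N"
  shows "prob_Rplus N"
proof -
  interpret N: real_distribution N by fact
  \<comment> \<open>A bounded continuous function that vanishes exactly on the half line; its
    integral in the limit detects negative mass.\<close>
  define f where "f x = min 1 (max (- x) 0)" for x :: real
  have f: "continuous_on UNIV f" "\<And>x. \<bar>f x\<bar> \<le> 1"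
    by (auto simp: f_def intro!: continuous_intros)
  then have [measurable]: "f \<in> borel_measurable borel"
    by (intro borel_measurable_continuous_onI)
  have "(LINT x|M n. f x) = 0" for n
  proof -
    interpret real_distribution "M n" by (rule prob_RplusD[OF M])
    have "AE x in M n. f x = 0"
      using prob_RplusD(5)[OF M[of n]] by eventually_elim (simp add: f_def)
    then have "(LINT x|M n. f x) = (LINT x|M n. 0)"
      by (intro integral_cong_AE) auto
    then show ?thesis by simp
  qed
  then have "(LINT x|N. f x) = 0"
    using weak_conv_integral[OF M N conv f] by (simp add: LIMSEQ_const_iff)
  moreover have "integrable N f"
    by (rule N.integrable_const_bound[where B=1]) (use f in auto)
  ultimately have "AE x in N. f x = 0"
    by (subst (asm) integral_nonneg_eq_0_iff_AE) (auto simp: f_def)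
  then have "AE x in N. x \<notin> {..<0}"
    by eventually_elim (auto simp: f_def min_def max_def split: if_splits)
  then have "measure N {..<0} = 0"
    using N.prob_eq_0[of "{..<0}"] by simp
  with N show ?thesis by (simp add: prob_Rplus_def)
qed

lemma weak_conv_lap:
  assumes M: "\<And>n. prob_Rplus (M n)" and N: "prob_Rplus N" and conv: "weak_conv_m M N" and q: "0 \<le> q"
  shows "(\<lambda>n. lap (M n) q) \<longlonglongrightarrow> lap N q"
proof -
  \<comment> \<open>Truncating at 0 makes the exponential bounded on the whole line and changes it
    only on a null set.\<close>
  define f where "f x = exp (- q * max x 0)" for x :: real
  have f: "continuous_on UNIV f" "\<And>x. \<bar>f x\<bar> \<le> 1"
    using q by (auto simp: f_def intro!: continuous_intros)
  then have [measurable]: "f \<in> borel_measurable borel"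
    by (intro borel_measurable_continuous_onI)
  have "lap N q = (LINT x|N. f x)" if "prob_Rplus N" for N
  proof -
    interpret real_distribution N by (rule prob_RplusD[OF that])
    have "AE x in N. exp (- q * x) = f x"
      using prob_RplusD(5)[OF that] by eventually_elim (simp add: f_def)
    then show ?thesis
      unfolding lap_def by (intro integral_cong_AE) auto
  qed
  then show ?thesis
    using weak_conv_integral[OF M prob_RplusD(1)[OF N] conv f] M N by simp
qed

text \<open>Markov's inequality for 1 - exp (- q x), which is at least 1/2 beyond ln 2 / q.\<close>

lemma lap_measure_le:
  assumes M: "prob_Rplus M" and q: "0 < q"
  shows "measure M {..ln 2 / q} \<ge> 1 - 2 * (1 - lap M q)"
proof -
  interpret real_distribution M by (rule prob_RplusD[OF M])
  define b where "b = ln 2 / q"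
  have "1 - lap M q = (LINT x|M. 1 - exp (- q * x))"
    unfolding lap_def using lap_integrable[OF M, of q] q
    by (subst Bochner_Integration.integral_diff) (auto simp: prob_space[unfolded space_eq_univ])
  also have "\<dots> \<ge> (LINT x|M. indicator {b<..} x * (1/2))"
  proof (rule integral_mono_AE)
    show "integrable M (\<lambda>x. 1 - exp (- q * x))"
      using lap_integrable[OF M, of q] q by auto
    show "AE x in M. indicator {b<..} x * (1 / 2) \<le> 1 - exp (- q * x)"
      using prob_RplusD(5)[OF M]
    proof eventually_elim
      case (elim x)
      show ?case
      proof (cases "b < x")
        case True
        then have "ln 2 \<le> q * x"
          using q by (simp add: b_def field_simps)
        then have "exp (- q * x) \<le> exp (- ln 2)" by simp
        also have "\<dots> = 1 / 2" by (simp add: exp_minus inverse_eq_divide)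
        finally show ?thesis using True by simp
      qed (use elim q in auto)
    qed
  qed (auto intro!: integrable_mult_left integrable_indicator_borel)
  finally have "measure M {b<..} \<le> 2 * (1 - lap M q)"
    by simp
  moreover have "measure M {..b} = 1 - measure M {b<..}"
    using prob_compl[of "{b<..}"] by (simp add: Compl_eq_Diff_UNIV[symmetric])
  ultimately show ?thesis by (simp add: b_def)
qed

text \<open>For a small \<open>q\<close> the limit is so close to 1 that
  \<open>lap_measure_le\<close> bounds all tails from some index on at the same point ln 2 / q. The
  finitely many remaining measures are tight one by one.\<close>

lemma tight_lap:
  assumes M: "\<And>n. prob_Rplus (M n)" and L: "\<And>q. 0 < q \<Longrightarrow> (\<lambda>n. lap (M n) q) \<longlonglongrightarrow> L q"
    and L1: "(L \<longlongrightarrow> 1) (at_right 0)"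
  shows "tight M"
  unfolding tight_def
proof (intro conjI allI impI)
  show "real_distribution (M n)" for n
    by (rule prob_RplusD[OF M])
  fix e :: real assume e: "0 < e"
  have "\<forall>\<^sub>F q in at_right 0. L q > 1 - e / 4"
    by (rule order_tendstoD(1)[OF L1]) (use e in auto)
  moreover have "\<forall>\<^sub>F q in at_right 0. (0::real) < q"
    by (rule eventually_at_right_less)
  ultimately have "\<exists>q. L q > 1 - e / 4 \<and> 0 < q"
    by (intro eventually_happens'[OF trivial_limit_at_right_real] eventually_conj)
  then obtain q where q: "L q > 1 - e / 4" "0 < q" by blast
  have "\<forall>\<^sub>F n in sequentially. lap (M n) q > 1 - e / 4"
    by (rule order_tendstoD(1)[OF L q(1)]) (use q in auto)
  then obtain n0 where n0: "\<And>n. n0 \<le> n \<Longrightarrow> lap (M n) q > 1 - e / 4"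
    by (auto simp: eventually_sequentially)
  have "\<exists>b. measure (M n) {..b} > 1 - e" for n
  proof -
    interpret real_distribution "M n" by (rule prob_RplusD[OF M])
    have "\<forall>\<^sub>F b in at_top. cdf (M n) b > 1 - e"
      by (rule order_tendstoD(1)[OF cdf_lim_at_top_prob]) (use e in auto)
    then show ?thesis
      by (auto simp: cdf_def eventually_at_top_linorder)
  qed
  then obtain b where b: "\<And>n. measure (M n) {..b n} > 1 - e" by metis
  define c where "c = Max (insert 0 (insert (ln 2 / q) (b ` {..<n0})))"
  have c: "0 \<le> c" "ln 2 / q \<le> c" "\<And>n. n < n0 \<Longrightarrow> b n \<le> c"
    unfolding c_def by (rule Max_ge; force)+
  \<comment> \<open>Tightness is phrased with intervals open on the left, and an atom at 0 has to be
    kept; hence a left end below 0.\<close>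
  have "1 - e < measure (M n) {-1<..c}" for n
  proof -
    interpret real_distribution "M n" by (rule prob_RplusD[OF M])
    have "1 - e < measure (M n) {..c}"
    proof (cases "n < n0")
      case True
      note b[of n]
      also have "measure (M n) {..b n} \<le> measure (M n) {..c}"
        by (intro finite_measure_mono) (use c(3) True in auto)
      finally show ?thesis .
    next
      case False
      have "1 - e < 1 - 2 * (1 - lap (M n) q)"
        using n0[of n] False e by simp
      also have "\<dots> \<le> measure (M n) {..ln 2 / q}"
        by (rule lap_measure_le[OF M q(2)])
      also have "\<dots> \<le> measure (M n) {..c}"
        by (intro finite_measure_mono) (use c(2) in auto)
      finally show ?thesis .
    qed
    also have "measure (M n) {..c} = measure (M n) {-1<..c}"
      by (intro measure_eq_AE) (use prob_RplusD(5)[OF M[of n]] in \<open>auto elim!: eventually_mono\<close>)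
    finally show ?thesis .
  qed
  then show "\<exists>a b. a < b \<and> (\<forall>n. 1 - e < measure (M n) {a<..b})"
    using c(1) by (intro exI[of _ "-1"] exI[of _ c]) auto
qed

text \<open>Continuity of \<open>L\<close> at 0 excludes escape of mass to infinity and so gives
  tightness; all subsequential limits have the transform \<open>L\<close> and therefore
  coincide.\<close>

lemma lap_continuity:
  assumes M: "\<And>n. prob_Rplus (M n)" and L: "\<And>q. 0 < q \<Longrightarrow> (\<lambda>n. lap (M n) q) \<longlonglongrightarrow> L q"
    and L1: "(L \<longlongrightarrow> 1) (at_right 0)"
  obtains N where "prob_Rplus N" "weak_conv_m M N" "\<And>q. 0 < q \<Longrightarrow> lap N q = L q"
proof -
  have tight: "tight M"
    by (rule tight_lap[OF M L L1])
  have lapN: "prob_Rplus N \<and> (\<forall>q>0. lap N q = L q)"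
    if "strict_mono r" "real_distribution N" "weak_conv_m (M \<circ> r) N" for r N
  proof -
    have N: "prob_Rplus N"
      by (rule weak_limit_prob_Rplus[OF _ that(2,3)]) (simp add: M)
    moreover have "lap N q = L q" if q: "0 < q" for q
    proof (rule LIMSEQ_unique)
      show "(\<lambda>n. lap ((M \<circ> r) n) q) \<longlonglongrightarrow> lap N q"
        by (rule weak_conv_lap[OF _ N \<open>weak_conv_m (M \<circ> r) N\<close>]) (use M q in auto)
      show "(\<lambda>n. lap ((M \<circ> r) n) q) \<longlonglongrightarrow> L q"
        using LIMSEQ_subseq_LIMSEQ[OF L[OF q] \<open>strict_mono r\<close>] by (simp add: o_def)
    qed
    ultimately show ?thesis by blast
  qed
  obtain r N where r: "strict_mono r" "real_distribution N" "weak_conv_m (M \<circ> id \<circ> r) N"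
    using tight_imp_convergent_subsubsequence[OF tight strict_mono_id] by blast
  then have N: "prob_Rplus N" "\<And>q. 0 < q \<Longrightarrow> lap N q = L q"
    using lapN[of r N] by auto
  have "weak_conv_m M N"
  proof (rule tight_subseq_weak_converge[OF prob_RplusD(1)[OF M] r(2) tight])
    fix s N' assume s: "strict_mono s" "real_distribution N'" "weak_conv_m (M \<circ> s) N'"
    have "N' = N"
      by (rule lap_unique) (use lapN[OF s] N in auto)
    with s show "weak_conv_m (M \<circ> s) N" by simp
  qed
  with N that show ?thesis by blast
qed

lemma lap_conv_imp_weak_conv:
  assumes M: "\<And>n. prob_Rplus (M n)" and N: "prob_Rplus N"
    and L: "\<And>q. 0 < q \<Longrightarrow> (\<lambda>n. lap (M n) q) \<longlonglongrightarrow> lap N q"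
  shows "weak_conv_m M N"
proof -
  obtain N' where N': "prob_Rplus N'" "weak_conv_m M N'" "\<And>q. 0 < q \<Longrightarrow> lap N' q = lap N q"
    using lap_continuity[OF M L lap_tendsto_1[OF N]] by blast
  have "N' = N"
    by (rule lap_unique[OF N'(1) N N'(3)])
  with N' show ?thesis by simp
qed

section \<open>The generating function and its separating integral\<close>

locale min_clustering =
  fixes p :: "nat \<Rightarrow> real"
  assumes p_nonneg: "0 \<le> p (Suc k)"
    and p_sum: "(\<lambda>k. p (Suc k)) sums 1"
    and p_mean: "summable (\<lambda>k. real (Suc k) * p (Suc k))"
begin

definition gen :: "real \<Rightarrow> real" where
  "gen z = (\<Sum>k. p (Suc k) * z ^ Suc k)"

lemma p_summable: "summable (\<lambda>k. p (Suc k))"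
  using p_sum by (rule sums_summable)

lemma gen_summable:
  assumes "0 \<le> z" "z \<le> 1"
  shows "summable (\<lambda>k. p (Suc k) * z ^ Suc k)"
  by (rule summable_comparison_test'[OF p_summable, of 0])
    (use assms p_nonneg in \<open>auto simp: abs_mult power_le_one mult_left_le simp del: power_Suc\<close>)

lemma gen_0 [simp]: "gen 0 = 0"
  by (simp add: gen_def)

lemma gen_1 [simp]: "gen 1 = 1"
  using p_sum by (simp add: gen_def sums_iff)

lemma gen_mono:
  assumes "0 \<le> a" "a \<le> b" "b \<le> 1"
  shows "gen a \<le> gen b"
  unfolding gen_def
  by (intro suminf_le gen_summable mult_left_mono power_mono p_nonneg) (use assms in auto)

lemma gen_le:
  assumes "0 \<le> z" "z \<le> 1"
  shows "gen z \<le> z"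
proof -
  have "gen z \<le> (\<Sum>k. p (Suc k) * z)"
    unfolding gen_def
  proof (intro suminf_le gen_summable mult_left_mono p_nonneg)
    show "z ^ Suc k \<le> z" for k
      using assms power_le_one[of z k] by (simp add: mult_left_le)
  qed (use assms p_summable in \<open>auto intro: summable_mult2\<close>)
  also have "\<dots> = z"
    using sums_mult2[OF p_sum, of z] by (simp add: sums_iff)
  finally show ?thesis .
qed

lemma gen_nonneg: "0 \<le> z \<Longrightarrow> z \<le> 1 \<Longrightarrow> 0 \<le> gen z"
  using gen_mono[of 0 z] by simp

lemma Q1_ge_1: "1 \<le> Q1 p"
proof -
  have "(\<Sum>k. p (Suc k)) \<le> (\<Sum>k. real (Suc k) * p (Suc k))"
    by (intro suminf_le p_summable p_mean) (use p_nonneg in \<open>simp add: algebra_simps\<close>)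
  then show ?thesis
    using p_sum by (simp add: Q1_def sums_iff)
qed

lemma Q1_pos: "0 < Q1 p"
  using Q1_ge_1 by simp

text \<open>Here the finite mean enters: \<open>Q1 p\<close> is the slope of the convex function
  \<open>gen\<close> at 1, its largest slope on the unit interval.\<close>

lemma gen_diff_le:
  assumes "0 \<le> a" "a \<le> b" "b \<le> 1"
  shows "gen b - gen a \<le> Q1 p * (b - a)"
proof -
  have pw: "b ^ n - a ^ n \<le> real n * (b - a)" for n
  proof (induction n)
    case (Suc n)
    have "b ^ Suc n - a ^ Suc n = b * (b ^ n - a ^ n) + (b - a) * a ^ n"
      by (simp add: algebra_simps)
    also have "\<dots> \<le> 1 * (b ^ n - a ^ n) + (b - a) * 1"
      by (intro add_mono mult_mono mult_left_mono) (use assms in \<open>auto simp: power_le_one power_mono\<close>)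
    also have "\<dots> \<le> real (Suc n) * (b - a)"
      using Suc by (simp add: algebra_simps)
    finally show ?case .
  qed simp
  have "gen b - gen a = (\<Sum>k. p (Suc k) * b ^ Suc k - p (Suc k) * a ^ Suc k)"
    unfolding gen_def by (intro suminf_diff gen_summable) (use assms in auto)
  also have "\<dots> \<le> (\<Sum>k. real (Suc k) * p (Suc k) * (b - a))"
  proof (intro suminf_le)
    show "p (Suc k) * b ^ Suc k - p (Suc k) * a ^ Suc k \<le> real (Suc k) * p (Suc k) * (b - a)" for k
      using mult_left_mono[OF pw[of "Suc k"] p_nonneg[of k]] by (simp only: algebra_simps)
  qed (use assms p_mean in \<open>auto intro!: summable_diff gen_summable summable_mult2 simp del: power_Suc of_nat_Suc\<close>)
  also have "\<dots> = Q1 p * (b - a)"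
    unfolding Q1_def by (rule suminf_mult2[OF p_mean, symmetric])
  finally show ?thesis .
qed

lemma gen_lipschitz:
  assumes "a \<in> {0..1}" "b \<in> {0..1}"
  shows "\<bar>gen b - gen a\<bar> \<le> Q1 p * \<bar>b - a\<bar>"
  using assms gen_diff_le[of a b] gen_diff_le[of b a] gen_mono[of a b] gen_mono[of b a]
  by (cases "a \<le> b") auto

lemma continuous_on_gen: "continuous_on {0..1} gen"
proof (rule lipschitz_on_continuous_on)
  show "(Q1 p)-lipschitz_on {0..1} gen"
    using Q1_pos gen_lipschitz by (intro lipschitz_onI) (auto simp: dist_real_def)
qed

lemma one_minus_gen_pos: "0 \<le> z \<Longrightarrow> z < 1 \<Longrightarrow> 0 < 1 - gen z"
  using gen_le[of z] by simp

section \<open>The separating integral\<close>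

text \<open>Meant for arguments in \<open>{0..<1}\<close>. It increases to infinity at 1, and at 1
  itself the divergent integral takes the default value 0, so strict bounds below 1 are carried
  along throughout.\<close>

definition phi :: "real \<Rightarrow> real" where
  "phi z = integral {0..z} (\<lambda>x. 1 / (1 - gen x))"

lemma phi_integrand_integrable:
  assumes "0 \<le> a" "b < 1"
  shows "(\<lambda>x. 1 / (1 - gen x)) integrable_on {a..b}"
proof (rule integrable_continuous_real)
  have "continuous_on {a..b} gen"
    by (rule continuous_on_subset[OF continuous_on_gen]) (use assms in auto)
  moreover have "1 - gen x \<noteq> 0" if "x \<in> {a..b}" for x
    using one_minus_gen_pos[of x] that assms by auto
  ultimately show "continuous_on {a..b} (\<lambda>x. 1 / (1 - gen x))"
    by (auto intro!: continuous_intros)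
qed

lemma phi_0 [simp]: "phi 0 = 0"
  by (simp add: phi_def)

lemma phi_diff:
  assumes "0 \<le> a" "a \<le> b" "b < 1"
  shows "phi b - phi a = integral {a..b} (\<lambda>x. 1 / (1 - gen x))"
  using Henstock_Kurzweil_Integration.integral_combine
    [OF assms(1,2) phi_integrand_integrable[of 0 b]] assms
  by (simp add: phi_def)

text \<open>The integrand is increasing because \<open>gen\<close> is. These two-sided bounds take
  the place of derivatives of \<open>phi\<close> when increments are compared.\<close>

lemma phi_diff_bounds:
  assumes "0 \<le> a" "a \<le> b" "b < 1"
  shows "(b - a) / (1 - gen a) \<le> phi b - phi a" "phi b - phi a \<le> (b - a) / (1 - gen b)"
proof -
  have int: "(\<lambda>x. 1 / (1 - gen x)) integrable_on {a..b}"
    using assms by (intro phi_integrand_integrable) auto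
  have b: "1 / (1 - gen a) \<le> 1 / (1 - gen x)" "1 / (1 - gen x) \<le> 1 / (1 - gen b)"
    if "x \<in> {a..b}" for x
    using that assms gen_mono[of a x] gen_mono[of x b] one_minus_gen_pos[of a]
      one_minus_gen_pos[of b] one_minus_gen_pos[of x]
    by (auto intro!: divide_left_mono mult_pos_pos)
  have "integral {a..b} (\<lambda>x. 1 / (1 - gen a)) \<le> integral {a..b} (\<lambda>x. 1 / (1 - gen x))"
    by (intro integral_le int) (use b in auto)
  then show "(b - a) / (1 - gen a) \<le> phi b - phi a"
    using assms by (simp add: phi_diff)
  have "integral {a..b} (\<lambda>x. 1 / (1 - gen x)) \<le> integral {a..b} (\<lambda>x. 1 / (1 - gen b))"
    by (intro integral_le int) (use b in auto)
  then show "phi b - phi a \<le> (b - a) / (1 - gen b)"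
    using assms by (simp add: phi_diff)
qed

lemma phi_diff_ge:
  assumes "0 \<le> a" "a \<le> b" "b < 1"
  shows "b - a \<le> phi b - phi a"
proof -
  have "0 \<le> gen a" "gen a < 1"
    using assms gen_nonneg[of a] one_minus_gen_pos[of a] by auto
  then have "b - a \<le> (b - a) / (1 - gen a)"
    using assms by (simp add: pos_le_divide_eq mult_left_le)
  with phi_diff_bounds(1)[OF assms] show ?thesis by simp
qed

text \<open>The integrand is at least 1, so \<open>phi\<close> is expanding: convergence of the
  values of \<open>phi\<close> carries over to its arguments, and \<open>phi\<close> is
  injective.\<close>

lemma phi_abs_diff_ge:
  assumes "a \<in> {0..<1}" "b \<in> {0..<1}"
  shows "\<bar>b - a\<bar> \<le> \<bar>phi b - phi a\<bar>"
  using phi_diff_ge[of a b] phi_diff_ge[of b a] assms by (cases "a \<le> b") auto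

lemma phi_inj: "inj_on phi {0..<1}"
  using phi_abs_diff_ge by (force intro!: inj_onI)

lemma phi_mono: "0 \<le> a \<Longrightarrow> a \<le> b \<Longrightarrow> b < 1 \<Longrightarrow> phi a \<le> phi b"
  using phi_diff_ge[of a b] by simp

lemma phi_nonneg: "0 \<le> z \<Longrightarrow> z < 1 \<Longrightarrow> 0 \<le> phi z"
  using phi_mono[of 0 z] by simp

lemma phi_ge: "0 \<le> z \<Longrightarrow> z < 1 \<Longrightarrow> z \<le> phi z"
  using phi_diff_ge[of 0 z] by simp

lemma phi_le:
  assumes "0 \<le> z" "z < 1"
  shows "phi z \<le> z / (1 - z)"
proof -
  have "phi z \<le> z / (1 - gen z)"
    using phi_diff_bounds(2)[of 0 z] assms by simp
  also have "\<dots> \<le> z / (1 - z)"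
    using assms gen_le[of z] by (intro divide_left_mono mult_pos_pos) auto
  finally show ?thesis .
qed

lemma continuous_on_phi: "b < 1 \<Longrightarrow> continuous_on {0..b} phi"
  unfolding phi_def
  by (rule indefinite_integral_continuous_1[OF phi_integrand_integrable]) auto

text \<open>Finiteness of the mean makes \<open>phi\<close> blow up logarithmically at 1, which prevents
  loss of mass at infinity.\<close>
lemma phi_diff_ge_ln:
  assumes "0 \<le> a" "a \<le> b" "b < 1"
  shows "ln ((1 - a) / (1 - b)) \<le> Q1 p * (phi b - phi a)"
proof -
  have "((\<lambda>x. 1 / (1 - x)) has_integral (- ln (1 - b)) - (- ln (1 - a))) {a..b}"
  proof (rule fundamental_theorem_of_calculus)
    show "((\<lambda>x. - ln (1 - x)) has_vector_derivative 1 / (1 - x)) (at x within {a..b})"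
      if "x \<in> {a..b}" for x
      unfolding has_real_derivative_iff_has_vector_derivative[symmetric]
      using that assms by (auto intro!: derivative_eq_intros simp: field_simps)
  qed (use assms in auto)
  then have int: "(\<lambda>x. 1 / (1 - x)) integrable_on {a..b}"
    and "ln ((1 - a) / (1 - b)) = integral {a..b} (\<lambda>x. 1 / (1 - x))"
    using assms by (auto simp: ln_div has_integral_iff)
  note this(2)
  also have "integral {a..b} (\<lambda>x. 1 / (1 - x)) \<le> integral {a..b} (\<lambda>x. Q1 p * (1 / (1 - gen x)))"
  proof (intro integral_le int integrable_on_mult_right phi_integrand_integrable)
    fix x assume x: "x \<in> {a..b}"
    have "1 - gen x \<le> Q1 p * (1 - x)"
      using gen_diff_le[of x 1] x assms by auto
    moreover have "0 < 1 - gen x" "0 < 1 - x"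
      using one_minus_gen_pos[of x] x assms by auto
    ultimately show "1 / (1 - x) \<le> Q1 p * (1 / (1 - gen x))"
      by (simp add: field_simps)
  qed (use assms in auto)
  also have "\<dots> = Q1 p * (phi b - phi a)"
    using assms by (subst integral_mult_right) (simp add: phi_diff)
  finally show ?thesis .
qed

lemma phi_surj:
  assumes "0 \<le> w" "w \<le> phi b" "0 \<le> b" "b < 1"
  obtains z where "0 \<le> z" "z \<le> b" "phi z = w"
  using IVT'[of phi 0 w b] assms continuous_on_phi[of b] by auto

end

section \<open>The clock and the separated equation\<close>

text \<open>Increments of second order make the difference quotients tend to 0, so the derivative
  exists and vanishes, one-sided at the two ends.\<close>

lemma quadratic_increment_const:
  fixes f :: "real \<Rightarrow> real"
  assumes "\<And>s t. a \<le> s \<Longrightarrow> s \<le> t \<Longrightarrow> t \<le> b \<Longrightarrow> \<bar>f t - f s\<bar> \<le> C * (t - s)\<^sup>2"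
    and "s \<in> {a..b}" "t \<in> {a..b}"
  shows "f s = f t"
proof -
  have "(f has_field_derivative 0) (at x within {a..b})" if x: "x \<in> {a..b}" for x
    unfolding has_field_derivative_iff
  proof (rule Lim_null_comparison)
    have "norm ((f y - f x) / (y - x)) \<le> C * \<bar>y - x\<bar>" if y: "y \<in> {a..b}" "y \<noteq> x" for y
    proof -
      have "\<bar>f y - f x\<bar> \<le> C * (y - x)\<^sup>2"
        using assms(1)[of x y] assms(1)[of y x] x y
        by (cases "x \<le> y") (auto simp: abs_minus_commute power2_commute)
      also have "(y - x)\<^sup>2 = \<bar>y - x\<bar> * \<bar>y - x\<bar>"
        by (simp add: power2_eq_square)
      finally show ?thesis
        using y by (simp add: divide_simps mult.assoc)
    qed
    then show "\<forall>\<^sub>F y in at x within {a..b}. norm ((f y - f x) / (y - x)) \<le> C * \<bar>y - x\<bar>"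
      by (auto simp: eventually_at_filter)
    show "((\<lambda>y. C * \<bar>y - x\<bar>) \<longlongrightarrow> 0) (at x within {a..b})"
      by (auto intro!: tendsto_eq_intros)
  qed
  then show ?thesis
    using has_field_derivative_zero_constant[of "{a..b}" f] assms(2,3) by fastforce
qed

lemma set_integrable_imp_interval:
  fixes a b :: real
  assumes "a \<le> b" "set_integrable lborel {a..b} f"
  shows "interval_lebesgue_integrable lborel (ereal a) (ereal b) f"
proof -
  have "set_integrable lborel {a<..<b} f"
    by (rule set_integrable_subset[OF assms(2)]) auto
  then show ?thesis
    using assms(1) by (simp add: interval_lebesgue_integrable_def)
qed

context min_clustering
begin

text \<open>Encoded as a measure, so that the integral of exp (- q l) against it is the Laplace
  transform of its image under l, and the inversion kernel applies to it in the same way as to a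
  probability measure.\<close>

definition clock :: "real \<Rightarrow> real \<Rightarrow> real measure" where
  "clock a b = density lborel (\<lambda>s. ennreal (indicator {a..b} s / (Q1 p * s)))"

lemma sets_clock [simp, measurable_cong]: "sets (clock a b) = sets borel"
  and space_clock [simp]: "space (clock a b) = UNIV"
  by (auto simp: clock_def)

lemma clock_weight_has_integral:
  assumes "0 < a" "a \<le> b"
  shows "((\<lambda>s. 1 / (Q1 p * s)) has_integral ln (b / a) / Q1 p) {a..b}"
proof -
  have "((\<lambda>s. 1 / (Q1 p * s)) has_integral ln b / Q1 p - ln a / Q1 p) {a..b}"
  proof (rule fundamental_theorem_of_calculus)
    show "((\<lambda>s. ln s / Q1 p) has_vector_derivative 1 / (Q1 p * s)) (at s within {a..b})"
      if "s \<in> {a..b}" for s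
      unfolding has_real_derivative_iff_has_vector_derivative[symmetric]
      using that assms Q1_pos by (auto intro!: derivative_eq_intros simp: field_simps)
  qed fact
  then show ?thesis
    using assms by (simp add: ln_div diff_divide_distrib)
qed

lemma clock_weight_integrable:
  assumes "0 < a" "a \<le> b"
  shows "integrable lborel (\<lambda>s. indicator {a..b} s / (Q1 p * s))"
    "(LINT s|lborel. indicator {a..b} s / (Q1 p * s)) = ln (b / a) / Q1 p"
proof -
  have "continuous_on {a..b} (\<lambda>s. 1 / (Q1 p * s))"
    using assms Q1_pos by (intro continuous_intros) auto
  then have int: "set_integrable lborel {a..b} (\<lambda>s. 1 / (Q1 p * s))"
    by (rule borel_integrable_atLeastAtMost')
  then show "integrable lborel (\<lambda>s. indicator {a..b} s / (Q1 p * s))"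
    by (simp add: set_integrable_def)
  have "(LINT s:{a..b}|lborel. 1 / (Q1 p * s)) = ln (b / a) / Q1 p"
    using set_borel_integral_eq_integral(2)[OF int] clock_weight_has_integral[OF assms]
    by (simp add: has_integral_iff)
  then show "(LINT s|lborel. indicator {a..b} s / (Q1 p * s)) = ln (b / a) / Q1 p"
    by (simp add: set_lebesgue_integral_def)
qed

lemma clock_weight_nonneg: "0 < a \<Longrightarrow> 0 \<le> indicator {a..b} s / (Q1 p * s)"
  using Q1_pos by (auto simp: indicator_def)

lemma finite_measure_clock:
  assumes "0 < a" "a \<le> b"
  shows "finite_measure (clock a b)"
    and measure_clock: "measure (clock a b) UNIV = ln (b / a) / Q1 p"
proof -
  have "emeasure (clock a b) UNIV = (\<integral>\<^sup>+s. ennreal (indicator {a..b} s / (Q1 p * s)) \<partial>lborel)"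
    unfolding clock_def by (subst emeasure_density) auto
  also have "\<dots> = ennreal (ln (b / a) / Q1 p)"
    using clock_weight_nonneg[of a b] assms
    by (subst nn_integral_eq_integral) (auto simp: clock_weight_integrable)
  finally have *: "emeasure (clock a b) UNIV = ennreal (ln (b / a) / Q1 p)" .
  then show "finite_measure (clock a b)"
    by (intro finite_measureI) simp
  show "measure (clock a b) UNIV = ln (b / a) / Q1 p"
    using * assms Q1_pos by (simp add: measure_def)
qed

lemma clock_total_le:
  assumes "0 < a" "a \<le> b"
  shows "0 \<le> ln (b / a) / Q1 p" "ln (b / a) / Q1 p \<le> (b - a) / a"
proof -
  have "ln (b / a) \<le> b / a - 1"
    using assms by (intro ln_le_minus_one) auto
  moreover have ln: "0 \<le> ln (b / a)"
    using assms by (intro ln_ge_zero) (simp add: field_simps)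
  moreover have "ln (b / a) / Q1 p \<le> ln (b / a) / 1"
    using ln Q1_ge_1 by (intro divide_left_mono) auto
  ultimately show "ln (b / a) / Q1 p \<le> (b - a) / a"
    using assms by (simp add: diff_divide_distrib)
  show "0 \<le> ln (b / a) / Q1 p"
    using ln Q1_pos by simp
qed

lemma AE_clock: "AE s in clock a b. s \<in> {a..b}"
proof -
  show ?thesis
    unfolding clock_def
    by (subst AE_density) (auto simp: indicator_def)
qed

text \<open>Discontinuities of monotone paths and single end points of time intervals are thus
  invisible to the clock.\<close>

lemma AE_clock_countable:
  assumes "countable S"
  shows "AE s in clock a b. s \<notin> S"
proof -
  have "S \<in> null_sets lborel"
    using assms by (rule countable_imp_null_set_lborel)
  then have "AE s in lborel. s \<notin> S"
    by (rule AE_not_in)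
  then show ?thesis
    unfolding clock_def by (subst AE_density) (auto elim: eventually_mono)
qed

lemma integrable_clock:
  assumes "0 < a" "a \<le> b" "g \<in> borel_measurable borel" "\<And>s. s \<in> {a..b} \<Longrightarrow> \<bar>g s\<bar> \<le> B"
  shows "integrable (clock a b) (g :: real \<Rightarrow> real)"
proof -
  interpret finite_measure "clock a b"
    by (rule finite_measure_clock[OF assms(1,2)])
  have "AE s in clock a b. norm (g s) \<le> B"
    using AE_clock[of a b] by eventually_elim (use assms(4) in auto)
  then show ?thesis
    using assms(3) by (intro integrable_const_bound[where B=B]) auto
qed

lemma integral_clock_eq_set:
  assumes "0 < a" "g \<in> borel_measurable borel"
  shows "(LINT s|clock a b. g s) = (LINT s:{a..b}|lborel. g s / (Q1 p * s))"
proof -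
  have "(LINT s|clock a b. g s) = (LINT s|lborel. (indicator {a..b} s / (Q1 p * s)) *\<^sub>R g s)"
    unfolding clock_def using clock_weight_nonneg[OF assms(1)] assms(2)
    by (intro integral_density) auto
  then show ?thesis
    by (simp add: set_lebesgue_integral_def)
qed

lemma integral_clock:
  assumes "0 < a" "a \<le> b" "g \<in> borel_measurable borel"
    and "\<And>s. s \<in> {a..b} \<Longrightarrow> f s = g s / (Q1 p * s)"
  shows "(LBINT s=a..b. f s) = (LINT s|clock a b. g s)"
  using assms unfolding integral_clock_eq_set[OF assms(1,3)] interval_integral_Icc[OF assms(2)]
  by (intro set_lebesgue_integral_cong) auto

lemma set_integrable_clock:
  assumes "0 < a" "a \<le> b" "g \<in> borel_measurable borel" "\<And>s. s \<in> {a..b} \<Longrightarrow> \<bar>g s\<bar> \<le> B"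
    and "\<And>s. s \<in> {a..b} \<Longrightarrow> f s = g s / (Q1 p * s)"
  shows "set_integrable lborel {a..b} (f :: real \<Rightarrow> real)"
proof -
  have "integrable lborel (\<lambda>s. (indicator {a..b} s / (Q1 p * s)) *\<^sub>R g s)"
  proof (subst integrable_density[symmetric])
    show "AE s in lborel. 0 \<le> indicator {a..b} s / (Q1 p * s)"
      using clock_weight_nonneg[OF assms(1)] by simp
    show "integrable (density lborel (\<lambda>s. ennreal (indicator {a..b} s / (Q1 p * s)))) g"
      using integrable_clock[OF assms(1-4)] by (simp add: clock_def)
  qed (use assms(3) in auto)
  moreover have "(indicator {a..b} s / (Q1 p * s)) *\<^sub>R g s = indicator {a..b} s *\<^sub>R f s" for s
    using assms(5)[of s] by (simp add: indicator_def)
  ultimately show ?thesis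
    by (simp add: set_integrable_def)
qed

lemma integral_clock_combine:
  assumes "0 < a" "a \<le> b" "b \<le> c" "g \<in> borel_measurable borel" "\<And>s. s \<in> {a..c} \<Longrightarrow> \<bar>g s\<bar> \<le> B"
  shows "(LINT s|clock a c. g s) = (LINT s|clock a b. g s) + (LINT s|clock b c. (g s :: real))"
proof -
  define f where "f s = g s / (Q1 p * s)" for s
  have "(LBINT s=a..b. f s) + (LBINT s=b..c. f s) = (LBINT s=a..c. f s)"
  proof (rule interval_integral_sum)
    have "set_integrable lborel {a..c} f"
      by (rule set_integrable_clock[OF _ _ assms(4,5)]) (use assms(1-3) f_def in auto)
    then have "interval_lebesgue_integrable lborel (ereal a) (ereal c) f"
      using assms(2,3) by (intro set_integrable_imp_interval) auto
    moreover have "min (ereal a) (min (ereal b) (ereal c)) = ereal a"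
      "max (ereal a) (max (ereal b) (ereal c)) = ereal c"
      using assms(2,3) by (auto simp: min_def max_def)
    ultimately show "interval_lebesgue_integrable lborel (min (ereal a) (min (ereal b) (ereal c)))
        (max (ereal a) (max (ereal b) (ereal c))) f"
      by simp
  qed
  moreover have "(LBINT s=a..b. f s) = (LINT s|clock a b. g s)"
    "(LBINT s=b..c. f s) = (LINT s|clock b c. g s)"
    "(LBINT s=a..c. f s) = (LINT s|clock a c. g s)"
    using assms(1-4) by (auto intro!: integral_clock simp: f_def)
  ultimately show ?thesis by simp
qed

lemma integral_clock_const:
  assumes "0 < a" "a \<le> b"
  shows "(LINT s|clock a b. c) = c * (ln (b / a) / Q1 p)"
  using measure_clock[OF assms] by simp

lemma integral_clock_mono:
  assumes "0 < a" "a \<le> b" "f \<in> borel_measurable borel" "g \<in> borel_measurable borel"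
    and "\<And>s. s \<in> {a..b} \<Longrightarrow> \<bar>f s\<bar> \<le> B" "\<And>s. s \<in> {a..b} \<Longrightarrow> \<bar>g s\<bar> \<le> B'"
    and "\<And>s. s \<in> {a..b} \<Longrightarrow> f s \<le> (g s :: real)"
  shows "(LINT s|clock a b. f s) \<le> (LINT s|clock a b. g s)"
proof (rule integral_mono_AE)
  show "AE s in clock a b. f s \<le> g s"
    using AE_clock[of a b] by eventually_elim (rule assms(7))
qed (rule integrable_clock[OF assms(1-3,5)] integrable_clock[OF assms(1,2,4,6)]; simp)+

lemma integral_clock_cong:
  assumes "f \<in> borel_measurable borel" "g \<in> borel_measurable borel"
    and "\<And>s. s \<in> {a..b} \<Longrightarrow> f s = (g s :: real)"
  shows "(LINT s|clock a b. f s) = (LINT s|clock a b. g s)"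
proof (rule integral_cong_AE)
  show "AE s in clock a b. f s = g s"
    using AE_clock[of a b] by eventually_elim (rule assms(3))
qed (use assms in auto)

lemma integral_clock_abs_le:
  assumes "0 < a" "a \<le> b" "g \<in> borel_measurable borel" "\<And>s. s \<in> {a..b} \<Longrightarrow> \<bar>g s\<bar> \<le> B"
  shows "\<bar>LINT s|clock a b. g s\<bar> \<le> B * (ln (b / a) / Q1 p)"
proof -
  have "(LINT s|clock a b. g s) \<le> (LINT s|clock a b. B)"
    "(LINT s|clock a b. - B) \<le> (LINT s|clock a b. g s)"
    using assms(3,4) by (intro integral_clock_mono[OF assms(1,2)]; force)+
  then show ?thesis
    unfolding integral_clock_const[OF assms(1,2)] by (simp add: abs_le_iff)
qed

lemma integral_clock_dominated:
  assumes "0 < a" "a \<le> b" "\<And>n. g n \<in> borel_measurable borel" "h \<in> borel_measurable borel"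
    and "\<And>n s. s \<in> {a..b} \<Longrightarrow> \<bar>g n s\<bar> \<le> B"
    and "countable S" "\<And>s. s \<in> {a..b} - S \<Longrightarrow> (\<lambda>n. g n s) \<longlonglongrightarrow> h s"
  shows "(\<lambda>n. LINT s|clock a b. g n s) \<longlonglongrightarrow> (LINT s|clock a b. (h s :: real))"
proof (rule integral_dominated_convergence)
  show "integrable (clock a b) (\<lambda>_. B)"
    by (rule integrable_clock[OF assms(1,2)]) auto
  show "AE s in clock a b. (\<lambda>n. g n s) \<longlonglongrightarrow> h s"
    using AE_clock[of a b] AE_clock_countable[OF assms(6), of a b]
    by eventually_elim (use assms(7) in auto)
  show "AE s in clock a b. norm (g n s) \<le> B" for n
    using AE_clock[of a b] by eventually_elim (use assms(5) in auto)
qed (use assms in auto)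

text \<open>The integrated equation for the Laplace transform and its separated form are equivalent.
  Since the intensity may jump with the min, the argument compares increments, which differ by
  a quantity of second order, instead of differentiating.\<close>
context
  fixes E z :: "real \<Rightarrow> real" and a b z0 :: real
  assumes ab: "0 < a" "a \<le> b"
    and E [measurable]: "E \<in> borel_measurable borel" and E_bounds: "\<And>s. 0 \<le> E s" "\<And>s. E s \<le> 1"
    and z: "antimono z" and z_bounds: "\<And>s. 0 \<le> z s" "\<And>s. z s \<le> z0" and z0: "z0 < 1"
begin

lemma z_antimonoD: "s \<le> t \<Longrightarrow> z t \<le> z s"
  using z by (rule antimonoD)

lemma gen_z_measurable [measurable]: "(\<lambda>s. gen (z s)) \<in> borel_measurable borel"
proof -
  have "mono (\<lambda>s. - gen (z s))"
  proof (rule monoI)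
    fix s t :: real assume "s \<le> t"
    then show "- gen (z s) \<le> - gen (z t)"
      using gen_mono[OF z_bounds(1) z_antimonoD, of s t] z_bounds(2)[of s] z0 by simp
  qed
  then have "(\<lambda>s. - (- gen (z s))) \<in> borel_measurable borel"
    by (intro borel_measurable_uminus borel_measurable_mono)
  then show ?thesis by simp
qed

lemma gen_z_bounds: "0 \<le> gen (z s)" "gen (z s) \<le> z0" "0 < 1 - gen (z s)"
  using gen_nonneg[of "z s"] gen_le[of "z s"] z_bounds[of s] z0 by auto

text \<open>Since \<open>z\<close> decreases, 1 - gen (z u) lies between its values at s and t,
  which sandwiches \<open>J\<close> between two multiples of \<open>I\<close>. They differ by at
  most I Q1 (z s - z t), a product of two increments and hence of second order.\<close>

lemma weighted_integral_bounds:
  assumes st: "a \<le> s" "s \<le> t" "t \<le> b"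
  defines "I \<equiv> (LINT u|clock s t. E u)"
  defines "J \<equiv> (LINT u|clock s t. E u * (1 - gen (z u)))"
  shows "0 \<le> I" "I \<le> (t - s) / a" "I * (1 - gen (z s)) \<le> J" "J \<le> I * (1 - gen (z t))"
    "I * (1 - gen (z t)) - I * (1 - gen (z s)) \<le> I * (Q1 p * (z s - z t))" "0 \<le> J" "J \<le> I"
proof -
  have s: "0 < s" using st ab by simp
  have E_abs: "\<bar>E u\<bar> \<le> 1" for u
    using E_bounds[of u] by simp
  show I: "0 \<le> I"
    unfolding I_def by (rule integral_nonneg_AE) (use E_bounds in auto)
  have "I \<le> 1 * (ln (t / s) / Q1 p)"
    using integral_clock_abs_le[OF s st(2) E E_abs] by (simp add: I_def)
  also have "\<dots> \<le> (t - s) / s"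
    using clock_total_le[OF s st(2)] by simp
  also have "\<dots> \<le> (t - s) / a"
    using st ab by (intro divide_left_mono) auto
  finally show "I \<le> (t - s) / a" .
  have zm: "gen (z u) \<le> gen (z s)" "gen (z t) \<le> gen (z u)" if "u \<in> {s..t}" for u
    using that z_bounds(1)[of t] z_bounds(1)[of u] z_bounds(2)[of u] z_bounds(2)[of s] z0
    by (auto intro!: gen_mono z_antimonoD)
  have prod: "\<bar>E u * c\<bar> \<le> 1" if "0 \<le> c" "c \<le> 1" for u c
    using E_bounds[of u] that by (simp add: abs_mult mult_le_one)
  have b1: "0 \<le> 1 - gen (z u)" "1 - gen (z u) \<le> 1" for u
    using gen_z_bounds[of u] by auto
  have "(LINT u|clock s t. E u * (1 - gen (z s))) \<le> J"
    unfolding J_def using zm E_bounds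
    by (intro integral_clock_mono[OF s st(2), where B=1 and B'=1] prod b1 mult_left_mono) auto
  then show 1: "I * (1 - gen (z s)) \<le> J"
    by (simp add: I_def)
  have "J \<le> (LINT u|clock s t. E u * (1 - gen (z t)))"
    unfolding J_def using zm E_bounds
    by (intro integral_clock_mono[OF s st(2), where B=1 and B'=1] prod b1 mult_left_mono) auto
  then show 2: "J \<le> I * (1 - gen (z t))"
    by (simp add: I_def)
  have "I * (gen (z s) - gen (z t)) \<le> I * (Q1 p * (z s - z t))"
    using gen_diff_le[of "z t" "z s"] z_bounds[of s] z_bounds[of t] z0 z_antimonoD[OF st(2)] I
    by (intro mult_left_mono) auto
  then show "I * (1 - gen (z t)) - I * (1 - gen (z s)) \<le> I * (Q1 p * (z s - z t))"
    by (simp add: algebra_simps)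
  have "0 \<le> I * (1 - gen (z s))"
    using I b1[of s] by simp
  with 1 show "0 \<le> J" by simp
  have "I * (1 - gen (z t)) \<le> I * 1"
    using I b1[of t] by (intro mult_left_mono) auto
  with 2 show "J \<le> I" by simp
qed

lemma integrated_iff_separated:
  "(\<forall>s t. a \<le> s \<longrightarrow> s \<le> t \<longrightarrow> t \<le> b \<longrightarrow> z s - z t = (LINT u|clock s t. E u * (1 - gen (z u)))) \<longleftrightarrow>
   (\<forall>s t. a \<le> s \<longrightarrow> s \<le> t \<longrightarrow> t \<le> b \<longrightarrow> phi (z s) - phi (z t) = (LINT u|clock s t. E u))"
  (is "?L \<longleftrightarrow> ?R")
proof -
  define I where "I s t = (LINT u|clock s t. E u)" for s t
  define J where "J s t = (LINT u|clock s t. E u * (1 - gen (z u)))" for s t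
  have E_abs: "\<bar>E u\<bar> \<le> 1" "\<bar>E u * (1 - gen (z u))\<bar> \<le> 1" for u
    using E_bounds[of u] gen_z_bounds[of u] by (auto simp: abs_mult intro!: mult_le_one)
  have I_add: "I a t = I a s + I s t" and J_add: "J a t = J a s + J s t"
    if "a \<le> s" "s \<le> t" "t \<le> b" for s t
    unfolding I_def J_def using that ab E_abs
    by (intro integral_clock_combine[where B=1]; simp)+
  note IJ = weighted_integral_bounds[folded I_def J_def]
  have phi_b: "(z s - z t) / (1 - gen (z t)) \<le> phi (z s) - phi (z t)"
    "phi (z s) - phi (z t) \<le> (z s - z t) / (1 - gen (z s))" if "s \<le> t" for s t
    using phi_diff_bounds[of "z t" "z s"] z_bounds[of s] z_bounds[of t] z0 z_antimonoD[OF that] by auto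
  have sq: "x * y \<le> (d / a) * (d / a)" if "0 \<le> x" "x \<le> d / a" "0 \<le> y" "y \<le> d / a" for x y d
    using that by (intro mult_mono) auto
  show ?thesis
  proof
    assume L: ?L
    \<comment> \<open>Dividing the sandwich for \<open>J\<close> by 1 - gen at the two ends shows
      that the increment of \<open>phi\<close> differs from \<open>I s t\<close> by at most K / (1 -
      z0), where \<open>K\<close> below is a product of two increments of order t - s.\<close>
    have key: "\<bar>(phi (z t) + I a t) - (phi (z s) + I a s)\<bar> \<le> (Q1 p / (1 - z0) / a\<^sup>2) * (t - s)\<^sup>2"
      if st: "a \<le> s" "s \<le> t" "t \<le> b" for s t
    proof -
      have zJ: "z s - z t = J s t"
        using L st by (simp add: J_def)
      note b = IJ[OF st] phi_b[OF st(2)] gen_z_bounds[of s] gen_z_bounds[of t]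
      define K where "K = I s t * (Q1 p * (z s - z t))"
      have K: "I s t * (1 - gen (z t)) - I s t * (1 - gen (z s)) \<le> K"
        using b(5) by (simp add: K_def)
      have K0: "0 \<le> K"
        unfolding K_def zJ using b(1) b(6) Q1_pos by simp
      have "phi (z s) - phi (z t) \<le> J s t / (1 - gen (z s))"
        using b(9) by (simp add: zJ)
      also have "\<dots> \<le> (I s t * (1 - gen (z s)) + K) / (1 - gen (z s))"
        using b(4) K b(12) by (intro divide_right_mono) auto
      also have "\<dots> = I s t + K / (1 - gen (z s))"
        using b(12) by (simp add: add_divide_distrib)
      also have "\<dots> \<le> I s t + K / (1 - z0)"
        using K0 b(11,12) z0 by (intro add_left_mono divide_left_mono mult_pos_pos) auto
      finally have up: "phi (z s) - phi (z t) \<le> I s t + K / (1 - z0)" .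
      have "I s t - K / (1 - z0) \<le> I s t - K / (1 - gen (z t))"
        using K0 b(14,15) z0 by (intro diff_left_mono divide_left_mono mult_pos_pos) auto
      also have "\<dots> = (I s t * (1 - gen (z t)) - K) / (1 - gen (z t))"
        using b(15) by (simp add: diff_divide_distrib)
      also have "\<dots> \<le> J s t / (1 - gen (z t))"
        using b(3) K b(15) by (intro divide_right_mono) auto
      also have "\<dots> \<le> phi (z s) - phi (z t)"
        using b(8) by (simp add: zJ)
      finally have lo: "I s t - K / (1 - z0) \<le> phi (z s) - phi (z t)" .
      have "I s t * J s t \<le> ((t - s) / a) * ((t - s) / a)"
        using b(1,2,6,7) by (intro sq) auto
      then have "K / (1 - z0) \<le> Q1 p * (((t - s) / a) * ((t - s) / a)) / (1 - z0)"
        unfolding K_def zJ mult.left_commute[of _ "Q1 p"]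
        using Q1_pos z0 by (intro divide_right_mono mult_left_mono) auto
      also have "\<dots> = (Q1 p / (1 - z0) / a\<^sup>2) * (t - s)\<^sup>2"
        by (simp add: power2_eq_square)
      finally have "K / (1 - z0) \<le> (Q1 p / (1 - z0) / a\<^sup>2) * (t - s)\<^sup>2" .
      with up lo I_add[OF st] show ?thesis
        by (simp add: abs_le_iff)
    qed
    show ?R
    proof (intro allI impI)
      fix s t assume st: "a \<le> s" "s \<le> t" "t \<le> b"
      have "phi (z s) + I a s = phi (z t) + I a t"
        by (rule quadratic_increment_const[OF key]) (use st in auto)
      then show "phi (z s) - phi (z t) = (LINT u|clock s t. E u)"
        using I_add[OF st] by (simp add: I_def)
    qed
  next
    assume R: ?R
    \<comment> \<open>In this direction z s - z t is of order t - s because \<open>phi\<close> is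
      expanding, and both z s - z t and \<open>J s t\<close> lie in the same interval of
      second-order length.\<close>
    have key: "\<bar>(z t + J a t) - (z s + J a s)\<bar> \<le> (Q1 p / a\<^sup>2) * (t - s)\<^sup>2"
      if st: "a \<le> s" "s \<le> t" "t \<le> b" for s t
    proof -
      have pI: "phi (z s) - phi (z t) = I s t"
        using R st by (simp add: I_def)
      note b = IJ[OF st] phi_b[OF st(2)] gen_z_bounds[of s] gen_z_bounds[of t]
      have "I s t * (1 - gen (z s)) \<le> z s - z t" "z s - z t \<le> I s t * (1 - gen (z t))"
        using b(8,9,12,15) by (auto simp: pI field_simps)
      then have "\<bar>(z s - z t) - J s t\<bar> \<le> I s t * (1 - gen (z t)) - I s t * (1 - gen (z s))"
        using b(3,4) by (auto simp: abs_le_iff)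
      also note b(5)
      also have "I s t * (Q1 p * (z s - z t)) = Q1 p * (I s t * (z s - z t))"
        by simp
      also have "\<dots> \<le> Q1 p * (((t - s) / a) * ((t - s) / a))"
      proof (intro mult_left_mono sq)
        have "z s - z t \<le> I s t"
          using phi_diff_ge[of "z t" "z s"] z_bounds[of s] z_bounds[of t] z0 z_antimonoD[OF st(2)] pI by auto
        with b(2) show "z s - z t \<le> (t - s) / a" by simp
      qed (use b(1,2) z_antimonoD[OF st(2)] Q1_pos in auto)
      also have "\<dots> = (Q1 p / a\<^sup>2) * (t - s)\<^sup>2"
        by (simp add: power2_eq_square)
      finally show ?thesis
        using J_add[OF st] by (simp add: abs_le_iff)
    qed
    show ?L
    proof (intro allI impI)
      fix s t assume st: "a \<le> s" "s \<le> t" "t \<le> b"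
      have "z s + J a s = z t + J a t"
        by (rule quadratic_increment_const[OF key]) (use st in auto)
      then show "z s - z t = (LINT u|clock s t. E u * (1 - gen (z u)))"
        using J_add[OF st] by (simp add: J_def)
    qed
  qed
qed

end

end

section \<open>The merging operator\<close>

lemma exp_in_C0: "0 < q \<Longrightarrow> (\<lambda>x. exp (- q * x)) \<in> C0"
proof -
  assume q: "0 < q"
  have "filterlim (\<lambda>x. - (q * x)) at_bot at_top"
    using filterlim_tendsto_pos_mult_at_top[OF tendsto_const q filterlim_ident]
    by (simp add: filterlim_uminus_at_bot)
  then have "((\<lambda>x. exp (- (q * x))) \<longlongrightarrow> 0) at_top"
    by (rule filterlim_compose[OF exp_at_bot])
  then show ?thesis
    by (auto simp: C0_def intro!: continuous_intros)
qed

text \<open>The substitution x = exp (- y) turns the problem into polynomial approximation on the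
  unit interval. The polynomial may have a constant term, which is why the case q = 0 is carried
  along wherever such sums are integrated.\<close>

lemma C0_approx_exp_sum:
  assumes a: "a \<in> C0" and e: "0 < e"
  obtains c :: "nat \<Rightarrow> real" and n where
    "\<And>y. 0 \<le> y \<Longrightarrow> \<bar>a y - (\<Sum>j\<le>n. c j * exp (- real j * y))\<bar> < e"
proof -
  have conta: "continuous_on UNIV a" and lima: "(a \<longlongrightarrow> 0) at_top"
    using a by (auto simp: C0_def)
  \<comment> \<open>The value at x = 0 is the limit of \<open>a\<close> at infinity; this is where
    vanishing at infinity gives continuity on the closed interval.\<close>
  define f where "f x = (if x = 0 then 0 else a (- ln x))" for x
  have "continuous_on {0..1} f"
    unfolding continuous_on_eq_continuous_within
  proof
    fix x :: real assume x: "x \<in> {0..1}"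
    show "continuous (at x within {0..1}) f"
    proof (cases "x = 0")
      case True
      have "filterlim (\<lambda>x. - ln x :: real) at_top (at_right 0)"
        using ln_at_0 by (simp add: filterlim_uminus_at_bot)
      then have "((\<lambda>x. a (- ln x)) \<longlongrightarrow> 0) (at_right 0)"
        by (rule filterlim_compose[OF lima])
      moreover have "\<forall>\<^sub>F x in at_right 0. a (- ln x) = f x"
        using eventually_at_right_less[of "0 :: real"] by eventually_elim (simp add: f_def)
      ultimately have "(f \<longlongrightarrow> 0) (at_right 0)"
        by (rule Lim_transform_eventually)
      then have "(f \<longlongrightarrow> 0) (at 0 within {0..1})"
        by (simp add: at_within_Icc_at_right)
      then show ?thesis
        by (simp add: continuous_within True f_def)
    next
      case False
      have "isCont a (- ln x)"
        using conta by (simp add: continuous_on_eq_continuous_at)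
      moreover have "isCont (\<lambda>x. - ln x) x"
        using False by (intro isCont_minus isCont_ln)
      ultimately have "isCont (\<lambda>x. a (- ln x)) x"
        using isCont_o2 by blast
      moreover have "\<forall>\<^sub>F y in nhds x. a (- ln y) = f y"
        using t1_space_nhds[OF False] by eventually_elim (simp add: f_def)
      ultimately have "isCont f x"
        by (simp add: isCont_cong)
      then show ?thesis
        by (rule continuous_at_imp_continuous_at_within)
    qed
  qed
  then obtain g where g: "polynomial_function g" "\<forall>x\<in>{0..1}. norm (f x - g x) < e"
    using Stone_Weierstrass_polynomial_function[of "{0..1}" f e] e by auto
  then obtain c n where gc: "g = (\<lambda>x. \<Sum>i\<le>n. c i * x ^ i)"
    using real_polynomial_function_imp_sum[of g] unfolding real_polynomial_function_eq by blast
  have "\<bar>a y - (\<Sum>j\<le>n. c j * exp (- real j * y))\<bar> < e" if "0 \<le> y" for y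
  proof -
    have "norm (f (exp (- y)) - g (exp (- y))) < e"
      using g(2) that by simp
    moreover have "exp (- y) ^ j = exp (- real j * y)" for j
      by (simp add: exp_of_nat_mult[symmetric])
    ultimately show ?thesis
      by (simp add: f_def gc)
  qed
  with that show ?thesis by blast
qed

lemma exp_sum_bounded:
  fixes y :: real
  assumes "0 \<le> y"
  shows "\<bar>\<Sum>j\<le>n. c j * exp (- real j * y)\<bar> \<le> (\<Sum>j\<le>n. \<bar>c j\<bar>)"
proof (rule sum_abs[THEN order_trans], rule sum_mono)
  show "\<bar>c j * exp (- real j * y)\<bar> \<le> \<bar>c j\<bar>" for j
    using assms by (simp add: abs_mult mult_left_le)
qed

lemma prob_Rplus_integrable:
  assumes "prob_Rplus M" "b \<in> borel_measurable borel" "\<And>y. 0 \<le> y \<Longrightarrow> \<bar>b y\<bar> \<le> B"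
  shows "integrable M (b :: real \<Rightarrow> real)"
proof -
  interpret real_distribution M by (rule prob_RplusD[OF assms(1)])
  have "AE y in M. norm (b y) \<le> B"
    using prob_RplusD(5)[OF assms(1)] by eventually_elim (use assms(3) in auto)
  then show ?thesis
    using assms(2) by (intro integrable_const_bound[where B=B]) auto
qed

lemma prob_Rplus_abs_integral_le:
  assumes "prob_Rplus M" "b \<in> borel_measurable borel" "\<And>y. 0 \<le> y \<Longrightarrow> \<bar>b y\<bar> \<le> B"
  shows "\<bar>LINT y|M. (b y :: real)\<bar> \<le> B"
proof -
  interpret real_distribution M by (rule prob_RplusD[OF assms(1)])
  note int = prob_Rplus_integrable[OF assms]
  have "AE y in M. b y \<le> B" "AE y in M. - B \<le> b y"
    using prob_RplusD(5)[OF assms(1)] by (eventually_elim, use assms(3) in force)+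
  then have "(LINT y|M. b y) \<le> (LINT y|M. B)" "(LINT y|M. - B) \<le> (LINT y|M. b y)"
    using int by (intro integral_mono_AE; simp)+
  then show ?thesis
    using prob_space[unfolded space_eq_univ] by (simp add: abs_le_iff)
qed

lemma lap_sum:
  assumes "prob_Rplus M"
  shows "(LINT y|M. (\<Sum>j\<le>n. c j * exp (- real j * y))) = (\<Sum>j\<le>n. c j * lap M (real j))"
proof -
  have "integrable M (\<lambda>y. c j * exp (- real j * y))" for j
    by (intro integrable_mult_right lap_integrable assms) simp
  then have "(LINT y|M. (\<Sum>j\<le>n. c j * exp (- real j * y))) = (\<Sum>j\<le>n. LINT y|M. c j * exp (- real j * y))"
    by (intro Bochner_Integration.integral_sum)
  then show ?thesis
    by (simp add: lap_def)
qed

section \<open>Merging and its action on exponentials\<close>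

context min_clustering
begin

definition merge_term :: "real measure \<Rightarrow> (real \<Rightarrow> real) \<Rightarrow> nat \<Rightarrow> real" where
  "merge_term M b k = (LINT y|PiM {..<Suc k} (\<lambda>_. M). b (pmin M + (\<Sum>i<Suc k. y i)) - b (pmin M))"

definition merge :: "real measure \<Rightarrow> (real \<Rightarrow> real) \<Rightarrow> real" where
  "merge M b = (\<Sum>k. p (Suc k) * merge_term M b k)"

lemma clust_rhs_eq: "clust_rhs p F b s = merge (F s) b / (Q1 p * s)"
  by (simp add: clust_rhs_def merge_def merge_term_def)

lemma merge_integrand:
  fixes b :: "real \<Rightarrow> real"
  assumes M: "prob_Rplus M" and b: "b \<in> borel_measurable borel" "\<And>y. 0 \<le> y \<Longrightarrow> \<bar>b y\<bar> \<le> B"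
  defines "f \<equiv> \<lambda>k y. b (pmin M + (\<Sum>i<Suc k. y i)) - b (pmin M)"
  shows "integrable (PiM {..<Suc k} (\<lambda>_. M)) (f k)" "\<bar>LINT y|PiM {..<Suc k} (\<lambda>_. M). f k y\<bar> \<le> 2 * B"
proof -
  let ?P = "PiM {..<Suc k} (\<lambda>_. M)"
  interpret real_distribution M by (rule prob_RplusD[OF M])
  interpret P: prob_space "?P"
    by (rule prob_space_PiM) (rule prob_space_axioms)
  have comp: "(\<lambda>y. y i) \<in> borel_measurable ?P" if "i < Suc k" for i
    using measurable_component_singleton[of i "{..<Suc k}" "\<lambda>_. M"] that
    by (simp add: measurable_cong_sets[OF refl events_eq_borel])
  have [measurable]: "(\<lambda>y. b (pmin M + (\<Sum>i<Suc k. y i))) \<in> borel_measurable ?P"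
    by (rule measurable_compose[OF _ b(1)])
      (intro borel_measurable_add borel_measurable_sum comp borel_measurable_const, simp)
  have "AE y in ?P. 0 \<le> y i" if "i < Suc k" for i
    by (rule AE_PiM_component) (use that prob_RplusD(5)[OF M] prob_space_axioms in auto)
  then have "AE y in ?P. \<forall>i\<in>{..<Suc k}. 0 \<le> y i"
    by (intro AE_finite_allI) auto
  then have bound: "AE y in ?P. \<bar>f k y\<bar> \<le> 2 * B"
  proof eventually_elim
    case (elim y)
    then have "0 \<le> (\<Sum>i<Suc k. y i)"
      by (intro sum_nonneg) auto
    then show ?case
      using b(2)[of "pmin M"] b(2)[of "pmin M + (\<Sum>i<Suc k. y i)"] pmin_nonneg[OF M]
      by (simp add: f_def)
  qed
  show int: "integrable ?P (f k)"
    by (rule P.integrable_const_bound[where B="2 * B"]) (use bound in \<open>auto simp: f_def simp del: sum.lessThan_Suc\<close>)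
  have "AE y in ?P. f k y \<le> 2 * B" "AE y in ?P. - (2 * B) \<le> f k y"
    using bound by (eventually_elim, simp)+
  then have "(LINT y|?P. f k y) \<le> (LINT y|?P. 2 * B)"
    "(LINT y|?P. - (2 * B)) \<le> (LINT y|?P. f k y)"
    using int by (intro integral_mono_AE; simp)+
  then show "\<bar>LINT y|?P. f k y\<bar> \<le> 2 * B"
    using P.prob_space by (simp add: abs_le_iff)
qed

lemma merge_summable:
  assumes "prob_Rplus M" "b \<in> borel_measurable borel" "\<And>y. 0 \<le> y \<Longrightarrow> \<bar>b y\<bar> \<le> B"
  shows "summable (\<lambda>k. p (Suc k) * merge_term M b k)" "\<bar>merge M b\<bar> \<le> 2 * B"
proof -
  have le: "norm (p (Suc k) * merge_term M b k) \<le> p (Suc k) * (2 * B)" for k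
    using merge_integrand(2)[OF assms, of k] p_nonneg[of k]
    by (auto simp: abs_mult merge_term_def intro!: mult_left_mono)
  have sm: "(\<lambda>k. p (Suc k) * (2 * B)) sums (1 * (2 * B))"
    by (intro sums_mult2 p_sum)
  have n: "summable (\<lambda>k. norm (p (Suc k) * merge_term M b k))"
    by (rule summable_comparison_test'[OF sums_summable[OF sm], of 0]) (use le in auto)
  then show "summable (\<lambda>k. p (Suc k) * merge_term M b k)"
    by (rule summable_norm_cancel)
  have "norm (merge M b) \<le> (\<Sum>k. norm (p (Suc k) * merge_term M b k))"
    unfolding merge_def by (rule summable_norm[OF n])
  also have "\<dots> \<le> (\<Sum>k. p (Suc k) * (2 * B))"
    by (intro suminf_le le n sums_summable[OF sm])
  finally show "\<bar>merge M b\<bar> \<le> 2 * B"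
    using sm by (simp add: sums_iff)
qed

lemma merge_add_mult:
  assumes "prob_Rplus M"
    and "b \<in> borel_measurable borel" "\<And>y. 0 \<le> y \<Longrightarrow> \<bar>b y\<bar> \<le> B"
    and "d \<in> borel_measurable borel" "\<And>y. 0 \<le> y \<Longrightarrow> \<bar>d y\<bar> \<le> D"
  shows "merge M (\<lambda>y. b y + c * d y) = merge M b + c * merge M d"
proof -
  have "merge_term M (\<lambda>y. b y + c * d y) k = merge_term M b k + c * merge_term M d k" for k
  proof -
    have "merge_term M (\<lambda>y. b y + c * d y) k = (LINT y|PiM {..<Suc k} (\<lambda>_. M).
        (b (pmin M + (\<Sum>i<Suc k. y i)) - b (pmin M)) + c * (d (pmin M + (\<Sum>i<Suc k. y i)) - d (pmin M)))"
      unfolding merge_term_def by (simp only: algebra_simps)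
    also have "\<dots> = merge_term M b k + c * merge_term M d k"
      unfolding merge_term_def
      using merge_integrand(1)[OF assms(1-3), of k] merge_integrand(1)[OF assms(1,4,5), of k]
      by (subst Bochner_Integration.integral_add) (simp_all del: sum.lessThan_Suc)
    finally show ?thesis .
  qed
  then have "merge M (\<lambda>y. b y + c * d y) =
      (\<Sum>k. p (Suc k) * merge_term M b k + c * (p (Suc k) * merge_term M d k))"
    by (simp add: merge_def algebra_simps)
  also have "\<dots> = merge M b + c * merge M d"
    unfolding merge_def using merge_summable(1)[OF assms(1-3)] merge_summable(1)[OF assms(1,4,5)]
    by (subst suminf_add[symmetric]) (auto intro: summable_mult simp: suminf_mult)
  finally show ?thesis .
qed

text \<open>By independence the exponential of a sum of k summands integrates to the k-th power of
  the Laplace transform, and summing over k gives the generating function. The resulting product of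
  a function of the min and a function of the transform is what makes the equation
  separable.\<close>

lemma merge_exp:
  assumes M: "prob_Rplus M" and q: "0 \<le> q"
  shows "merge M (\<lambda>x. exp (- q * x)) = exp (- q * pmin M) * (gen (lap M q) - 1)"
proof -
  interpret real_distribution M by (rule prob_RplusD[OF M])
  interpret product_prob_space "\<lambda>_ :: nat. M" "{}"
    by unfold_locales
  define e where "e = exp (- q * pmin M)"
  have mterm: "merge_term M (\<lambda>x. exp (- q * x)) k = e * lap M q ^ Suc k - e" for k
  proof -
    let ?P = "PiM {..<Suc k} (\<lambda>_. M)"
    interpret PP: prob_space "?P"
      by (rule prob_space_PiM) (rule prob_RplusD(2)[OF M])
    have int: "integrable M (\<lambda>x. exp (- q * x))"
      by (rule lap_integrable[OF M q])
    have "merge_term M (\<lambda>x. exp (- q * x)) k =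
        (LINT y|?P. e * (\<Prod>i<Suc k. exp (- q * y i)) - e)"
      unfolding merge_term_def e_def
      by (simp add: exp_add[symmetric] exp_sum[symmetric] sum_distrib_left distrib_left
          sum_negf del: sum.lessThan_Suc prod.lessThan_Suc)
    also have "\<dots> = e * (LINT y|?P. (\<Prod>i<Suc k. exp (- q * y i))) - e"
      using product_integrable_prod[of "{..<Suc k}" "\<lambda>_ x. exp (- q * x)"] int PP.prob_space
      by (subst Bochner_Integration.integral_diff) (simp_all del: prod.lessThan_Suc)
    also have "(LINT y|?P. (\<Prod>i<Suc k. exp (- q * y i))) = lap M q ^ Suc k"
      using product_integral_prod[of "{..<Suc k}" "\<lambda>_ x. exp (- q * x)"] int
      by (simp add: lap_def)
    finally show ?thesis .
  qed
  have "(\<lambda>k. e * (p (Suc k) * lap M q ^ Suc k) - e * p (Suc k)) sums (e * gen (lap M q) - e * 1)"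
    using gen_summable[of "lap M q"] lap_pos[OF M q] lap_le_1[OF M q] unfolding gen_def
    by (intro sums_diff sums_mult p_sum summable_sums) auto
  then show ?thesis
    unfolding merge_def mterm by (simp add: sums_iff e_def algebra_simps)
qed

lemma merge_exp_sum:
  assumes M: "prob_Rplus M"
  shows "merge M (\<lambda>y. \<Sum>j\<le>n. c j * exp (- real j * y)) = (\<Sum>j\<le>n. c j * merge M (\<lambda>y. exp (- real j * y)))"
proof (induction n)
  case 0
  have 0: "merge M (\<lambda>y. 0) = 0"
    by (simp add: merge_def merge_term_def)
  show ?case
    using merge_add_mult[OF M, of "\<lambda>_. 0" 0 "\<lambda>y. exp (- real 0 * y)" 1 "c 0"] 0 by simp
next
  case (Suc n)
  have "merge M (\<lambda>y. (\<Sum>j\<le>n. c j * exp (- real j * y)) + c (Suc n) * exp (- real (Suc n) * y)) =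
    merge M (\<lambda>y. \<Sum>j\<le>n. c j * exp (- real j * y)) + c (Suc n) * merge M (\<lambda>y. exp (- real (Suc n) * y))"
    by (rule merge_add_mult[OF M, where B="\<Sum>j\<le>n. \<bar>c j\<bar>" and D=1])
      (use exp_sum_bounded in \<open>auto simp del: of_nat_Suc\<close>)
  with Suc show ?case by (simp del: of_nat_Suc)
qed

text \<open>The path \<open>ell\<close> is a parameter so that different monotone extensions of the
  min beyond the time interval can be inserted.\<close>

lemma weak_solution_imp_separated:
  assumes F: "weak_solution p {a..b} F" and a: "0 < a" and ell: "mono ell" "\<And>u. u \<in> {a..b} \<Longrightarrow> ell u = pmin (F u)"
    and st: "a \<le> s" "s \<le> t" "t \<le> b" and q: "0 < q"
  shows "phi (lap (F s) q) - phi (lap (F t) q) = (LINT u|clock s t. exp (- q * ell u))"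
proof -
  \<comment> \<open>Clamping time to \<open>{a..b}\<close> extends the transform and the intensity
    to the whole line and keeps them monotone, as the equivalence of the two equations
    demands.\<close>
  define cl where "cl u = max a (min b u)" for u
  have ab: "a \<le> b" using st by simp
  have cl: "cl u \<in> {a..b}" for u using ab by (auto simp: cl_def)
  have cl_id: "cl u = u" if "u \<in> {a..b}" for u using that by (auto simp: cl_def)
  have cl_mono: "u \<le> v \<Longrightarrow> cl u \<le> cl v" for u v by (auto simp: cl_def)
  have P: "prob_Rplus (F u)" "0 < pmin (F u)" if "u \<in> {a..b}" for u
    using F that by (auto simp: weak_solution_def)
  have pm: "pmin (F u) \<le> pmin (F v)" if "u \<in> {a..b}" "v \<in> {a..b}" "u \<le> v" for u v
    using F that by (auto simp: weak_solution_def mono_on_def)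
  define z where "z u = lap (F (cl u)) q" for u
  define E where "E u = exp (- q * pmin (F (cl u)))" for u
  define g where "g u = E u * (1 - gen (z u))" for u
  have z_b: "0 \<le> z u" "z u \<le> exp (- q * pmin (F a))" for u
  proof -
    show "0 \<le> z u"
      unfolding z_def using lap_pos[OF P(1)[OF cl], of q] q by (simp add: less_imp_le)
    have "z u \<le> exp (- q * pmin (F (cl u)))"
      unfolding z_def using lap_le_pmin[OF P(1)[OF cl]] q by simp
    also have "\<dots> \<le> exp (- q * pmin (F a))"
      using pm[of a "cl u"] cl[of u] ab q by simp
    finally show "z u \<le> exp (- q * pmin (F a))" .
  qed
  have z0: "exp (- q * pmin (F a)) < 1"
    using P(2)[of a] ab q by simp
  have E_b: "0 \<le> E u" "E u \<le> 1" for u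
    using P(2)[OF cl, of u] q by (auto simp: E_def)
  have eq: "z u - z v = (LBINT x=u..v. g x / (Q1 p * x))" if uv: "a \<le> u" "u \<le> v" "v \<le> b" for u v
  proof -
    have "lap (F v) q - lap (F u) q = (LBINT x=u..v. clust_rhs p F (\<lambda>x. exp (- q * x)) x)"
      using F exp_in_C0[OF q] uv unfolding weak_solution_def lap_def by auto
    also have "\<dots> = (LBINT x=u..v. - (g x / (Q1 p * x)))"
      unfolding interval_integral_Icc[OF uv(2)]
    proof (rule set_lebesgue_integral_cong, simp, intro allI impI)
      fix x assume "x \<in> {u..v}"
      then have x: "x \<in> {a..b}" using uv by auto
      show "clust_rhs p F (\<lambda>x. exp (- q * x)) x = - (g x / (Q1 p * x))"
        unfolding clust_rhs_eq merge_exp[OF P(1)[OF x] less_imp_le[OF q]] g_def E_def z_def cl_id[OF x]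
        by (simp add: right_diff_distrib diff_divide_distrib)
    qed
    also have "\<dots> = - (LBINT x=u..v. g x / (Q1 p * x))"
      by (rule interval_lebesgue_integral_uminus)
    finally show ?thesis
      using uv by (simp add: z_def cl_id)
  qed
  \<comment> \<open>Monotonicity of the transform in time is not assumed of a weak solution; it
    follows from the sign of the right-hand side of the integrated equation.\<close>
  have anti: "antimono z"
  proof (rule antimonoI)
    fix u v :: real assume "u \<le> v"
    then have uv: "a \<le> cl u" "cl u \<le> cl v" "cl v \<le> b"
      using cl[of u] cl[of v] cl_mono by auto
    have "0 \<le> (LBINT x=cl u..cl v. g x / (Q1 p * x))"
      unfolding interval_integral_Icc[OF uv(2)] set_lebesgue_integral_def
    proof (rule integral_nonneg_AE, rule AE_I2)
      fix x :: real
      have "z x \<le> 1"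
        using z_b(2)[of x] z0 by linarith
      then have "gen (z x) \<le> 1"
        using gen_le[of "z x"] z_b(1)[of x] by simp
      then show "0 \<le> indicator {cl u..cl v} x *\<^sub>R (g x / (Q1 p * x))"
        using uv a Q1_pos E_b(1)[of x]
        by (auto simp: indicator_def g_def intro!: divide_nonneg_nonneg mult_nonneg_nonneg)
    qed
    with eq[OF uv] show "z v \<le> z u"
      using cl_id[OF cl] by (simp add: z_def)
  qed
  have E_meas: "E \<in> borel_measurable borel"
  proof -
    have "mono (\<lambda>u. pmin (F (cl u)))"
      using pm cl cl_mono by (intro monoI) auto
    from borel_measurable_mono[OF this] show ?thesis
      unfolding E_def by measurable
  qed
  note ctx = a ab E_meas E_b anti z_b z0
  have g_meas: "g \<in> borel_measurable borel"
    unfolding g_def using gen_z_measurable[OF ctx] E_meas by measurable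
  have "z u - z v = (LINT x|clock u v. E x * (1 - gen (z x)))" if uv: "a \<le> u" "u \<le> v" "v \<le> b" for u v
    using eq[OF uv] integral_clock[OF _ uv(2) g_meas, of "\<lambda>x. g x / (Q1 p * x)"] uv a
    by (simp add: g_def)
  then have "phi (z s) - phi (z t) = (LINT u|clock s t. E u)"
    using integrated_iff_separated[OF ctx] st by blast
  also have "\<dots> = (LINT u|clock s t. exp (- q * ell u))"
  proof (rule integral_clock_cong[OF E_meas])
    show "(\<lambda>u. exp (- q * ell u)) \<in> borel_measurable borel"
      using borel_measurable_mono[OF ell(1)] by measurable
    show "E u = exp (- q * ell u)" if "u \<in> {s..t}" for u
      using that st cl_id[of u] ell(2)[of u] by (simp add: E_def)
  qed
  finally show ?thesis
    using st by (simp add: z_def cl_id)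
qed

end

section \<open>From the separated equation to weak solutions\<close>

context min_clustering
begin

lemma lap_0: "prob_Rplus M \<Longrightarrow> lap M 0 = 1"
  using prob_space.prob_space[OF prob_RplusD(2), of M] prob_RplusD(4)[of M] by (simp add: lap_def)

context
  fixes F :: "real \<Rightarrow> real measure" and ell :: "real \<Rightarrow> real" and t0 :: real
  assumes t0: "0 < t0" and P: "\<And>t. t0 \<le> t \<Longrightarrow> prob_Rplus (F t)"
    and ell: "mono ell" "0 < ell t0" and ell_eq: "\<And>t. t0 \<le> t \<Longrightarrow> pmin (F t) = ell t"
    and sep: "\<And>t q. t0 \<le> t \<Longrightarrow> 0 < q \<Longrightarrow>
      phi (lap (F t0) q) - phi (lap (F t) q) = (LINT u|clock t0 t. exp (- q * ell u))"
begin

lemma ell_pos: "t0 \<le> t \<Longrightarrow> 0 < ell t"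
  using ell monoD[OF ell(1), of t0 t] by simp

lemma exp_ell_measurable [measurable]: "(\<lambda>u. exp (- q * ell u)) \<in> borel_measurable borel"
  using borel_measurable_mono[OF ell(1)] by measurable

lemma separated_between:
  assumes "t0 \<le> s" "s \<le> t" "0 < q"
  shows "phi (lap (F s) q) - phi (lap (F t) q) = (LINT u|clock s t. exp (- q * ell u))"
proof -
  have "\<bar>exp (- q * ell u)\<bar> \<le> 1" if "u \<in> {t0..t}" for u
    using that assms(3) ell_pos[of u] by simp
  then have "(LINT u|clock t0 t. exp (- q * ell u)) =
      (LINT u|clock t0 s. exp (- q * ell u)) + (LINT u|clock s t. exp (- q * ell u))"
    by (rule integral_clock_combine[OF t0 assms(1,2) exp_ell_measurable])
  then show ?thesis
    using sep[of s q] sep[of t q] assms by simp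
qed

lemma lap_less_1':
  assumes "t0 \<le> t" "0 < q"
  shows "0 < lap (F t) q" "lap (F t) q < 1"
  using lap_pos[OF P, of t q] lap_less_1[OF P, of t q] ell_pos[OF assms(1)] ell_eq[OF assms(1)] assms by auto

lemma lap_antimono:
  assumes "t0 \<le> s" "s \<le> t" "0 < q"
  shows "lap (F t) q \<le> lap (F s) q"
proof (rule ccontr)
  assume "\<not> ?thesis"
  then have less: "lap (F s) q < lap (F t) q" by simp
  have "0 \<le> (LINT u|clock s t. exp (- q * ell u))"
    by (rule integral_nonneg_AE) simp
  then have "phi (lap (F t) q) \<le> phi (lap (F s) q)"
    using separated_between[OF assms] by linarith
  then show False
    using phi_diff_ge[of "lap (F s) q" "lap (F t) q"] less lap_less_1'[of s q] lap_less_1'[of t q] assms by simp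
qed

lemma lap_F_measurable:
  assumes "0 \<le> q"
  shows "(\<lambda>u. lap (F (max t0 u)) q) \<in> borel_measurable borel"
proof (cases "q = 0")
  case True
  then show ?thesis using lap_0[OF P] by simp
next
  case False
  have "mono (\<lambda>u. - lap (F (max t0 u)) q)"
    using False assms by (intro monoI) (auto intro!: lap_antimono)
  from borel_measurable_uminus[OF borel_measurable_mono[OF this]] show ?thesis by simp
qed

lemma merge_exp_integral:
  assumes q: "0 \<le> q" and t: "t0 \<le> t"
  shows "(\<lambda>u. merge (F (max t0 u)) (\<lambda>x. exp (- q * x))) \<in> borel_measurable borel" (is ?M)
    and "lap (F t) q - lap (F t0) q = (LINT u|clock t0 t. merge (F (max t0 u)) (\<lambda>x. exp (- q * x)))" (is ?I)
proof -
  define z where "z u = lap (F (max t0 u)) q" for u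
  define E where "E u = exp (- q * ell (max t0 u))" for u
  have mg: "merge (F (max t0 u)) (\<lambda>x. exp (- q * x)) = E u * (gen (z u) - 1)" for u
    using merge_exp[OF P q, of "max t0 u"] ell_eq[of "max t0 u"] by (simp add: E_def z_def)
  have "mono (\<lambda>u. ell (max t0 u))"
    by (intro monoI monoD[OF ell(1)]) auto
  from borel_measurable_mono[OF this] have E_meas: "E \<in> borel_measurable borel"
    unfolding E_def by measurable
  have "?M \<and> ?I"
  proof (cases "q = 0")
    \<comment> \<open>Here the transform is 1, out of reach of \<open>phi\<close>; but gen 1 = 1, so
      both sides of the equation vanish.\<close>
    case True
    then have "z u = 1" for u
      using lap_0[OF P] by (simp add: z_def)
    then show ?thesis
      unfolding mg using True lap_0[OF P] t by simp
  next
    case False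
    with q have q: "0 < q" by simp
    have E_b: "0 \<le> E u" "E u \<le> 1" for u
      using ell_pos[of "max t0 u"] q by (auto simp: E_def)
    have anti: "antimono z"
      unfolding z_def by (intro antimonoI lap_antimono q) auto
    have z_b: "0 \<le> z u" "z u \<le> lap (F t0) q" for u
      unfolding z_def using lap_less_1'[of "max t0 u" q] lap_antimono[of t0 "max t0 u" q] q by auto
    have z0: "lap (F t0) q < 1"
      using lap_less_1'[of t0 q] q by simp
    note ctx = t0 t E_meas E_b anti z_b z0
    have "phi (z u) - phi (z v) = (LINT x|clock u v. E x)" if uv: "t0 \<le> u" "u \<le> v" for u v
    proof -
      have "(LINT x|clock u v. exp (- q * ell x)) = (LINT x|clock u v. E x)"
        by (rule integral_clock_cong[OF exp_ell_measurable E_meas]) (use uv in \<open>simp add: E_def max_absorb2\<close>)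
      then show ?thesis
        using separated_between[OF uv q] uv by (simp add: z_def max_absorb2)
    qed
    then have "z t0 - z t = (LINT u|clock t0 t. E u * (1 - gen (z u)))"
      using integrated_iff_separated[OF ctx] t by blast
    also have "\<dots> = - (LINT u|clock t0 t. E u * (gen (z u) - 1))"
      by (subst Bochner_Integration.integral_minus[symmetric]) (simp add: algebra_simps)
    finally have "z t - z t0 = (LINT u|clock t0 t. E u * (gen (z u) - 1))" by simp
    moreover have "(\<lambda>u. E u * (gen (z u) - 1)) \<in> borel_measurable borel"
      using gen_z_measurable[OF ctx] E_meas by measurable
    ultimately show ?thesis
      unfolding mg using t by (simp add: z_def max_absorb2)
  qed
  then show ?M ?I by auto
qed

text \<open>Collects the measurability and the equation demanded for one test function, in a form
  that survives uniform limits on the half line. Clamping time by \<open>max t0 u\<close> allows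
  measurability on the whole line.\<close>

definition good_test :: "(real \<Rightarrow> real) \<Rightarrow> bool" where
  "good_test b \<longleftrightarrow> b \<in> borel_measurable borel \<and> (\<exists>B. \<forall>y\<ge>0. \<bar>b y\<bar> \<le> B) \<and>
     (\<lambda>u. LINT y|F (max t0 u). b y) \<in> borel_measurable borel \<and>
     (\<lambda>u. merge (F (max t0 u)) b) \<in> borel_measurable borel \<and>
     (\<forall>t\<ge>t0. (LINT y|F t. b y) - (LINT y|F t0. b y) = (LINT u|clock t0 t. merge (F (max t0 u)) b))"

lemma good_test_exp_sum: "good_test (\<lambda>y. \<Sum>j\<le>n. c j * exp (- real j * y))"
  unfolding good_test_def
proof (intro conjI allI impI)
  show "\<exists>B. \<forall>y\<ge>0. \<bar>\<Sum>j\<le>n. c j * exp (- real j * y)\<bar> \<le> B"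
    using exp_sum_bounded by blast
  show "(\<lambda>u. LINT y|F (max t0 u). (\<Sum>j\<le>n. c j * exp (- real j * y))) \<in> borel_measurable borel"
    unfolding lap_sum[OF P[OF max.cobounded1]]
    by (intro borel_measurable_sum borel_measurable_times borel_measurable_const lap_F_measurable) simp
  show "(\<lambda>u. merge (F (max t0 u)) (\<lambda>y. \<Sum>j\<le>n. c j * exp (- real j * y))) \<in> borel_measurable borel"
    using merge_exp_integral(1)[of _ t0] unfolding merge_exp_sum[OF P[OF max.cobounded1]]
    by (intro borel_measurable_sum borel_measurable_times borel_measurable_const) simp_all
  fix t assume t: "t0 \<le> t"
  have int: "integrable (clock t0 t) (\<lambda>u. merge (F (max t0 u)) (\<lambda>y. exp (- real j * y)))" for j
  proof (rule integrable_clock[OF t0 t merge_exp_integral(1)[OF _ t]])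
    show "\<bar>merge (F (max t0 u)) (\<lambda>y. exp (- real j * y))\<bar> \<le> 2 * 1" for u
      by (rule merge_summable(2)[OF P]) auto
  qed simp
  have "(LINT u|clock t0 t. merge (F (max t0 u)) (\<lambda>y. \<Sum>j\<le>n. c j * exp (- real j * y))) =
      (\<Sum>j\<le>n. c j * (lap (F t) (real j) - lap (F t0) (real j)))"
    unfolding merge_exp_sum[OF P[OF max.cobounded1]] using int
    by (subst Bochner_Integration.integral_sum) (auto simp: merge_exp_integral(2)[OF _ t])
  then show "(LINT y|F t. (\<Sum>j\<le>n. c j * exp (- real j * y))) - (LINT y|F t0. (\<Sum>j\<le>n. c j * exp (- real j * y))) =
      (LINT u|clock t0 t. merge (F (max t0 u)) (\<lambda>y. \<Sum>j\<le>n. c j * exp (- real j * y)))"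
    unfolding lap_sum[OF P[OF t]] lap_sum[OF P[OF order_refl]]
    by (simp add: sum_subtractf right_diff_distrib)
qed measurable

text \<open>Integration against a probability measure and \<open>merge\<close> are linear and
  bounded in the sup norm on the half line, with bounds 1 and 2, uniformly over all measures
  involved; so measurability and the equation pass to the limit.\<close>

lemma good_test_limit:
  assumes b: "\<And>n. good_test (b n)" and a: "a \<in> borel_measurable borel"
    and close: "\<And>n y. 0 \<le> y \<Longrightarrow> \<bar>a y - b n y\<bar> \<le> inverse (real (Suc n))"
  shows "good_test a"
proof -
  have b_meas: "b n \<in> borel_measurable borel" for n
    using b by (auto simp: good_test_def)
  obtain B where B: "\<And>n y. 0 \<le> y \<Longrightarrow> \<bar>b n y\<bar> \<le> B n"
    using b unfolding good_test_def by metis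
  define A where "A = B 0 + 1"
  have A: "\<bar>a y\<bar> \<le> A" if "0 \<le> y" for y
    using B[OF that, of 0] close[OF that, of 0] by (simp add: A_def)
  have diff_meas: "(\<lambda>y. a y + (- 1) * b n y) \<in> borel_measurable borel" for n
    using a b_meas by measurable
  have diff_bd: "\<bar>a y + (- 1) * b n y\<bar> \<le> inverse (real (Suc n))" if "0 \<le> y" for y n
    using close[OF that, of n] by simp
  have int_close: "\<bar>(LINT y|M. a y) - (LINT y|M. b n y)\<bar> \<le> inverse (real (Suc n))"
    if M: "prob_Rplus M" for M n
  proof -
    have "(LINT y|M. a y + (- 1) * b n y) = (LINT y|M. a y) - (LINT y|M. b n y)"
      using prob_Rplus_integrable[OF M a A] prob_Rplus_integrable[OF M b_meas B, of n] by simp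
    then show ?thesis
      using prob_Rplus_abs_integral_le[OF M diff_meas diff_bd, of n] by simp
  qed
  have merge_close: "\<bar>merge M a - merge M (b n)\<bar> \<le> 2 * inverse (real (Suc n))"
    if M: "prob_Rplus M" for M n
    using merge_summable(2)[OF M diff_meas diff_bd, of n] merge_add_mult[OF M a A b_meas B, of "- 1" n]
    by simp
  have lim0: "(\<lambda>n. c * inverse (real (Suc n))) \<longlonglongrightarrow> 0" for c
    by (rule tendsto_mult_right_zero[OF LIMSEQ_inverse_real_of_nat])
  have int_lim: "(\<lambda>n. LINT y|M. b n y) \<longlonglongrightarrow> (LINT y|M. a y)" if M: "prob_Rplus M" for M
    by (rule LIM_zero_cancel, rule Lim_null_comparison[OF always_eventually lim0[of 1]])
      (use int_close[OF M] in \<open>simp add: abs_minus_commute\<close>)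
  have merge_lim: "(\<lambda>n. merge M (b n)) \<longlonglongrightarrow> merge M a" if M: "prob_Rplus M" for M
    by (rule LIM_zero_cancel, rule Lim_null_comparison[OF always_eventually lim0[of 2]])
      (use merge_close[OF M] in \<open>simp add: abs_minus_commute\<close>)
  have PM: "prob_Rplus (F (max t0 u))" for u
    by (rule P) simp
  have merge_meas: "(\<lambda>u. merge (F (max t0 u)) a) \<in> borel_measurable borel"
    by (rule borel_measurable_LIMSEQ_real[OF merge_lim[OF PM]]) (use b in \<open>auto simp: good_test_def\<close>)
  show ?thesis
    unfolding good_test_def
  proof (intro conjI allI impI a merge_meas)
    show "\<exists>B. \<forall>y\<ge>0. \<bar>a y\<bar> \<le> B"
      using A by blast
    show "(\<lambda>u. LINT y|F (max t0 u). a y) \<in> borel_measurable borel"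
      by (rule borel_measurable_LIMSEQ_real[OF int_lim[OF PM]]) (use b in \<open>auto simp: good_test_def\<close>)
    fix t assume t: "t0 \<le> t"
    have "(\<lambda>n. LINT u|clock t0 t. merge (F (max t0 u)) (b n)) \<longlonglongrightarrow> (LINT u|clock t0 t. merge (F (max t0 u)) a)"
    proof (rule integral_clock_dominated[OF t0 t _ merge_meas, where S="{}" and B="2 * A + 2"])
      show "(\<lambda>u. merge (F (max t0 u)) (b n)) \<in> borel_measurable borel" for n
        using b by (auto simp: good_test_def)
      fix n u
      have "2 * inverse (real (Suc n)) \<le> 2 * 1"
        by (intro mult_left_mono) (auto simp: inverse_eq_divide)
      then show "\<bar>merge (F (max t0 u)) (b n)\<bar> \<le> 2 * A + 2"
        using merge_close[OF PM, of u n] merge_summable(2)[OF PM a A, of u] by linarith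
    qed (rule countable_empty merge_lim[OF PM])+
    moreover have "(LINT u|clock t0 t. merge (F (max t0 u)) (b n)) = (LINT y|F t. b n y) - (LINT y|F t0. b n y)" for n
      using b[of n] t by (simp add: good_test_def)
    ultimately have "(\<lambda>n. (LINT y|F t. b n y) - (LINT y|F t0. b n y)) \<longlonglongrightarrow> (LINT u|clock t0 t. merge (F (max t0 u)) a)"
      by simp
    moreover have "(\<lambda>n. (LINT y|F t. b n y) - (LINT y|F t0. b n y)) \<longlonglongrightarrow> (LINT y|F t. a y) - (LINT y|F t0. a y)"
      using t by (intro tendsto_diff int_lim P) auto
    ultimately show "(LINT y|F t. a y) - (LINT y|F t0. a y) = (LINT u|clock t0 t. merge (F (max t0 u)) a)"
      by (rule LIMSEQ_unique[symmetric])
  qed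
qed

lemma C0_measurable: "a \<in> C0 \<Longrightarrow> a \<in> borel_measurable borel"
  by (auto simp: C0_def intro: borel_measurable_continuous_onI)

lemma good_test_C0:
  assumes a: "a \<in> C0"
  shows "good_test a"
proof -
  have "\<exists>c m. \<forall>y\<ge>0. \<bar>a y - (\<Sum>j\<le>m. c j * exp (- real j * y))\<bar> < inverse (real (Suc n))" for n :: nat
    using C0_approx_exp_sum[OF a, of "inverse (real (Suc n))"] by (metis inverse_positive_iff_positive of_nat_0_less_iff zero_less_Suc)
  then obtain c m where cm: "\<And>n y. 0 \<le> y \<Longrightarrow> \<bar>a y - (\<Sum>j\<le>m n. c n j * exp (- real j * y))\<bar> < inverse (real (Suc n))"
    by metis
  show ?thesis
    by (rule good_test_limit[OF good_test_exp_sum C0_measurable[OF a] less_imp_le[OF cm]])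
qed

lemma separated_imp_weak_solution: "weak_solution p {t0..} F"
  unfolding weak_solution_def
proof (intro conjI ballI)
  show "prob_Rplus (F t)" "0 < pmin (F t)" if "t \<in> {t0..}" for t
    using that P ell_pos ell_eq by auto
  show "mono_on {t0..} (\<lambda>t. pmin (F t))"
    using ell_eq monoD[OF ell(1)] by (auto intro!: mono_onI)
next
  fix a assume a: "a \<in> C0"
  have "(\<lambda>u. LINT y|F (max t0 u). a y) \<in> borel_measurable borel"
    using good_test_C0[OF a] by (simp add: good_test_def)
  then have "(\<lambda>u. LINT y|F (max t0 u). a y) \<in> borel_measurable (restrict_space borel {t0..})"
    by (rule measurable_restrict_space1)
  then show "(\<lambda>t. LINT y|F t. a y) \<in> borel_measurable (restrict_space borel {t0..})"
    by (subst measurable_cong[where g="\<lambda>u. LINT y|F (max t0 u). a y"])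
      (auto simp: space_restrict_space max_absorb2)
next
  fix a s t assume a: "a \<in> C0" and s: "s \<in> {t0..}" and t: "t \<in> {t0..}"
  define g where "g u = merge (F (max t0 u)) a" for u
  have good: "good_test a" by (rule good_test_C0[OF a])
  then obtain A where A: "\<And>y. 0 \<le> y \<Longrightarrow> \<bar>a y\<bar> \<le> A"
    by (auto simp: good_test_def)
  have g_meas: "g \<in> borel_measurable borel"
    using good unfolding g_def[abs_def] good_test_def by blast
  have g_b: "\<bar>g u\<bar> \<le> 2 * A" for u
    unfolding g_def by (rule merge_summable(2)[OF P C0_measurable[OF a] A]) auto
  have rhs: "clust_rhs p F a u = g u / (Q1 p * u)" if "t0 \<le> u" for u
    using that by (simp add: clust_rhs_eq g_def max_absorb2)
  have main: "interval_lebesgue_integrable lborel (ereal u) (ereal v) (clust_rhs p F a)"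
    "(LINT y|F v. a y) - (LINT y|F u. a y) = (LBINT s=u..v. clust_rhs p F a s)"
    if uv: "t0 \<le> u" "u \<le> v" for u v
  proof -
    have u: "0 < u" using uv t0 by simp
    show "interval_lebesgue_integrable lborel (ereal u) (ereal v) (clust_rhs p F a)"
      by (rule set_integrable_imp_interval[OF uv(2) set_integrable_clock[OF u uv(2) g_meas g_b]])
        (use rhs uv in auto)
    have "(LINT s|clock t0 v. g s) = (LINT s|clock t0 u. g s) + (LINT s|clock u v. g s)"
      by (rule integral_clock_combine[OF t0 uv g_meas g_b])
    moreover have "(LBINT s=u..v. clust_rhs p F a s) = (LINT s|clock u v. g s)"
      by (rule integral_clock[OF u uv(2) g_meas]) (use rhs uv in auto)
    ultimately show "(LINT y|F v. a y) - (LINT y|F u. a y) = (LBINT s=u..v. clust_rhs p F a s)"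
      using good uv unfolding good_test_def g_def[symmetric]
      by (smt (verit))
  qed
  have "interval_lebesgue_integrable lborel (ereal s) (ereal t) (clust_rhs p F a) \<and>
    (LINT y|F t. a y) - (LINT y|F s. a y) = (LBINT s=s..t. clust_rhs p F a s)"
  proof (cases "s \<le> t")
    case True
    then show ?thesis using main[of s t] s by simp
  next
    case False
    have "(LBINT s=s..t. clust_rhs p F a s) = - (LBINT s=t..s. clust_rhs p F a s)"
      by (rule interval_integral_endpoints_reverse)
    moreover have "interval_lebesgue_integrable lborel (ereal s) (ereal t) (clust_rhs p F a)"
      by (rule interval_integrable_endpoints_reverse[THEN iffD1, OF main(1)]) (use t False in auto)
    ultimately show ?thesis
      using main(2)[of t s] t False by simp
  qed
  then show "interval_lebesgue_integrable lborel (ereal s) (ereal t) (clust_rhs p F a)"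
    "(LINT y|F t. a y) - (LINT y|F s. a y) = (LBINT s=s..t. clust_rhs p F a s)"
    by auto
qed

end

end

section \<open>Uniqueness\<close>

context min_clustering
begin

lemma phi_minus_id_bounds:
  assumes "0 \<le> z" "z \<le> z0" "z0 < 1"
  shows "0 \<le> phi z - z" "phi z - z \<le> z\<^sup>2 / (1 - z0)"
proof -
  show "0 \<le> phi z - z"
    using phi_ge[of z] assms by simp
  have "phi z - z \<le> z / (1 - z) - z"
    using phi_le[of z] assms by simp
  also have "\<dots> = z\<^sup>2 / (1 - z)"
    using assms by (simp add: field_simps power2_eq_square)
  also have "\<dots> \<le> z\<^sup>2 / (1 - z0)"
    using assms by (intro divide_left_mono) auto
  finally show "phi z - z \<le> z\<^sup>2 / (1 - z0)" .
qed

context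
  fixes F :: "real \<Rightarrow> real measure" and a b :: real
  assumes F: "weak_solution p {a..b} F" and a: "0 < a"
begin

lemma weak_solution_prob: "t \<in> {a..b} \<Longrightarrow> prob_Rplus (F t)"
  and weak_solution_pmin_pos: "t \<in> {a..b} \<Longrightarrow> 0 < pmin (F t)"
  and weak_solution_pmin_mono: "s \<in> {a..b} \<Longrightarrow> t \<in> {a..b} \<Longrightarrow> s \<le> t \<Longrightarrow> pmin (F s) \<le> pmin (F t)"
  using F by (auto simp: weak_solution_def mono_on_def)

text \<open>Extended by constants beyond \<open>{a..b}\<close>, which makes the path monotone, hence
  measurable, on the whole line.\<close>

definition ell_of :: "real \<Rightarrow> real" where
  "ell_of u = pmin (F (max a (min b u)))"

lemma ell_of_eq: "u \<in> {a..b} \<Longrightarrow> ell_of u = pmin (F u)"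
  by (simp add: ell_of_def max_absorb2 min_absorb2)

lemma mono_ell_of:
  assumes "a \<le> b"
  shows "mono ell_of"
  unfolding ell_of_def using assms by (intro monoI weak_solution_pmin_mono) auto

lemma ell_of_pos: "a \<le> b \<Longrightarrow> 0 < ell_of u"
  unfolding ell_of_def by (intro weak_solution_pmin_pos) auto

lemma exp_ell_of_measurable: "a \<le> b \<Longrightarrow> (\<lambda>u. exp (- q * ell_of u)) \<in> borel_measurable borel"
  using borel_measurable_mono[OF mono_ell_of] by measurable

lemma weak_solution_separated:
  assumes "a \<le> s" "s \<le> t" "t \<le> b" "0 < q"
  shows "phi (lap (F s) q) - phi (lap (F t) q) = (LINT u|clock s t. exp (- q * ell_of u))"
  by (rule weak_solution_imp_separated[OF F a mono_ell_of ell_of_eq assms]) (use assms in auto)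

lemma weak_solution_lap_less_1:
  assumes "t \<in> {a..b}" "0 < q"
  shows "0 < lap (F t) q" "lap (F t) q < 1"
  using lap_pos[OF weak_solution_prob[OF assms(1)], of q] assms
    lap_less_1[OF weak_solution_prob weak_solution_pmin_pos] lap_less_1[of "F t" q]
    weak_solution_prob[OF assms(1)] weak_solution_pmin_pos[OF assms(1)] by auto

lemma weak_solution_lap_diff:
  assumes st: "a \<le> s" "s \<le> t" "t \<le> b" and q: "0 < q"
  shows "\<bar>lap (F s) q - lap (F t) q\<bar> \<le> (t - s) / a"
proof -
  have s: "0 < s" and ab: "a \<le> b" using st a by auto
  have "\<bar>exp (- q * ell_of u)\<bar> \<le> 1" for u
    using ell_of_pos[OF ab, of u] q by simp
  then have "\<bar>phi (lap (F s) q) - phi (lap (F t) q)\<bar> \<le> 1 * (ln (t / s) / Q1 p)"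
    unfolding weak_solution_separated[OF st q]
    by (intro integral_clock_abs_le s st exp_ell_of_measurable ab)
  also have "\<dots> \<le> (t - s) / s"
    using clock_total_le[OF s st(2)] by simp
  also have "\<dots> \<le> (t - s) / a"
    using st a by (intro divide_left_mono) auto
  finally have "\<bar>phi (lap (F s) q) - phi (lap (F t) q)\<bar> \<le> (t - s) / a" .
  moreover have "\<bar>lap (F s) q - lap (F t) q\<bar> \<le> \<bar>phi (lap (F s) q) - phi (lap (F t) q)\<bar>"
    using weak_solution_lap_less_1[of s q] weak_solution_lap_less_1[of t q] st q
    by (intro phi_abs_diff_ge) auto
  ultimately show ?thesis by linarith
qed

text \<open>If the min were at least x immediately after s, the Laplace transforms there would be at
  most exp (- q x). By continuity in time so would be the one at s, and its decay rate would push
  the min at s up to x.\<close>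

lemma weak_solution_pmin_right:
  assumes s: "a \<le> s" "s < b" and x: "pmin (F s) < x"
  obtains t where "s < t" "t \<le> b" "pmin (F t) < x"
proof (rule ccontr)
  assume "\<not> thesis"
  with that have ge: "x \<le> pmin (F t)" if "s < t" "t \<le> b" for t
    using that by force
  have "lap (F s) q \<le> 1 * exp (- q * x)" if "1 \<le> q" for q
  proof (rule field_le_epsilon)
    fix e :: real assume e: "0 < e"
    define t where "t = min b (s + a * e)"
    have t: "s < t" "t \<le> b" "t - s \<le> a * e"
      using s e a by (auto simp: t_def)
    have "lap (F s) q \<le> lap (F t) q + (t - s) / a"
      using weak_solution_lap_diff[of s t q] s t that by simp
    also have "lap (F t) q \<le> exp (- q * pmin (F t))"
      by (rule lap_le_pmin[OF weak_solution_prob]) (use s t that in auto)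
    also have "\<dots> \<le> exp (- q * x)"
      using ge[OF t(1,2)] that by simp
    also have "(t - s) / a \<le> e"
      using t(3) a by (simp add: field_simps)
    finally show "lap (F s) q \<le> 1 * exp (- q * x) + e" by simp
  qed
  then have "x \<le> pmin (F s)"
    using s by (intro le_pminI[OF weak_solution_prob, where C=1]) auto
  with x show False by simp
qed

text \<open>Prepares the use of Helly's selection theorem, which is applied to right-continuous
  paths.\<close>

lemma ell_of_right_continuous:
  assumes "a \<le> b"
  shows "continuous (at_right s) ell_of"
  unfolding continuous_within
proof (rule tendstoI)
  fix e :: real assume e: "0 < e"
  have ex: "\<exists>t>s. ell_of t < ell_of s + e"
  proof (cases "a \<le> s \<and> s < b")
    case True
    then obtain t where "s < t" "t \<le> b" "pmin (F t) < ell_of s + e"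
      using weak_solution_pmin_right[of s "ell_of s + e"] ell_of_eq[of s] e by auto
    then show ?thesis
      using True ell_of_eq[of t] by auto
  next
    \<comment> \<open>Outside \<open>[a, b)\<close> the path is constant for a while to the right:
      up to a on the left of the interval, forever from b on.\<close>
    case False
    then have "ell_of ((if s < a then a else s + 1)) = ell_of s"
      using assms by (auto simp: ell_of_def min_def max_def)
    then show ?thesis
      using False e by (intro exI[of _ "if s < a then a else s + 1"]) auto
  qed
  then obtain t where t: "s < t" "ell_of t < ell_of s + e" by blast
  have "\<forall>\<^sub>F u in at_right s. u \<in> {s<..<t}"
    using t(1) by (rule eventually_at_right_real)
  then show "\<forall>\<^sub>F u in at_right s. dist (ell_of u) (ell_of s) < e"
  proof eventually_elim
    case (elim u)
    then have "ell_of s \<le> ell_of u" "ell_of u \<le> ell_of t"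
      using monoD[OF mono_ell_of[OF assms]] by auto
    with t(2) show ?case by (simp add: dist_real_def)
  qed
qed

lemma mik_clock_sums:
  assumes "a \<le> t" "t \<le> b"
  shows "(\<lambda>k. (-1) ^ k / fact (Suc k) * (exp (real (Suc k) * real N * x) *
      (LINT u|clock a t. exp (- (real (Suc k) * real N) * ell_of u)))) sums (LINT u|clock a t. mik (real N) x (ell_of u))"
proof (rule mik_integral_sums)
  have ab: "a \<le> b" using assms by simp
  show "finite_measure (clock a t)"
    by (rule finite_measure_clock[OF a assms(1)])
  show "ell_of \<in> borel_measurable (clock a t)"
    using borel_measurable_mono[OF mono_ell_of[OF ab]] by simp
  show "AE u in clock a t. 0 \<le> ell_of u"
    using ell_of_pos[OF ab] by (simp add: less_imp_le)
qed simp

lemma mik_lap_sums: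
  assumes "t \<in> {a..b}"
  shows "(\<lambda>k. (-1) ^ k / fact (Suc k) * (exp (real (Suc k) * real N * x) * lap (F t) (real (Suc k) * real N)))
    sums (LINT y|F t. mik (real N) x y)"
proof -
  interpret real_distribution "F t"
    by (rule prob_RplusD[OF weak_solution_prob[OF assms]])
  show ?thesis
    using mik_integral_sums[OF finite_measure_axioms _ prob_RplusD(5)[OF weak_solution_prob[OF assms]], of "real N" x]
    by (simp add: lap_def)
qed

text \<open>The remainder of \<open>phi\<close> after its linear part is quadratic, so it decays at
  twice the rate of the transform. The constant depends on the initial min only, hence is common to
  two solutions with the same initial measure and uniform in \<open>q\<close>.\<close>

lemma weak_solution_lap_square:
  assumes t: "t \<in> {a..b}" and q: "1 \<le> q" and c: "c \<le> pmin (F t)"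
  shows "\<bar>phi (lap (F t) q) - lap (F t) q\<bar> \<le> 1 / (1 - exp (- pmin (F a))) * exp (- q * (2 * c))"
proof -
  have P: "prob_Rplus (F t)" "0 < pmin (F a)" "pmin (F a) \<le> pmin (F t)"
    using t by (auto intro: weak_solution_prob weak_solution_pmin_pos weak_solution_pmin_mono)
  have le: "lap (F t) q \<le> exp (- q * pmin (F t))"
    using lap_le_pmin[OF P(1)] q by simp
  have "1 * pmin (F a) \<le> q * pmin (F t)"
    using P q by (intro mult_mono) auto
  with le have le2: "lap (F t) q \<le> exp (- pmin (F a))"
    by (smt (verit) exp_le_cancel_iff mult_minus_left)
  have le3: "lap (F t) q \<le> exp (- q * c)"
    by (rule order_trans[OF le]) (use c q in \<open>simp add: mult_left_mono\<close>)
  have "0 \<le> lap (F t) q"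
    using lap_pos[OF P(1), of q] q by simp
  then have "\<bar>phi (lap (F t) q) - lap (F t) q\<bar> \<le> (lap (F t) q)\<^sup>2 / (1 - exp (- pmin (F a)))"
    using phi_minus_id_bounds[OF _ le2] P by simp
  also have "\<dots> \<le> (exp (- q * c))\<^sup>2 / (1 - exp (- pmin (F a)))"
    using \<open>0 \<le> lap (F t) q\<close> le3 P by (intro divide_right_mono power_mono) auto
  also have "(exp (- q * c))\<^sup>2 = exp (- q * (2 * c))"
    by (simp add: exp_double[symmetric] mult.left_commute)
  finally show ?thesis by simp
qed

end

text \<open>If the min of \<open>F\<close> were smaller at time s, then it would stay so up to some t > s. Below
  twice the min of \<open>F t\<close>, the sum of \<open>F t\<close> and the image of the clock under the min is determined
  by the initial measure, since \<open>phi\<close> is the identity to first order. Comparing its mass just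
  above the min of \<open>F t\<close> gives \<open>clock a t\<close> for \<open>F\<close>, but at most \<open>clock a s\<close> for \<open>G\<close>.\<close>
lemma weak_solution_pmin_le:
  assumes F: "weak_solution p {a..b} F" and G: "weak_solution p {a..b} G" and a: "0 < a"
    and FG: "F a = G a" and s: "a \<le> s" "s < b"
  shows "pmin (G s) \<le> pmin (F s)"
proof (rule ccontr)
  assume "\<not> ?thesis"
  then obtain t where t: "s < t" "t \<le> b" "pmin (F t) < pmin (G s)"
    using weak_solution_pmin_right[OF F a s, of "pmin (G s)"] by auto
  define c where "c = pmin (F t)"
  define g where "g = pmin (G s)"
  have tab: "t \<in> {a..b}" and ab: "a \<le> b" and at: "a \<le> t" and sab: "s \<in> {a..b}" using s t by auto
  have c: "0 < c" "c < g"
    using weak_solution_pmin_pos[OF F a tab] t(3) by (auto simp: c_def g_def)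
  \<comment> \<open>The level lies between the two mins, so that the kernel separates them, and
    below \<open>2 * c\<close>, where the remainder of \<open>phi\<close> is invisible.\<close>
  then obtain x where x: "c < x" "x < g" "x < 2 * c"
    using dense[of c "min g (2 * c)"] by auto
  define eF where "eF = ell_of F a b"
  define eG where "eG = ell_of G a b"
  have eF_le: "eF u \<le> c" if "u \<in> {a..t}" for u
    using weak_solution_pmin_mono[OF F a, of u t] ell_of_eq[OF F a, of u] that tab by (simp add: eF_def c_def)
  have eG_ge: "g \<le> eG u" if "u \<in> {s..t}" for u
    using weak_solution_pmin_mono[OF G a, of s u] ell_of_eq[OF G a, of u] that sab tab s
    by (simp add: eG_def g_def)
  have meas [measurable]: "eF \<in> borel_measurable borel" "eG \<in> borel_measurable borel"
    unfolding eF_def eG_def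
    using borel_measurable_mono[OF mono_ell_of[OF F a ab]] borel_measurable_mono[OF mono_ell_of[OF G a ab]] by auto
  have [measurable]: "mik n x \<in> borel_measurable borel" for n
    unfolding mik_def by measurable
  have G_pmin: "g \<le> pmin (G t)"
    using weak_solution_pmin_mono[OF G a sab tab] t by (simp add: g_def)
  \<comment> \<open>By the separated equations up to t, whose initial terms agree, this is a
    difference of two remainders of \<open>phi\<close>; \<open>D\<close> is the same combination
    with the kernel in place of the exponential.\<close>
  define d where "d q = (LINT u|clock a t. exp (- q * eF u)) + lap (F t) q
      - (LINT u|clock a t. exp (- q * eG u)) - lap (G t) q" for q
  define D where "D N = (LINT u|clock a t. mik (real N) x (eF u)) + (LINT y|F t. mik (real N) x y)
      - (LINT u|clock a t. mik (real N) x (eG u)) - (LINT y|G t. mik (real N) x y)" for N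
  define C where "C = 1 / (1 - exp (- pmin (F a)))"
  have D0: "D \<longlonglongrightarrow> 0"
  proof (rule mik_diff_tendsto_0)
    show "\<bar>d q\<bar> \<le> (2 * C) * exp (- q * (2 * c))" if q: "1 \<le> q" for q
    proof -
      have "d q = (phi (lap (G t) q) - lap (G t) q) - (phi (lap (F t) q) - lap (F t) q)"
        using weak_solution_separated[OF F a order_refl at t(2), of q]
          weak_solution_separated[OF G a order_refl at t(2), of q] q FG
        by (simp add: d_def eF_def eG_def)
      moreover have "\<bar>phi (lap (F t) q) - lap (F t) q\<bar> \<le> C * exp (- q * (2 * c))"
        unfolding C_def by (rule weak_solution_lap_square[OF F a tab q]) (simp add: c_def)
      moreover have "\<bar>phi (lap (G t) q) - lap (G t) q\<bar> \<le> C * exp (- q * (2 * c))"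
        unfolding C_def FG by (rule weak_solution_lap_square[OF G a tab q]) (use G_pmin c in simp)
      ultimately show ?thesis by linarith
    qed
    show "(\<lambda>k. (-1) ^ k / fact (Suc k) * (exp (real (Suc k) * real N * x) * d (real (Suc k) * real N))) sums D N" for N
      using sums_diff[OF sums_diff[OF sums_add[OF mik_clock_sums[OF F a at t(2)] mik_lap_sums[OF F a tab]]
            mik_clock_sums[OF G a at t(2)]] mik_lap_sums[OF G a tab], of N x N x N x N x]
      unfolding D_def d_def eF_def eG_def by (simp only: algebra_simps)
  qed (use x in auto)
  define k where "k u v = ln (v / u) / Q1 p" for u v
  have low: "mik (real N) x c * k a t - (k a s + exp (- real N * (g - x)) * k s t) - exp (- real N * (g - x)) \<le> D N" for N
  proof -
    have mb: "\<bar>mik (real N) x y\<bar> \<le> 1" for y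
      using mik_bounds[of "real N" x y] by simp
    have "mik (real N) x c * k a t = (LINT u|clock a t. mik (real N) x c)"
      unfolding k_def by (rule integral_clock_const[OF a at, symmetric])
    also have "\<dots> \<le> (LINT u|clock a t. mik (real N) x (eF u))"
      by (rule integral_clock_mono[OF a at, where B=1 and B'=1]) (use mb eF_le in \<open>auto intro: mik_ge\<close>)
    finally have 1: "mik (real N) x c * k a t \<le> (LINT u|clock a t. mik (real N) x (eF u))" .
    have 2: "0 \<le> (LINT y|F t. mik (real N) x y)"
      by (rule integral_nonneg_AE) (simp add: mik_bounds)
    have s0: "0 < s" using s a by simp
    have split: "(LINT u|clock a t. mik (real N) x (eG u)) =
        (LINT u|clock a s. mik (real N) x (eG u)) + (LINT u|clock s t. mik (real N) x (eG u))"
      by (rule integral_clock_combine[OF a s(1), where B=1]) (use t mb in auto)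
    have "\<bar>LINT u|clock a s. mik (real N) x (eG u)\<bar> \<le> 1 * (ln (s / a) / Q1 p)"
      by (rule integral_clock_abs_le[OF a s(1)]) (use mb in auto)
    moreover have "\<bar>LINT u|clock s t. mik (real N) x (eG u)\<bar> \<le> exp (- real N * (g - x)) * (ln (t / s) / Q1 p)"
    proof (rule integral_clock_abs_le[OF s0 less_imp_le[OF t(1)]])
      fix u assume "u \<in> {s..t}"
      then show "\<bar>mik (real N) x (eG u)\<bar> \<le> exp (- real N * (g - x))"
        using mik_le[of "real N" g "eG u" x] mik_bounds[of "real N" x "eG u"] eG_ge by simp
    qed measurable
    ultimately have 3: "(LINT u|clock a t. mik (real N) x (eG u)) \<le> k a s + exp (- real N * (g - x)) * k s t"
      unfolding split k_def by linarith
    interpret Gt: real_distribution "G t"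
      by (rule prob_RplusD[OF weak_solution_prob[OF G a tab]])
    have "(LINT y|G t. mik (real N) x y) \<le> (LINT y|G t. exp (- real N * (g - x)))"
    proof (rule integral_mono_AE)
      show "integrable (G t) (mik (real N) x)"
        by (rule Gt.integrable_const_bound[where B=1]) (use mb in auto)
      show "AE y in G t. mik (real N) x y \<le> exp (- real N * (g - x))"
        using pmin_AE[OF weak_solution_prob[OF G a tab]]
        by eventually_elim (rule mik_le; use G_pmin in simp)
    qed simp
    then have 4: "(LINT y|G t. mik (real N) x y) \<le> exp (- real N * (g - x))"
      by (simp add: Gt.prob_space[unfolded Gt.space_eq_univ])
    show ?thesis
      unfolding D_def using 1 2 3 4 by linarith
  qed
  have "(\<lambda>N. mik (real N) x c * k a t - (k a s + exp (- real N * (g - x)) * k s t) - exp (- real N * (g - x)))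
      \<longlonglongrightarrow> 1 * k a t - (k a s + 0 * k s t) - 0"
    using x by (intro tendsto_intros mik_tendsto_1 exp_real_tendsto_0) auto
  then have "1 * k a t - (k a s + 0 * k s t) - 0 \<le> 0"
    by (rule LIMSEQ_le[OF _ D0]) (use low in auto)
  moreover have "k a s < k a t"
    unfolding k_def using s t a Q1_pos by (intro divide_strict_right_mono) (auto simp: divide_strict_right_mono)
  ultimately show False by simp
qed

lemma weak_solution_unique:
  assumes F: "weak_solution p {a..b} F" and G: "weak_solution p {a..b} G" and a: "0 < a"
    and FG: "F a = G a" and t: "t \<in> {a..b}"
  shows "F t = G t"
proof (rule lap_unique)
  show "prob_Rplus (F t)" "prob_Rplus (G t)"
    using weak_solution_prob[OF F a t] weak_solution_prob[OF G a t] by auto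
  fix q :: real assume q: "0 < q"
  have ab: "a \<le> b" and at: "a \<le> t" "t \<le> b" using t by auto
  \<comment> \<open>The comparison of mins needs room to the right of u, so the end point b escapes
    it; the clock does not charge a single point.\<close>
  have eq: "ell_of F a b u = ell_of G a b u" if "u \<in> {a..t}" "u \<notin> {b}" for u
    using weak_solution_pmin_le[OF F G a FG, of u] weak_solution_pmin_le[OF G F a FG[symmetric], of u]
      ell_of_eq[OF F a, of u] ell_of_eq[OF G a, of u] that t by auto
  have "AE u in clock a t. u \<in> {a..t}" "AE u in clock a t. u \<notin> {b}"
    using AE_clock[of a t] AE_clock_countable[of "{b}" a t] by simp_all
  then have "AE u in clock a t. exp (- q * ell_of F a b u) = exp (- q * ell_of G a b u)"
  proof eventually_elim
    case (elim u)
    then show ?case using eq[of u] by simp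
  qed
  then have "(LINT u|clock a t. exp (- q * ell_of F a b u)) = (LINT u|clock a t. exp (- q * ell_of G a b u))"
    using exp_ell_of_measurable[OF F a ab, of q] exp_ell_of_measurable[OF G a ab, of q]
    by (intro integral_cong_AE) auto
  then have "phi (lap (F t) q) = phi (lap (G t) q)"
    using weak_solution_separated[OF F a order_refl at q] weak_solution_separated[OF G a order_refl at q] FG
    by simp
  then show "lap (F t) q = lap (G t) q"
    using inj_onD[OF phi_inj] weak_solution_lap_less_1[OF F a t q] weak_solution_lap_less_1[OF G a t q]
    by (simp add: less_imp_le)
qed

end

section \<open>Compactness\<close>

context min_clustering
begin

text \<open>The logarithmic blow-up of \<open>phi\<close> in exponential form: changing
  \<open>phi\<close> by a bounded amount multiplies the distance to 1 by a bounded factor.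
  Transforms that tend to 1 as q tends to 0 therefore keep doing so.\<close>

lemma one_minus_le_of_phi:
  assumes "a \<in> {0..<1}" "b \<in> {0..<1}"
  shows "1 - a \<le> (1 - b) * exp (Q1 p * \<bar>phi b - phi a\<bar>)"
proof (cases "a \<le> b")
  case True
  have "ln ((1 - a) / (1 - b)) \<le> Q1 p * \<bar>phi b - phi a\<bar>"
    using phi_diff_ge_ln[of a b] phi_mono[of a b] True assms by simp
  then have "(1 - a) / (1 - b) \<le> exp (Q1 p * \<bar>phi b - phi a\<bar>)"
    using assms by (subst ln_le_cancel_iff[symmetric]) auto
  then show ?thesis
    using assms by (simp add: field_simps)
next
  case False
  have "(1 - b) * 1 \<le> (1 - b) * exp (Q1 p * \<bar>phi b - phi a\<bar>)"
    using assms Q1_pos by (intro mult_left_mono) auto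
  then show ?thesis using False by simp
qed

lemma isCont_phi:
  assumes "0 < z" "z < 1"
  shows "isCont phi z"
proof -
  obtain b where b: "z < b" "b < 1"
    using assms dense by blast
  show ?thesis
    by (rule continuous_on_interior[OF continuous_on_phi[OF b(2)]]) (use assms b in auto)
qed

context
  fixes Fn :: "nat \<Rightarrow> real \<Rightarrow> real measure" and en :: "nat \<Rightarrow> real \<Rightarrow> real"
    and Fh :: "real measure" and t0 :: real
  assumes t0: "0 < t0" and P: "\<And>n t. t0 \<le> t \<Longrightarrow> prob_Rplus (Fn n t)"
    and en: "\<And>n. mono (en n)" "\<And>n x. continuous (at_right x) (en n)" "\<And>n x. 0 < en n x"
    and lap_en: "\<And>n t q. t0 \<le> t \<Longrightarrow> 0 < q \<Longrightarrow> lap (Fn n t) q \<le> exp (- q * en n t)"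
    and Fh: "prob_Rplus Fh" "0 < pmin Fh"
    and init: "\<And>q. 0 < q \<Longrightarrow> (\<lambda>n. lap (Fn n t0) q) \<longlonglongrightarrow> lap Fh q"
    and err: "\<And>t q. t0 \<le> t \<Longrightarrow> 0 < q \<Longrightarrow>
      (\<lambda>n. phi (lap (Fn n t) q) - phi (lap (Fn n t0) q) + (LINT u|clock t0 t. exp (- q * en n u))) \<longlonglongrightarrow> 0"
begin

lemma lap_Fn: "t0 \<le> t \<Longrightarrow> 0 < q \<Longrightarrow> lap (Fn n t) q \<in> {0..<1}"
  using lap_pos[OF P, of t q n] lap_en[of t q n] en(3)[of n t]
  by (smt (verit) atLeastLessThan_iff exp_less_one_iff mult_minus_left mult_pos_pos)

lemma lap_Fh: "0 < q \<Longrightarrow> 0 < lap Fh q" "0 < q \<Longrightarrow> lap Fh q < 1"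
  using lap_pos[OF Fh(1), of q] lap_less_1[OF Fh(1) _ Fh(2), of q] by auto

text \<open>The paths \<open>en\<close> only have to bound the decay of the transforms, and the
  separated equation only has to hold up to a vanishing error. The statement thus covers exact
  solutions with converging data as well as Euler approximations.\<close>

lemma limit_weak_solution:
  obtains r F where "strict_mono (r :: nat \<Rightarrow> nat)" "weak_solution p {t0..} F" "F t0 = Fh"
    "\<And>t. t0 \<le> t \<Longrightarrow> weak_conv_m (\<lambda>n. Fn (r n) t) (F t)"
proof -
  \<comment> \<open>Helly's theorem needs bounded increasing functions. The transformed paths stay
    in \<open>{-1..<0}\<close>, and the value 0 stands for an infinite min.\<close>
  define Gn where "Gn n x = - exp (- en n x)" for n x
  have Gn_rc: "continuous (at_right x) (Gn n)" for n x
    unfolding Gn_def by (intro continuous_intros en)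
  have Gn_mono: "mono (Gn n)" for n
    unfolding Gn_def using monoD[OF en(1)] by (intro monoI) auto
  have Gn_bd: "\<bar>Gn n x\<bar> \<le> 1" for n x
    using en(3)[of n x] by (simp add: Gn_def)
  obtain r G where r: "strict_mono r" and G_rc: "\<And>x. continuous (at_right x) G" and G: "mono G"
    and G_bd: "\<And>x. \<bar>G x\<bar> \<le> 1" and G_lim: "\<And>x. isCont G x \<Longrightarrow> (\<lambda>n. Gn (r n) x) \<longlonglongrightarrow> G x"
    using Helly_selection[of Gn 1, OF Gn_rc Gn_mono Gn_bd] by blast
  define S where "S = {x. \<not> isCont G x}"
  have S: "countable S"
    unfolding S_def by (rule mono_ctble_discont[OF G])
  have cont_pt: "\<exists>y. x < y \<and> y < z \<and> isCont G y" if "x < z" for x z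
    using open_minus_countable[OF S, of "{x<..<z}"] that by (auto simp: S_def)
  have G_meas [measurable]: "G \<in> borel_measurable borel"
    by (rule borel_measurable_mono[OF G])
  have G_le_0: "G x \<le> 0" for x
  proof -
    obtain y where y: "x < y" "isCont G y"
      using cont_pt[of x "x + 1"] by auto
    have "G y \<le> 0"
      by (rule LIMSEQ_le_const2[OF G_lim[OF y(2)]]) (simp add: Gn_def)
    with monoD[OF G, of x y] y show ?thesis by simp
  qed
  \<comment> \<open>In this form the intensity also makes sense where the limit \<open>G\<close> is
    0, with the correct value 0, before such points are excluded.\<close>
  have exp_powr: "exp (- q * en n x) = (- Gn n x) powr q" for q n x
    by (simp add: Gn_def powr_def)
  define W where "W t q = (LINT u|clock t0 t. (- G u) powr q)" for t q
  have W_meas: "(\<lambda>u. (- G u) powr q) \<in> borel_measurable borel" for q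
    by measurable
  have powr_bd: "\<bar>(- G u) powr q\<bar> \<le> 1" if "0 < q" for u q
    using powr_mono2[of q "- G u" 1] G_bd[of u] G_le_0[of u] that by simp
  have int_lim: "(\<lambda>n. LINT u|clock t0 t. exp (- q * en (r n) u)) \<longlonglongrightarrow> W t q" if t: "t0 \<le> t" and q: "0 < q" for t q
    unfolding W_def
  proof (rule integral_clock_dominated[OF t0 t _ W_meas _ S, where B=1])
    show "(\<lambda>u. exp (- q * en (r n) u)) \<in> borel_measurable borel" for n
      using borel_measurable_mono[OF en(1)] by measurable
    show "\<bar>exp (- q * en (r n) u)\<bar> \<le> 1" for n u
      using en(3)[of "r n" u] q by simp
    fix u assume "u \<in> {t0..t} - S"
    then have "(\<lambda>n. - Gn (r n) u) \<longlonglongrightarrow> - G u"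
      by (intro tendsto_minus G_lim) (simp add: S_def)
    then show "(\<lambda>n. exp (- q * en (r n) u)) \<longlonglongrightarrow> (- G u) powr q"
      unfolding exp_powr using q
      by (intro tendsto_powr') (auto simp: Gn_def)
  qed
  have init': "(\<lambda>n. lap (Fn (r n) t0) q) \<longlonglongrightarrow> lap Fh q" if "0 < q" for q
    using LIMSEQ_subseq_LIMSEQ[OF init[OF that] r] by (simp add: o_def)
  have phi_init: "(\<lambda>n. phi (lap (Fn (r n) t0) q)) \<longlonglongrightarrow> phi (lap Fh q)" if "0 < q" for q
    by (rule isCont_tendsto_compose[OF isCont_phi init']) (use lap_Fh that in auto)
  have phi_lim: "(\<lambda>n. phi (lap (Fn (r n) t) q)) \<longlonglongrightarrow> phi (lap Fh q) - W t q" if t: "t0 \<le> t" and q: "0 < q" for t q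
  proof -
    have "(\<lambda>n. phi (lap (Fn (r n) t) q) - phi (lap (Fn (r n) t0) q) + (LINT u|clock t0 t. exp (- q * en (r n) u))) \<longlonglongrightarrow> 0"
      using LIMSEQ_subseq_LIMSEQ[OF err[OF t q] r] by (simp add: o_def)
    from tendsto_diff[OF tendsto_add[OF this phi_init[OF q]] int_lim[OF t q]]
    show ?thesis by simp
  qed
  have W_nonneg: "0 \<le> W t q" for t q
    unfolding W_def by (rule integral_nonneg_AE) simp
  have W_le: "W t q \<le> ln (t / t0) / Q1 p" if "t0 \<le> t" "0 < q" for t q
    using integral_clock_abs_le[OF t0 that(1) W_meas, of q 1] powr_bd[OF that(2)] by (simp add: W_def)
  \<comment> \<open>As a limit of nonnegative numbers the right-hand side lies in the range of
    \<open>phi\<close> up to \<open>lap Fh q\<close>; the intermediate value is the candidate for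
    the limit transform.\<close>
  have "\<exists>z. 0 \<le> z \<and> z \<le> lap Fh q \<and> phi z = phi (lap Fh q) - W t q" if t: "t0 \<le> t" and q: "0 < q" for t q
  proof -
    have "0 \<le> phi (lap Fh q) - W t q"
      by (rule LIMSEQ_le_const[OF phi_lim[OF t q]]) (use lap_Fn[OF t q] in \<open>auto intro!: phi_nonneg\<close>)
    then show ?thesis
      using phi_surj[of "phi (lap Fh q) - W t q" "lap Fh q"] W_nonneg[of t q] lap_Fh[OF q] by (metis diff_le_eq le_add_same_cancel1 less_imp_le)
  qed
  then obtain L where L: "\<And>t q. t0 \<le> t \<Longrightarrow> 0 < q \<Longrightarrow>
      0 \<le> L t q \<and> L t q \<le> lap Fh q \<and> phi (L t q) = phi (lap Fh q) - W t q"
    by metis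
  have L1: "L t q \<in> {0..<1}" if "t0 \<le> t" "0 < q" for t q
    using L[OF that] lap_Fh[OF that(2)] by simp
  have L_lim: "(\<lambda>n. lap (Fn (r n) t) q) \<longlonglongrightarrow> L t q" if t: "t0 \<le> t" and q: "0 < q" for t q
  proof (rule LIM_zero_cancel, rule Lim_null_comparison)
    show "\<forall>\<^sub>F n in sequentially. norm (lap (Fn (r n) t) q - L t q) \<le> \<bar>phi (lap (Fn (r n) t) q) - phi (L t q)\<bar>"
      using phi_abs_diff_ge[OF L1[OF t q] lap_Fn[OF t q]] by (simp add: always_eventually)
    show "(\<lambda>n. \<bar>phi (lap (Fn (r n) t) q) - phi (L t q)\<bar>) \<longlonglongrightarrow> 0"
      using phi_lim[OF t q] L[OF t q] by (intro tendsto_rabs_zero LIM_zero) simp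
  qed
  have L_to_1: "(L t \<longlongrightarrow> 1) (at_right 0)" if t: "t0 \<le> t" for t
  proof (rule tendsto_sandwich)
    \<comment> \<open>This is t / t0. It does not depend on \<open>q\<close> because the total clock
      time bounds \<open>W\<close> for all \<open>q\<close> at once.\<close>
    define K where "K = exp (Q1 p * (ln (t / t0) / Q1 p))"
    have "1 - (1 - lap Fh q) * K \<le> L t q \<and> L t q \<le> 1" if q: "0 < q" for q
    proof -
      have "1 - L t q \<le> (1 - lap Fh q) * exp (Q1 p * \<bar>phi (lap Fh q) - phi (L t q)\<bar>)"
        using lap_Fh[OF q] by (intro one_minus_le_of_phi L1 t q) auto
      also have "\<bar>phi (lap Fh q) - phi (L t q)\<bar> = W t q"
        using L[OF t q] W_nonneg[of t q] by simp
      also have "(1 - lap Fh q) * exp (Q1 p * W t q) \<le> (1 - lap Fh q) * K"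
        unfolding K_def using W_le[OF t q] Q1_pos lap_Fh[OF q]
        by (intro mult_left_mono) (simp_all add: field_simps)
      finally show ?thesis
        using L1[OF t q] by simp
    qed
    then show "\<forall>\<^sub>F q in at_right 0. 1 - (1 - lap Fh q) * K \<le> L t q" "\<forall>\<^sub>F q in at_right 0. L t q \<le> 1"
      using eventually_at_right_less[of "0 :: real"] by (auto elim: eventually_mono)
    have "((\<lambda>q. 1 - (1 - lap Fh q) * K) \<longlongrightarrow> 1 - (1 - 1) * K) (at_right 0)"
      by (intro tendsto_intros lap_tendsto_1 Fh)
    then show "((\<lambda>q. 1 - (1 - lap Fh q) * K) \<longlongrightarrow> 1) (at_right 0)" by simp
  qed auto
  have "\<exists>N. prob_Rplus N \<and> weak_conv_m (\<lambda>n. Fn (r n) t) N \<and> (\<forall>q>0. lap N q = L t q)" if t: "t0 \<le> t" for t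
    using lap_continuity[OF P[OF t] L_lim[OF t] L_to_1[OF t]] by blast
  then obtain F where F: "\<And>t. t0 \<le> t \<Longrightarrow> prob_Rplus (F t)"
      "\<And>t. t0 \<le> t \<Longrightarrow> weak_conv_m (\<lambda>n. Fn (r n) t) (F t)"
      "\<And>t q. t0 \<le> t \<Longrightarrow> 0 < q \<Longrightarrow> lap (F t) q = L t q"
    by metis
  have "F t0 = Fh"
    by (rule lap_unique[OF F(1) Fh(1)])
      (use F(3)[of t0] LIMSEQ_unique[OF init' L_lim[of t0]] in auto)
  \<comment> \<open>If the limit path were infinite at some time, it would be so at a later
    continuity point, and the transforms there would tend to 0; but the transform of a probability
    measure is positive.\<close>
  have G_neg: "G x < 0" for x
  proof (rule ccontr)
    assume "\<not> G x < 0"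
    obtain y where y: "max x t0 < y" "isCont G y"
      using cont_pt[of "max x t0" "max x t0 + 1"] by auto
    have "G y = 0"
      using monoD[OF G, of x y] G_le_0[of y] \<open>\<not> G x < 0\<close> y by simp
    then have "(\<lambda>n. - Gn (r n) y) \<longlonglongrightarrow> 0"
      using tendsto_minus[OF G_lim[OF y(2)]] by simp
    then have "(\<lambda>n. exp (- 1 * en (r n) y)) \<longlonglongrightarrow> 0"
      by (simp add: Gn_def)
    then have "L y 1 \<le> 0"
      using lap_en[of y 1] y by (intro LIMSEQ_le[OF L_lim]) auto
    then show False
      using lap_pos[OF F(1), of y 1] F(3)[of y 1] y by simp
  qed
  define ell where "ell x = - ln (- G x)" for x
  have ell_mono: "mono ell"
    unfolding ell_def using monoD[OF G] G_neg by (intro monoI) auto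
  have ell_rc: "(ell \<longlongrightarrow> ell x) (at_right x)" for x
    unfolding ell_def using G_rc[of x] G_neg[of x]
    by (intro tendsto_intros) (auto simp: continuous_within)
  have exp_ell: "exp (- q * ell u) = (- G u) powr q" for q u
    using G_neg[of u] by (simp add: ell_def powr_def)
  have sep: "phi (lap (F t0) q) - phi (lap (F t) q) = (LINT u|clock t0 t. exp (- q * ell u))"
    if t: "t0 \<le> t" and q: "0 < q" for t q
    unfolding exp_ell W_def[symmetric] using L[OF t q] F(3)[OF t q] \<open>F t0 = Fh\<close> by simp
  have exp_meas: "(\<lambda>u. exp (- q * ell u)) \<in> borel_measurable borel" for q
    using borel_measurable_mono[OF ell_mono] by measurable
  have sep2: "phi (lap (F s) q) - phi (lap (F t) q) = (LINT u|clock s t. exp (- q * ell u))"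
    if s: "t0 \<le> s" and t: "s \<le> t" and q: "0 < q" for s t q
  proof -
    have "(LINT u|clock t0 t. exp (- q * ell u)) = (LINT u|clock t0 s. exp (- q * ell u)) + (LINT u|clock s t. exp (- q * ell u))"
      by (rule integral_clock_combine[OF t0 s t exp_meas, where B=1]) (use powr_bd[OF q] in \<open>simp only: exp_ell\<close>)
    then show ?thesis
      using sep[OF s q] sep[of t q] s t q by simp
  qed
  \<comment> \<open>The decay bounds pass to the limit only at continuity points of
    \<open>G\<close>. Such points y exist just after t, and continuity of the transform in time
    transfers the bound back to t.\<close>
  have pmin_ge: "ell t \<le> pmin (F t)" if t: "t0 \<le> t" for t
  proof (rule le_pminI[OF F(1)[OF t], where C=1])
    fix q :: real assume "1 \<le> q"
    then have q: "0 < q" by simp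
    show "lap (F t) q \<le> 1 * exp (- q * ell t)"
    proof (rule field_le_epsilon)
      fix e :: real assume e: "0 < e"
      have tpos: "0 < t" using t t0 by simp
      obtain y where y: "t < y" "y < t + t * e" "isCont G y"
        using cont_pt[of t "t + t * e"] e tpos by auto
      have "(\<lambda>n. (- Gn (r n) y) powr q) \<longlonglongrightarrow> (- G y) powr q"
        using G_neg[of y] by (intro tendsto_powr tendsto_minus G_lim y tendsto_const) auto
      moreover have "lap (Fn (r n) y) q \<le> (- Gn (r n) y) powr q" for n
        using lap_en[of y q "r n"] y t q unfolding exp_powr by simp
      ultimately have "L y q \<le> exp (- q * ell y)"
        unfolding exp_ell using y t q by (intro LIMSEQ_le[OF L_lim]) auto
      also have "\<dots> \<le> exp (- q * ell t)"
        using monoD[OF ell_mono, of t y] y q by simp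
      finally have "lap (F y) q \<le> exp (- q * ell t)"
        using F(3)[of y q] y t q by simp
      moreover have "\<bar>lap (F t) q - lap (F y) q\<bar> \<le> \<bar>phi (lap (F t) q) - phi (lap (F y) q)\<bar>"
        using F(3)[of t q] F(3)[of y q] y t q by (intro phi_abs_diff_ge) (auto simp: L1 simp del: atLeastLessThan_iff)
      moreover have "\<bar>phi (lap (F t) q) - phi (lap (F y) q)\<bar> \<le> 1 * (ln (y / t) / Q1 p)"
        unfolding sep2[OF t less_imp_le[OF y(1)] q] using powr_bd[OF q]
        by (intro integral_clock_abs_le[OF tpos less_imp_le[OF y(1)] exp_meas]) (simp only: exp_ell)
      moreover have "ln (y / t) / Q1 p \<le> (y - t) / t"
        using clock_total_le[OF tpos] y by simp
      moreover have "(y - t) / t \<le> e"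
        using y tpos by (simp add: field_simps)
      ultimately show "lap (F t) q \<le> 1 * exp (- q * ell t) + e" by linarith
    qed
  qed
  \<comment> \<open>Weak convergence alone does not give this, since mass near the min can fade
    away. By right continuity the path stays below x for a positive clock time after t. The
    separated equation bounds this time, multiplied by exp (- q x), by phi of the transform at t,
    which decays like exp (- q pmin): a contradiction for large q if the min exceeds x.\<close>
  have pmin_le: "pmin (F t) \<le> ell t" if t: "t0 \<le> t" for t
  proof (rule ccontr)
    assume "\<not> pmin (F t) \<le> ell t"
    then obtain x where x: "ell t < x" "x < pmin (F t)"
      using dense by (auto simp: not_le)
    have "\<forall>\<^sub>F y in at_right t. ell y < x"
      using order_tendstoD(2)[OF ell_rc x(1)] .
    then have "\<forall>\<^sub>F y in at_right t. ell y < x \<and> t < y"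
      using eventually_at_right_less[of t] by (rule eventually_conj)
    then obtain y where y: "ell y < x" "t < y"
      using eventually_happens'[OF trivial_limit_at_right_real] by blast
    have tpos: "0 < t" using t t0 by simp
    \<comment> \<open>For q at least 1 the transform is at most \<open>lap Fh 1\<close>, which keeps
      the denominator in \<open>phi_le\<close> away from 0 uniformly in q.\<close>
    define C where "C = 1 / (1 - lap Fh 1)"
    have "ln (y / t) / Q1 p \<le> C * exp (- q * (pmin (F t) - x))" if "1 \<le> q" for q
    proof -
      have q: "0 < q" using that by simp
      have Fh1: "lap Fh q \<le> lap Fh 1"
        unfolding lap_def
      proof (rule integral_mono_AE[OF lap_integrable[OF Fh(1)] lap_integrable[OF Fh(1)]])
        show "AE x in Fh. exp (- q * x) \<le> exp (- 1 * x)"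
          using prob_RplusD(5)[OF Fh(1)]
        proof eventually_elim
          case (elim x)
          then show ?case using mult_right_mono[OF that, of x] by simp
        qed
      qed (use q in auto)
      have "exp (- q * x) * (ln (y / t) / Q1 p) = (LINT u|clock t y. exp (- q * x))"
        by (rule integral_clock_const[symmetric]) (use tpos y in auto)
      also have "\<dots> \<le> (LINT u|clock t y. exp (- q * ell u))"
      proof (rule integral_clock_mono[OF tpos less_imp_le[OF y(2)] _ exp_meas])
        fix u assume u: "u \<in> {t..y}"
        then have "ell u \<le> x"
          using monoD[OF ell_mono, of u y] y by simp
        then show "exp (- q * x) \<le> exp (- q * ell u)"
          using q by simp
        show "\<bar>exp (- q * ell u)\<bar> \<le> 1"
          using powr_bd[OF q] by (simp only: exp_ell)
        show "\<bar>exp (- q * x)\<bar> \<le> exp (- q * x)" by simp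
      qed simp
      also have "\<dots> = phi (lap (F t) q) - phi (lap (F y) q)"
        using sep2[OF t less_imp_le[OF y(2)] q] by simp
      also have "\<dots> \<le> phi (lap (F t) q)"
        using F(3)[of y q] L1[of y q] y t q by (simp add: phi_nonneg)
      also have "\<dots> \<le> lap (F t) q / (1 - lap (F t) q)"
        using F(3)[of t q] L1[of t q] t q by (intro phi_le) auto
      also have "\<dots> \<le> lap (F t) q / (1 - lap Fh 1)"
        using F(3)[of t q] L1[of t q] L[of t q] Fh1 lap_Fh[of 1] t q by (intro divide_left_mono mult_pos_pos) auto
      also have "\<dots> = C * lap (F t) q"
        by (simp add: C_def)
      also have "\<dots> \<le> C * exp (- q * pmin (F t))"
        using lap_Fh[of 1] q by (intro mult_left_mono lap_le_pmin[OF F(1)[OF t]]) (auto simp: C_def)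
      finally have "exp (- q * x) * (ln (y / t) / Q1 p) \<le> C * exp (- q * pmin (F t))" .
      also have "\<dots> = exp (- q * x) * (C * exp (- q * (pmin (F t) - x)))"
        by (simp add: exp_add[symmetric] algebra_simps)
      finally show ?thesis by (rule mult_left_le_imp_le) simp
    qed
    moreover have "0 < pmin (F t) - x"
      using x(2) by linarith
    ultimately have "ln (y / t) / Q1 p \<le> 0"
      by (rule le_0_if_le_exp)
    moreover have "0 < ln (y / t) / Q1 p"
      using y tpos Q1_pos by simp
    ultimately show False by simp
  qed
  have pmin_eq: "pmin (F t) = ell t" if "t0 \<le> t" for t
    using pmin_ge[OF that] pmin_le[OF that] by simp
  have "weak_solution p {t0..} F"
  proof (rule separated_imp_weak_solution[OF t0 F(1) ell_mono _ pmin_eq sep])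
    show "0 < ell t0"
      using pmin_eq[of t0] \<open>F t0 = Fh\<close> Fh(2) by simp
  qed
  from that[OF r this \<open>F t0 = Fh\<close> F(2)] show ?thesis .
qed

end

end

section \<open>Continuous dependence and growth of the min\<close>

context min_clustering
begin

lemma weak_solution_subset:
  assumes "weak_solution p J F" "I \<subseteq> J"
  shows "weak_solution p I F"
proof -
  have "(\<lambda>t. LINT y|F t. a y) \<in> borel_measurable (restrict_space borel I)" if "a \<in> C0" for a
  proof -
    have "(\<lambda>t. LINT y|F t. a y) \<in> borel_measurable (restrict_space borel J)"
      using assms(1) that by (simp add: weak_solution_def)
    then show ?thesis
      by (rule measurable_restrict_mono) (rule assms(2))
  qed
  moreover have "mono_on I (\<lambda>t. pmin (F t))"
    using assms by (intro mono_on_subset[OF _ assms(2)]) (simp add: weak_solution_def)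
  ultimately show ?thesis
    using assms unfolding weak_solution_def by (meson subsetD)
qed

context
  fixes F :: "real \<Rightarrow> real measure" and t0 :: real
  assumes F: "weak_solution p {t0..} F" and t0: "0 < t0"
begin

lemma weak_solution_Icc: "weak_solution p {t0..b} F"
  by (rule weak_solution_subset[OF F]) auto

definition min_path :: "real \<Rightarrow> real" where
  "min_path u = pmin (F (max t0 u))"

lemma mono_min_path: "mono min_path"
  using F by (auto simp: min_path_def weak_solution_def mono_on_def intro!: monoI)

lemma min_path_pos: "0 < min_path u"
  using F by (auto simp: min_path_def weak_solution_def)

lemma min_path_right_continuous: "continuous (at_right s) min_path"
  unfolding continuous_within
proof -
  define b where "b = max t0 s + 1"
  have b: "t0 \<le> b" "s < b" by (auto simp: b_def)
  have eq: "ell_of F t0 b u = min_path u" if "u \<le> b" for u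
    using that b by (simp add: ell_of_def[OF weak_solution_Icc t0] min_path_def min_absorb2)
  have "(ell_of F t0 b \<longlongrightarrow> ell_of F t0 b s) (at_right s)"
    using ell_of_right_continuous[OF weak_solution_Icc t0 b(1)] by (simp add: continuous_within)
  moreover have "\<forall>\<^sub>F u in at_right s. ell_of F t0 b u = min_path u"
    using eventually_at_right_real[OF b(2)] by eventually_elim (simp add: eq)
  ultimately show "(min_path \<longlongrightarrow> min_path s) (at_right s)"
    unfolding eq[OF less_imp_le[OF b(2)], symmetric] by (rule Lim_transform_eventually)
qed

lemma min_path_separated:
  assumes "t0 \<le> t" "0 < q"
  shows "phi (lap (F t0) q) - phi (lap (F t) q) = (LINT u|clock t0 t. exp (- q * min_path u))"
  by (rule weak_solution_imp_separated[OF weak_solution_Icc t0 mono_min_path])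
    (use assms in \<open>auto simp: min_path_def max_absorb2\<close>)

lemma weak_solution_prob_at: "t0 \<le> t \<Longrightarrow> prob_Rplus (F t)"
  and weak_solution_pmin_pos_at: "t0 \<le> t \<Longrightarrow> 0 < pmin (F t)"
  and weak_solution_pmin_mono_at: "t0 \<le> s \<Longrightarrow> s \<le> t \<Longrightarrow> pmin (F s) \<le> pmin (F t)"
  using F by (auto simp: weak_solution_def mono_on_def)

end

text \<open>Compactness combined with uniqueness: a subsequence staying away from the limit would
  have a further subsequence converging to a weak solution with the initial measure of
  \<open>F\<close>, that is, to \<open>F\<close> itself.\<close>

lemma weak_solution_stable:
  assumes t0: "0 < t0" and Fn: "\<And>n. weak_solution p {t0..} (Fn n)" and F: "weak_solution p {t0..} F"
    and conv: "weak_conv_m (\<lambda>n. Fn n t0) (F t0)" and t: "t0 \<le> t"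
  shows "weak_conv_m (\<lambda>n. Fn n t) (F t)"
proof (rule lap_conv_imp_weak_conv)
  show P: "prob_Rplus (Fn n t)" "prob_Rplus (F t)" for n
    using weak_solution_prob_at[OF Fn t0 t] weak_solution_prob_at[OF F t0 t] by auto
  fix q :: real assume q: "0 < q"
  show "(\<lambda>n. lap (Fn n t) q) \<longlonglongrightarrow> lap (F t) q"
  proof (rule ccontr)
    assume "\<not> ?thesis"
    then obtain e where e: "0 < e" "\<not> (\<forall>\<^sub>F n in sequentially. dist (lap (Fn n t) q) (lap (F t) q) < e)"
      by (auto simp: tendsto_iff)
    then obtain s where s: "strict_mono (s :: nat \<Rightarrow> nat)" "\<And>n. e \<le> dist (lap (Fn (s n) t) q) (lap (F t) q)"
      using not_eventually_sequentiallyD[OF e(2)] by (auto simp: not_less)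
    define en where "en n = min_path (Fn (s n)) t0" for n
    obtain r G where r: "strict_mono (r :: nat \<Rightarrow> nat)" and G: "weak_solution p {t0..} G" "G t0 = F t0"
      and G_conv: "\<And>t. t0 \<le> t \<Longrightarrow> weak_conv_m (\<lambda>n. Fn (s (r n)) t) (G t)"
    proof (rule limit_weak_solution[of t0 "\<lambda>n. Fn (s n)" en "F t0"])
      show "0 < t0" by fact
      show "prob_Rplus (Fn (s n) t)" if "t0 \<le> t" for n t
        by (rule weak_solution_prob_at[OF Fn t0 that])
      show "mono (en n)" "continuous (at_right x) (en n)" "0 < en n x" for n x
        unfolding en_def by (rule mono_min_path[OF Fn t0] min_path_right_continuous[OF Fn t0] min_path_pos[OF Fn t0])+
      show "lap (Fn (s n) t) q \<le> exp (- q * en n t)" if "t0 \<le> t" "0 < q" for n t q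
        using lap_le_pmin[OF weak_solution_prob_at[OF Fn t0 that(1)], of q "s n"] that
        by (simp add: en_def min_path_def[OF Fn t0] max_absorb2)
      show "prob_Rplus (F t0)" "0 < pmin (F t0)"
        by (rule weak_solution_prob_at[OF F t0] weak_solution_pmin_pos_at[OF F t0], simp)+
      show "(\<lambda>n. lap (Fn (s n) t0) q) \<longlonglongrightarrow> lap (F t0) q" if "0 < q" for q
        using LIMSEQ_subseq_LIMSEQ[OF weak_conv_lap[OF weak_solution_prob_at[OF Fn t0 order_refl]
              weak_solution_prob_at[OF F t0 order_refl] conv less_imp_le[OF that]] s(1)]
        by (simp add: o_def)
      show "(\<lambda>n. phi (lap (Fn (s n) t) q) - phi (lap (Fn (s n) t0) q) + (LINT u|clock t0 t. exp (- q * en n u))) \<longlonglongrightarrow> 0"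
        if "t0 \<le> t" "0 < q" for t q
        unfolding en_def min_path_separated[OF Fn t0 that, symmetric] by simp
    qed blast
    have "G t = F t"
      by (rule weak_solution_unique[OF weak_solution_Icc[OF G(1) t0] weak_solution_Icc[OF F t0] t0 G(2)]) (use t in auto)
    then have "(\<lambda>n. lap (Fn (s (r n)) t) q) \<longlonglongrightarrow> lap (F t) q"
      using weak_conv_lap[OF _ P(2), of "\<lambda>n. Fn (s (r n)) t" q] G_conv[OF t] P(1) q by simp
    then have "\<forall>\<^sub>F n in sequentially. dist (lap (Fn (s (r n)) t) q) (lap (F t) q) < e"
      using e(1) by (rule tendstoD)
    then obtain n where "dist (lap (Fn (s (r n)) t) q) (lap (F t) q) < e"
      using eventually_happens'[OF sequentially_bot] by blast
    with s(2)[of "r n"] show False by simp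
  qed
qed

text \<open>As long as the min stays below a point \<open>x\<close> less than twice its initial value, merging only
  removes mass from \<open>[0, x]\<close>, at unit rate with respect to the clock.\<close>
lemma merge_cts_step:
  assumes M: "prob_Rplus M" and x: "pmin M \<le> x" "x < c" "c \<le> 2 * pmin M"
  shows "merge M (cts_step x c) = - 1"
proof -
  interpret real_distribution M by (rule prob_RplusD[OF M])
  have one: "cts_step x c (pmin M) = 1"
    using x by (simp add: cts_step_def)
  have m0: "0 \<le> pmin M" by (rule pmin_nonneg[OF M])
  have "merge_term M (cts_step x c) k = - 1" for k
  proof -
    let ?P = "PiM {..<Suc k} (\<lambda>_. M)"
    interpret PP: prob_space "?P"
      by (rule prob_space_PiM) (rule prob_RplusD(2)[OF M])
    have "AE y in ?P. pmin M \<le> y i" if "i < Suc k" for i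
      by (rule AE_PiM_component) (use that pmin_AE[OF M] prob_RplusD(2)[OF M] in auto)
    then have "AE y in ?P. \<forall>i\<in>{..<Suc k}. pmin M \<le> y i"
      by (intro AE_finite_allI) auto
    then have "AE y in ?P.
        cts_step x c (pmin M + (\<Sum>i<Suc k. y i)) - cts_step x c (pmin M) = - 1"
    proof eventually_elim
      case (elim y)
      \<comment> \<open>A single summand, being at least the min, already carries the merged point
        to twice the min, where the step function is 0.\<close>
      have "pmin M \<le> y 0" using elim by simp
      also have "y 0 \<le> (\<Sum>i<Suc k. y i)"
        using elim m0 by (intro member_le_sum) (auto intro: order_trans)
      finally have "c \<le> pmin M + (\<Sum>i<Suc k. y i)"
        using x by simp
      then show ?case
        using x one by (simp add: cts_step_def del: sum.lessThan_Suc)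
    qed
    moreover have "integrable ?P
        (\<lambda>y. cts_step x c (pmin M + (\<Sum>i<Suc k. y i)) - cts_step x c (pmin M))"
      by (rule merge_integrand(1)[OF M, where B=1])
        (use x in \<open>auto simp: cts_step_def intro!: borel_measurable_continuous_onI
          uniformly_continuous_imp_continuous cts_step_uniformly_continuous\<close>)
    ultimately have "merge_term M (cts_step x c) k = (LINT y|?P. - 1)"
      unfolding merge_term_def by (intro integral_cong_AE) auto
    then show ?thesis
      using PP.prob_space by simp
  qed
  then show ?thesis
    using p_sum by (simp add: merge_def sums_iff suminf_minus p_summable)
qed

text \<open>The factor exp (Q1 p) in time is one unit of the clock. If the min stayed below some x <
  2 * pmin (F s), the integral of a step function from x to that bound would fall at unit rate for a
  unit of time, from at most 1 to at most 0, although \<open>F t\<close> still charges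
  \<open>{0..x}\<close>.\<close>

lemma weak_solution_pmin_doubling:
  assumes F: "weak_solution p {t0..} F" and t0: "0 < t0" and s: "t0 \<le> s"
  shows "2 * pmin (F s) \<le> pmin (F (s * exp (Q1 p)))"
proof (rule ccontr)
  define t where "t = s * exp (Q1 p)"
  define c where "c = 2 * pmin (F s)"
  have s0: "0 < s" using s t0 by simp
  have st: "s \<le> t" and t: "t0 \<le> t"
    using s s0 Q1_pos by (auto simp: t_def intro: order_trans[of t0 s])
  assume "\<not> ?thesis"
  then obtain x where x: "pmin (F t) < x" "x < c"
    using dense[of "pmin (F t)" c] by (auto simp: not_le t_def c_def)
  let ?a = "cts_step x c"
  have cont: "continuous_on UNIV ?a"
    by (rule uniformly_continuous_imp_continuous[OF cts_step_uniformly_continuous[OF x(2)]])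
  have "\<forall>\<^sub>F y in at_top. ?a y = 0"
    using eventually_ge_at_top[of c] by eventually_elim (use x in \<open>simp add: cts_step_def\<close>)
  then have a: "?a \<in> C0"
    using cont by (simp add: C0_def tendsto_eventually)
  have a_bd: "0 \<le> ?a y" "?a y \<le> 1" for y
    using x by (auto simp: cts_step_def)
  have mg: "clust_rhs p F ?a u = (- 1) / (Q1 p * u)" if u: "u \<in> {s..t}" for u
  proof -
    have "pmin (F s) \<le> pmin (F u)" "pmin (F u) \<le> pmin (F t)"
      using weak_solution_pmin_mono_at[OF F t0] u s by auto
    then show ?thesis
      unfolding clust_rhs_eq using x u s
      by (subst merge_cts_step[OF weak_solution_prob_at[OF F t0]]) (auto simp: c_def)
  qed
  have "(LINT y|F t. ?a y) - (LINT y|F s. ?a y) = (LBINT u=s..t. clust_rhs p F ?a u)"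
    using F a s t unfolding weak_solution_def by auto
  also have "\<dots> = (LINT u|clock s t. - 1)"
    by (rule integral_clock[OF s0 st]) (use mg in auto)
  also have "\<dots> = - 1"
    unfolding integral_clock_const[OF s0 st] using s0 Q1_pos by (simp add: t_def)
  finally have eq: "(LINT y|F t. ?a y) - (LINT y|F s. ?a y) = - 1" .
  interpret S: real_distribution "F s"
    by (rule prob_RplusD[OF weak_solution_prob_at[OF F t0 s]])
  interpret T: real_distribution "F t"
    by (rule prob_RplusD[OF weak_solution_prob_at[OF F t0 t]])
  have [measurable]: "?a \<in> borel_measurable borel"
    by (rule borel_measurable_continuous_onI[OF cont])
  have "(LINT y|F s. ?a y) \<le> (LINT y|F s. 1)"
    by (rule integral_mono[OF S.integrable_const_bound[where B=1]]) (use a_bd in auto)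
  also have "\<dots> = 1"
    by (simp add: S.prob_space[unfolded S.space_eq_univ])
  finally have "(LINT y|F s. ?a y) \<le> 1" .
  moreover have "measure (F t) {0..x} \<le> (LINT y|F t. ?a y)"
  proof -
    have "measure (F t) {0..x} = (LINT y|F t. indicator {0..x} y)"
      by simp
    also have "\<dots> \<le> (LINT y|F t. ?a y)"
      by (rule integral_mono[OF T.integrable_indicator_borel T.integrable_const_bound[where B=1]])
        (use a_bd in \<open>auto simp: indicator_def cts_step_def\<close>)
    finally show ?thesis .
  qed
  moreover have "0 < measure (F t) {0..x}"
    by (rule measure_pmin_pos[OF weak_solution_prob_at[OF F t0 t] x(1)])
  ultimately show False
    using eq by simp
qed

text \<open>Doubling is iterated over the integer part of the elapsed clock time ln (t / t0) / Q1;
  the incomplete last unit costs the factor 1/2.\<close>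

lemma weak_solution_pmin_growth:
  assumes F: "weak_solution p {t0..} F" and t0: "0 < t0" and t: "t0 \<le> t"
  shows "(1 / 2) * (t / t0) powr (ln 2 / Q1 p) \<le> pmin (F t) / pmin (F t0)"
proof -
  define x where "x = ln (t / t0) / Q1 p"
  define n where "n = nat \<lfloor>x\<rfloor>"
  have x: "0 \<le> x"
    unfolding x_def using t t0 Q1_pos by (intro divide_nonneg_pos ln_ge_zero) (auto simp: field_simps)
  then have n: "real n \<le> x" "x < real n + 1"
    by (auto simp: n_def)
  have step: "2 ^ k * pmin (F t0) \<le> pmin (F (t0 * exp (Q1 p) ^ k))" for k
  proof (induction k)
    case (Suc k)
    have "t0 * 1 \<le> t0 * exp (Q1 p) ^ k"
      using t0 Q1_pos by (intro mult_left_mono one_le_power) auto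
    then have "2 * pmin (F (t0 * exp (Q1 p) ^ k)) \<le> pmin (F (t0 * exp (Q1 p) ^ k * exp (Q1 p)))"
      by (intro weak_solution_pmin_doubling[OF F t0]) simp
    with Suc show ?case by (simp add: mult.commute mult.left_commute)
  qed simp
  have le: "t0 * exp (Q1 p) ^ n \<le> t"
  proof -
    have "exp (Q1 p) ^ n = exp (real n * Q1 p)"
      by (rule exp_of_nat_mult[symmetric])
    also have "\<dots> \<le> exp (x * Q1 p)"
      using n(1) Q1_pos by simp
    also have "\<dots> = t / t0"
      using t t0 Q1_pos by (simp add: x_def)
    finally show ?thesis
      using t0 by (simp add: field_simps)
  qed
  have ge: "t0 \<le> t0 * exp (Q1 p) ^ n"
    using t0 Q1_pos one_le_power[of "exp (Q1 p)" n] by simp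
  have pos: "0 < pmin (F t0)"
    by (rule weak_solution_pmin_pos_at[OF F t0]) simp
  have "(t / t0) powr (ln 2 / Q1 p) = 2 powr x"
    using t t0 by (simp add: x_def powr_def)
  also have "\<dots> \<le> 2 powr (real n + 1)"
    using n by (intro powr_mono) auto
  also have "\<dots> = 2 * 2 ^ n"
    by (simp add: powr_add powr_realpow)
  finally have "(1 / 2) * (t / t0) powr (ln 2 / Q1 p) \<le> 2 ^ n" by simp
  also have "\<dots> \<le> pmin (F t) / pmin (F t0)"
    using step[of n] weak_solution_pmin_mono_at[OF F t0 ge le] pos by (simp add: field_simps)
  finally show ?thesis .
qed

end

section \<open>Existence by an Euler scheme\<close>

lemma pmf_integrable_bounded:
  fixes f :: "'a \<Rightarrow> real"
  assumes "\<And>x. \<bar>f x\<bar> \<le> B"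
  shows "integrable (measure_pmf M) f"
  by (rule measure_pmf.integrable_const_bound[where B=B]) (use assms in auto)

lemma expectation_bind_pmf:
  fixes h :: "'b \<Rightarrow> real"
  assumes h: "\<And>x. 0 \<le> h x" "\<And>x. h x \<le> B"
  shows "measure_pmf.expectation (bind_pmf M N) h = measure_pmf.expectation M (\<lambda>x. measure_pmf.expectation (N x) h)"
proof -
  have abs: "\<bar>h x\<bar> \<le> B" for x using h[of x] by simp
  have eh: "0 \<le> measure_pmf.expectation K h" "measure_pmf.expectation K h \<le> B" for K
  proof -
    show "0 \<le> measure_pmf.expectation K h"
      by (rule integral_nonneg_AE) (use h in auto)
    have "measure_pmf.expectation K h \<le> measure_pmf.expectation K (\<lambda>_. B)"
      by (rule integral_mono[OF pmf_integrable_bounded[OF abs]]) (use h in auto)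
    then show "measure_pmf.expectation K h \<le> B" by simp
  qed
  have nn: "(\<integral>\<^sup>+x. ennreal (h x) \<partial>measure_pmf K) = ennreal (measure_pmf.expectation K h)" for K
    by (rule nn_integral_eq_integral[OF pmf_integrable_bounded[OF abs]]) (use h in auto)
  have "ennreal (measure_pmf.expectation (bind_pmf M N) h) = (\<integral>\<^sup>+x. ennreal (measure_pmf.expectation (N x) h) \<partial>measure_pmf M)"
    by (simp add: nn[symmetric])
  also have "\<dots> = ennreal (measure_pmf.expectation M (\<lambda>x. measure_pmf.expectation (N x) h))"
    by (rule nn_integral_eq_integral[OF pmf_integrable_bounded[where B=B]]) (use eh in auto)
  finally show ?thesis
    using eh(1) by (subst (asm) ennreal_inj) (auto intro!: integral_nonneg_AE)
qed

section \<open>Generating functions of lattice distributions\<close>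

definition pgf :: "nat pmf \<Rightarrow> real \<Rightarrow> real" where
  "pgf f x = measure_pmf.expectation f (\<lambda>k. x ^ k)"

lemma pgf_bounds:
  assumes "0 \<le> x" "x \<le> 1"
  shows "0 \<le> pgf f x" "pgf f x \<le> 1"
proof -
  show "0 \<le> pgf f x"
    unfolding pgf_def by (rule integral_nonneg_AE) (use assms in auto)
  have "pgf f x \<le> measure_pmf.expectation f (\<lambda>_. 1)"
    unfolding pgf_def using assms
    by (intro integral_mono pmf_integrable_bounded[where B=1]) (auto simp: power_le_one)
  then show "pgf f x \<le> 1" by simp
qed

lemma pgf_bind:
  assumes "0 \<le> x" "x \<le> 1"
  shows "pgf (bind_pmf M N) x = measure_pmf.expectation M (\<lambda>y. pgf (N y) x)"
  unfolding pgf_def by (rule expectation_bind_pmf[where B=1]) (use assms in \<open>auto simp: power_le_one\<close>)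

lemma pgf_shift: "pgf (map_pmf ((+) a) f) x = x ^ a * pgf f x"
  by (simp add: pgf_def power_add)

lemma pgf_return [simp]: "pgf (return_pmf k) x = x ^ k"
  by (simp add: pgf_def)

primrec iid_sum :: "nat pmf \<Rightarrow> nat \<Rightarrow> nat pmf" where
  "iid_sum f 0 = return_pmf 0"
| "iid_sum f (Suc k) = bind_pmf f (\<lambda>a. map_pmf ((+) a) (iid_sum f k))"

lemma pgf_iid_sum:
  assumes "0 \<le> x" "x \<le> 1"
  shows "pgf (iid_sum f k) x = pgf f x ^ k"
proof (induction k)
  case (Suc k)
  have "pgf (iid_sum f (Suc k)) x = measure_pmf.expectation f (\<lambda>a. x ^ a * pgf f x ^ k)"
    by (simp add: pgf_bind[OF assms] pgf_shift Suc)
  also have "\<dots> = pgf f x ^ Suc k"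
    by (simp add: pgf_def)
  finally show ?case .
qed simp

lemma iid_sum_ge: "(\<And>a. a \<in> set_pmf f \<Longrightarrow> 1 \<le> a) \<Longrightarrow> s \<in> set_pmf (iid_sum f (Suc k)) \<Longrightarrow> 1 \<le> s"
  by (auto simp: Suc_le_eq)

definition min_pmf :: "nat pmf \<Rightarrow> nat" where
  "min_pmf f = (LEAST k. k \<in> set_pmf f)"

lemma min_pmf_in: "min_pmf f \<in> set_pmf f"
  unfolding min_pmf_def using set_pmf_not_empty[of f] by (auto intro: LeastI)

lemma min_pmf_le: "k \<in> set_pmf f \<Longrightarrow> min_pmf f \<le> k"
  unfolding min_pmf_def by (rule Least_le)

lemma pgf_le_min:
  assumes "0 \<le> x" "x \<le> 1"
  shows "pgf f x \<le> x ^ min_pmf f"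
proof -
  have "pgf f x \<le> measure_pmf.expectation f (\<lambda>_. x ^ min_pmf f)"
    unfolding pgf_def using assms
    by (intro integral_mono_AE pmf_integrable_bounded[where B=1])
      (auto simp: power_le_one AE_measure_pmf_iff intro!: power_decreasing min_pmf_le)
  then show ?thesis by simp
qed

context min_clustering
begin

text \<open>Shifted by one: the value k stands for k + 1 summands, which is why
  \<open>merged\<close> takes \<open>Suc k\<close> of them.\<close>

definition offspring :: "nat pmf" where
  "offspring = embed_pmf (\<lambda>k. p (Suc k))"

lemma pmf_offspring: "pmf offspring k = p (Suc k)"
  unfolding offspring_def
proof (rule pmf_embed_pmf)
  show "0 \<le> p (Suc k)" for k by (rule p_nonneg)
  have "(\<integral>\<^sup>+k. ennreal (p (Suc k)) \<partial>count_space UNIV) = (\<Sum>k. ennreal (p (Suc k)))"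
    by (rule nn_integral_count_space_nat)
  also have "\<dots> = ennreal (\<Sum>k. p (Suc k))"
    by (rule suminf_ennreal2[OF p_nonneg p_summable])
  finally show "(\<integral>\<^sup>+k. ennreal (p (Suc k)) \<partial>count_space UNIV) = 1"
    using p_sum by (simp add: sums_iff)
qed

lemma expectation_offspring:
  assumes "0 \<le> z" "z \<le> 1"
  shows "measure_pmf.expectation offspring (\<lambda>k. z ^ Suc k) = gen z"
proof -
  have "measure_pmf.expectation offspring (\<lambda>k. z ^ Suc k) =
      (LINT k|count_space UNIV. pmf offspring k *\<^sub>R z ^ Suc k)"
    unfolding measure_pmf_eq_density by (rule integral_density) auto
  also have "\<dots> = gen z"
    unfolding gen_def pmf_offspring real_scaleR_def
  proof (rule integral_count_space_nat)
    have "summable (\<lambda>k. norm (p (Suc k) * z ^ Suc k))"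
      using gen_summable[OF assms] p_nonneg assms by (simp add: abs_mult)
    then show "integrable (count_space UNIV) (\<lambda>k. p (Suc k) * z ^ Suc k)"
      by (simp add: integrable_count_space_nat_iff)
  qed
  finally show ?thesis .
qed

definition merged :: "nat pmf \<Rightarrow> nat pmf" where
  "merged f = bind_pmf offspring (\<lambda>k. iid_sum f (Suc k))"

lemma pgf_merged:
  assumes "0 \<le> x" "x \<le> 1"
  shows "pgf (merged f) x = gen (pgf f x)"
  unfolding merged_def pgf_bind[OF assms] pgf_iid_sum[OF assms]
  by (rule expectation_offspring) (use pgf_bounds[OF assms] in auto)

lemma merged_ge:
  assumes "\<And>a. a \<in> set_pmf f \<Longrightarrow> 1 \<le> a" "s \<in> set_pmf (merged f)"
  shows "1 \<le> s"
  using assms(2) iid_sum_ge[OF assms(1)] unfolding merged_def set_bind_pmf by blast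

context
  fixes eps :: real
  assumes eps: "0 < eps"
begin

definition moved :: "nat pmf \<Rightarrow> real" where
  "moved f = min eps (pmf f (min_pmf f))"

text \<open>Capping the moved mass by the smallest atom keeps the scheme positive. The clock advances by
  \<open>eps\<close> nevertheless.\<close>
definition euler :: "nat pmf \<Rightarrow> nat pmf" where
  "euler f = bind_pmf f (\<lambda>k. if k = min_pmf f
     then bind_pmf (bernoulli_pmf (moved f / pmf f (min_pmf f)))
       (\<lambda>b. if b then map_pmf ((+) (min_pmf f)) (merged f) else return_pmf (min_pmf f))
     else return_pmf k)"

lemma pmf_min_pos: "0 < pmf f (min_pmf f)"
  using min_pmf_in[of f] by (simp add: pmf_positive_iff)

lemma moved_bounds: "0 < moved f" "moved f \<le> eps" "moved f \<le> pmf f (min_pmf f)"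
  using eps pmf_min_pos[of f] by (auto simp: moved_def)

lemma moved_ratio: "0 \<le> moved f / pmf f (min_pmf f)" "moved f / pmf f (min_pmf f) \<le> 1"
  using moved_bounds[of f] pmf_min_pos[of f] by auto

text \<open>At x = exp (- q h) this is an explicit Euler step of size \<open>moved f\<close> for the
  equation of the Laplace transform. The Bernoulli variable makes the fraction of the smallest atom
  that is moved exactly \<open>moved f\<close>.\<close>

lemma pgf_euler:
  assumes x: "0 \<le> x" "x \<le> 1"
  shows "pgf (euler f) x = pgf f x - moved f * x ^ min_pmf f * (1 - gen (pgf f x))"
proof -
  define j where "j = min_pmf f"
  define r where "r = moved f / pmf f j"
  define H where "H = x ^ j * gen (pgf f x) * r + x ^ j * (1 - r)"
  have r: "0 \<le> r" "r \<le> 1" using moved_ratio[of f] by (auto simp: r_def j_def)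
  define B where "B = bind_pmf (bernoulli_pmf r) (\<lambda>b. if b then map_pmf ((+) j) (merged f) else return_pmf j)"
  have B: "pgf B x = H"
    unfolding B_def pgf_bind[OF x] by (simp add: r pgf_shift pgf_merged[OF x] H_def)
  have "pgf (euler f) x = measure_pmf.expectation f (\<lambda>k. pgf (if k = j then B else return_pmf k) x)"
    unfolding euler_def pgf_bind[OF x] B_def j_def r_def ..
  also have "(\<lambda>k. pgf (if k = j then B else return_pmf k) x) = (\<lambda>k. if k = j then H else x ^ k)"
    by (auto simp: B fun_eq_iff)
  also have "measure_pmf.expectation f \<dots> = measure_pmf.expectation f (\<lambda>k. x ^ k + indicator {j} k * (H - x ^ j))"
    by (intro Bochner_Integration.integral_cong) (auto simp: indicator_def)
  also have "\<dots> = pgf f x + pmf f j * (H - x ^ j)"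
    unfolding pgf_def using x
    by (subst Bochner_Integration.integral_add)
      (auto simp: power_le_one measure_pmf_single intro!: pmf_integrable_bounded[where B=1] integrable_mult_left)
  also have "pmf f j * (H - x ^ j) = - (moved f * x ^ j * (1 - gen (pgf f x)))"
    using pmf_min_pos[of f] by (simp add: H_def r_def j_def field_simps)
  finally show ?thesis by (simp add: j_def)
qed

lemma set_euler:
  assumes "k \<in> set_pmf (euler f)"
  shows "k \<in> set_pmf f \<and> k \<noteq> min_pmf f \<or> (\<exists>s\<in>set_pmf (merged f). k = min_pmf f + s)
    \<or> k = min_pmf f \<and> moved f = eps"
proof -
  \<comment> \<open>An atom smaller than \<open>eps\<close> is emptied completely: the Bernoulli
    parameter is then 1.\<close>
  have "False \<notin> set_pmf (bernoulli_pmf (moved f / pmf f (min_pmf f)))" if "moved f \<noteq> eps"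
  proof -
    have "moved f = pmf f (min_pmf f)"
      using that by (auto simp: moved_def min_def split: if_splits)
    then show ?thesis
      using pmf_min_pos[of f] by (simp add: set_pmf_iff)
  qed
  with assms show ?thesis
    unfolding euler_def by (auto split: if_splits)
qed

lemma euler_ge_1:
  assumes f: "\<And>a. a \<in> set_pmf f \<Longrightarrow> 1 \<le> a" and k: "k \<in> set_pmf (euler f)"
  shows "1 \<le> k"
  using set_euler[OF k] f merged_ge[OF f] min_pmf_in[of f] by fastforce

text \<open>Merging adds at least 1 to the min, so nothing returns to a site once it is emptied, and
  a step that moves less than \<open>eps\<close> raises the min strictly.\<close>

lemma min_euler:
  assumes f: "\<And>a. a \<in> set_pmf f \<Longrightarrow> 1 \<le> a"
  shows "min_pmf f \<le> min_pmf (euler f)" "moved f \<noteq> eps \<Longrightarrow> Suc (min_pmf f) \<le> min_pmf (euler f)"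
  using set_euler[OF min_pmf_in[of "euler f"]] merged_ge[OF f] min_pmf_le[of _ f] le_neq_implies_less
  by (fastforce simp: Suc_le_eq)+

text \<open>The separated form of one step. The upper bound for the decrease of \<open>phi\<close>
  is exact, since the intensity is taken at the start of the step, where the integrand of
  \<open>phi\<close> is largest; only the lower bound has an error, a product of two quantities of
  order \<open>eps\<close>.\<close>

lemma phi_euler_step:
  assumes x: "0 \<le> x" "x \<le> 1" and z: "pgf f x \<le> z0" "z0 < 1"
  shows "\<bar>phi (pgf (euler f) x) - phi (pgf f x) + moved f * x ^ min_pmf f\<bar> \<le> eps\<^sup>2 * (Q1 p / (1 - z0))"
    and "pgf (euler f) x \<le> pgf f x"
proof -
  define a b m where "a = pgf (euler f) x" and "b = pgf f x" and "m = moved f * x ^ min_pmf f"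
  have m: "0 \<le> m" "m \<le> eps"
    using moved_bounds[of f] x mult_mono[of "moved f" eps "x ^ min_pmf f" 1]
    by (auto simp: m_def power_le_one)
  have b: "0 \<le> b" "b \<le> z0" "b < 1" and a0: "0 \<le> a"
    using pgf_bounds[OF x] z by (auto simp: a_def b_def)
  have gb: "0 \<le> gen b" "gen b \<le> z0" "0 < 1 - gen b"
    using gen_nonneg[of b] gen_le[of b] b z by auto
  have ba: "b - a = m * (1 - gen b)"
    using pgf_euler[OF x, of f] by (simp add: a_def b_def m_def)
  have "0 \<le> m * (1 - gen b)" "m * (1 - gen b) \<le> m"
    using m gb gen_nonneg[of b] b by (auto intro: mult_left_le)
  then have ab: "a \<le> b" and ba_m: "b - a \<le> m"
    using ba by linarith+
  then show "pgf (euler f) x \<le> pgf f x" by (simp add: a_def b_def)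
  have ga: "0 < 1 - gen a" "gen a \<le> gen b"
    using one_minus_gen_pos[of a] gen_mono[of a b] a0 ab b by auto
  have up: "phi b - phi a \<le> m"
    using phi_diff_bounds(2)[of a b] a0 ab b gb by (simp add: ba)
  have "m - (phi b - phi a) \<le> m - (b - a) / (1 - gen a)"
    using phi_diff_bounds(1)[of a b] a0 ab b by simp
  also have "\<dots> = m * (gen b - gen a) / (1 - gen a)"
    using ga unfolding ba by (simp add: field_simps)
  also have "\<dots> \<le> m * (Q1 p * (b - a)) / (1 - z0)"
    using m ga gb z gen_diff_le[of a b] a0 ab b Q1_pos
    by (intro frac_le mult_left_mono mult_nonneg_nonneg) auto
  also have "\<dots> \<le> eps * (Q1 p * eps) / (1 - z0)"
    using m ab ba_m Q1_pos z eps
    by (intro divide_right_mono mult_mono mult_nonneg_nonneg) auto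
  also have "\<dots> = eps\<^sup>2 * (Q1 p / (1 - z0))"
    by (simp add: power2_eq_square)
  finally have "m - (phi b - phi a) \<le> eps\<^sup>2 * (Q1 p / (1 - z0))" .
  with up show "\<bar>phi (pgf (euler f) x) - phi (pgf f x) + moved f * x ^ min_pmf f\<bar> \<le> eps\<^sup>2 * (Q1 p / (1 - z0))"
    unfolding a_def[symmetric] b_def[symmetric] m_def[symmetric] by (simp add: abs_le_iff)
qed

context
  fixes f0 :: "nat pmf"
  assumes f0: "0 \<notin> set_pmf f0"
begin

definition chain :: "nat \<Rightarrow> nat pmf" where
  "chain i = (euler ^^ i) f0"

lemma chain_simps [simp]: "chain 0 = f0" "chain (Suc i) = euler (chain i)"
  by (simp_all add: chain_def)

lemma chain_ge_1: "a \<in> set_pmf (chain i) \<Longrightarrow> 1 \<le> a"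
proof (induction i arbitrary: a)
  case 0
  then show ?case using f0 by (cases a) auto
next
  case (Suc i)
  then show ?case using euler_ge_1[of "chain i" a] by simp
qed

lemma chain_min_step:
  "min_pmf (chain i) \<le> min_pmf (chain (Suc i))"
  "moved (chain i) \<noteq> eps \<Longrightarrow> Suc (min_pmf (chain i)) \<le> min_pmf (chain (Suc i))"
  using min_euler[of "chain i"] chain_ge_1[of _ i] by simp_all

lemma chain_min_mono: "i \<le> k \<Longrightarrow> min_pmf (chain i) \<le> min_pmf (chain k)"
  by (rule lift_Suc_mono_le[of "\<lambda>i. min_pmf (chain i)", OF chain_min_step(1)])

lemma chain_min_ge_1: "1 \<le> min_pmf (chain i)"
  by (rule chain_ge_1[OF min_pmf_in])

lemma chain_pgf_le:
  assumes x: "0 \<le> x" "x \<le> 1" and z: "pgf f0 x \<le> z0" "z0 < 1"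
  shows "pgf (chain i) x \<le> z0"
proof (induction i)
  case (Suc i)
  then show ?case
    using phi_euler_step(2)[OF x Suc z(2)] by simp
qed (simp add: z)

text \<open>Each site is exhausted at most once, so the total mass by which the steps fall short of
  \<open>eps\<close> is controlled by a geometric series.\<close>
lemma chain_deficit:
  assumes x: "0 \<le> x" "x < 1"
  shows "(\<Sum>l<i. (eps - moved (chain l)) * x ^ min_pmf (chain l)) * (1 - x) \<le> eps * (1 - x ^ min_pmf (chain i))"
proof (induction i)
  case (Suc i)
  let ?j = "min_pmf (chain i)" and ?j' = "min_pmf (chain (Suc i))" and ?m = "moved (chain i)"
  have "(eps - ?m) * x ^ ?j * (1 - x) \<le> eps * (x ^ ?j - x ^ ?j')"
  proof (cases "?m = eps")
    case True
    have "x ^ ?j' \<le> x ^ ?j"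
      using chain_min_step(1)[of i] x by (intro power_decreasing) auto
    with True show ?thesis using eps by simp
  next
    case False
    then have "x ^ ?j' \<le> x ^ Suc ?j"
      using chain_min_step(2)[of i] x by (intro power_decreasing) auto
    then have 1: "x ^ ?j * (1 - x) \<le> x ^ ?j - x ^ ?j'"
      by (simp add: algebra_simps)
    have "(eps - ?m) * (x ^ ?j * (1 - x)) \<le> eps * (x ^ ?j * (1 - x))"
      using moved_bounds(1)[of "chain i"] x by (intro mult_right_mono) auto
    also have "\<dots> \<le> eps * (x ^ ?j - x ^ ?j')"
      using 1 eps by (intro mult_left_mono) auto
    finally show ?thesis by (simp only: mult.assoc)
  qed
  with Suc show ?case by (simp add: algebra_simps)
next
  case 0
  show ?case using x eps by (simp add: power_le_one)
qed

text \<open>Two errors add up: one of order \<open>eps\<close> squared in each step, hence of order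
  \<open>eps\<close> over a fixed clock time, and the shortfall of the moved mass against
  \<open>eps\<close>, bounded by \<open>chain_deficit\<close>.\<close>

lemma chain_phi:
  assumes x: "0 \<le> x" "x < 1" and z: "pgf f0 x \<le> z0" "z0 < 1"
  shows "\<bar>phi (pgf (chain i) x) - phi (pgf f0 x) + (\<Sum>l<i. eps * x ^ min_pmf (chain l))\<bar>
    \<le> real i * eps * (eps * (Q1 p / (1 - z0))) + eps / (1 - x)"
proof -
  have x': "x \<le> 1" using x by simp
  define d where "d = eps\<^sup>2 * (Q1 p / (1 - z0))"
  have 1: "\<bar>phi (pgf (chain i) x) - phi (pgf f0 x) + (\<Sum>l<i. moved (chain l) * x ^ min_pmf (chain l))\<bar> \<le> real i * d"
  proof (induction i)
    case (Suc i)
    with phi_euler_step(1)[OF x(1) x' chain_pgf_le[OF x(1) x' z] z(2), of i, folded d_def]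
    show ?case by (simp add: distrib_right)
  qed simp
  have 2: "0 \<le> (\<Sum>l<i. (eps - moved (chain l)) * x ^ min_pmf (chain l))"
    using moved_bounds(2) x by (intro sum_nonneg) auto
  have "(\<Sum>l<i. (eps - moved (chain l)) * x ^ min_pmf (chain l)) * (1 - x) \<le> eps"
  proof (rule order_trans[OF chain_deficit[OF x, of i]])
    show "eps * (1 - x ^ min_pmf (chain i)) \<le> eps"
      using x eps by (intro mult_left_le) auto
  qed
  then have 3: "(\<Sum>l<i. (eps - moved (chain l)) * x ^ min_pmf (chain l)) \<le> eps / (1 - x)"
    using x by (simp add: field_simps)
  have "(\<Sum>l<i. eps * x ^ min_pmf (chain l)) = (\<Sum>l<i. moved (chain l) * x ^ min_pmf (chain l))
      + (\<Sum>l<i. (eps - moved (chain l)) * x ^ min_pmf (chain l))"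
    by (simp add: sum.distrib[symmetric] algebra_simps)
  moreover have "real i * d = real i * eps * (eps * (Q1 p / (1 - z0)))"
    by (simp add: d_def power2_eq_square)
  ultimately show ?thesis
    using 1 2 3 by linarith
qed

end

end

end

section \<open>Lattice approximation of the initial measure\<close>

definition lattice_measure :: "real \<Rightarrow> nat pmf \<Rightarrow> real measure" where
  "lattice_measure h f = distr (measure_pmf f) borel (\<lambda>k. h * real k)"

lemma lattice_measure_prob:
  assumes "0 \<le> h"
  shows "prob_Rplus (lattice_measure h f)"
proof -
  have "prob_space (lattice_measure h f)"
    unfolding lattice_measure_def by (rule measure_pmf.prob_space_distr) simp
  then have "real_distribution (lattice_measure h f)"
    by (simp add: real_distribution_def real_distribution_axioms_def lattice_measure_def)
  moreover have "measure (lattice_measure h f) {..<0} = measure (measure_pmf f) {k. h * real k < 0}"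
    unfolding lattice_measure_def by (subst measure_distr) (auto simp: vimage_def)
  moreover have "{k :: nat. h * real k < 0} = {}"
    using assms by (auto simp: not_less)
  ultimately show ?thesis
    by (simp add: prob_Rplus_def)
qed

lemma lap_lattice_measure: "lap (lattice_measure h f) q = pgf f (exp (- q * h))"
proof -
  have "exp (- q * (h * real k)) = exp (- q * h) ^ k" for k
    by (simp add: exp_of_nat_mult[symmetric] algebra_simps)
  then show ?thesis
    unfolding lap_def lattice_measure_def pgf_def by (subst integral_distr) auto
qed

text \<open>Points are rounded up to the lattice. This moves them by at most h, and positive points
  never reach 0, so the chain can start.\<close>

lemma lattice_approx:
  assumes M: "prob_Rplus M" "0 < pmin M" and h: "0 < h"
  obtains f where "0 \<notin> set_pmf f"
    "\<And>q. 0 < q \<Longrightarrow> exp (- q * h) * lap M q \<le> lap (lattice_measure h f) q"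
    "\<And>q. 0 < q \<Longrightarrow> lap (lattice_measure h f) q \<le> lap M q"
proof -
  interpret real_distribution M by (rule prob_RplusD[OF M(1)])
  define g where "g x = nat \<lceil>x / h\<rceil>" for x
  have g: "g \<in> measurable M (count_space UNIV)"
    unfolding g_def by measurable
  define N where "N = distr M (count_space UNIV) g"
  have N: "prob_space N"
    unfolding N_def by (rule prob_space_distr[OF g])
  interpret N: prob_space N by fact
  have sN: "sets N = UNIV" by (simp add: N_def)
  \<comment> \<open>On the naturals a probability measure is carried by its atoms, the condition for
    it to be a \<open>pmf\<close>.\<close>
  have "AE k in N. k \<noteq> i \<or> measure N {i} \<noteq> 0" for i
    by (cases "measure N {i} = 0") (auto intro!: AE_I[where N="{i}"] simp: sN N.emeasure_eq_measure)
  then have "AE k in N. \<forall>i. k \<noteq> i \<or> measure N {i} \<noteq> 0"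
    unfolding AE_all_countable by blast
  then have "AE k in N. measure N {k} \<noteq> 0"
    by eventually_elim blast
  then have Nf: "measure_pmf (Abs_pmf N) = N"
    using N sN by (intro Abs_pmf_inverse) auto
  define f where "f = Abs_pmf N"
  have lap_f: "lap (lattice_measure h f) q = (LINT x|M. exp (- q * (h * real (g x))))" for q
    unfolding lap_def lattice_measure_def f_def Nf
    by (subst integral_distr) (auto simp: sN N_def integral_distr[OF g])
  have int: "integrable M (\<lambda>x. exp (- q * (h * real (g x))))" if "0 < q" for q
  proof (rule integrable_const_bound[where B=1])
    have "0 \<le> q * (h * real (g x))" for x
      using that h by simp
    then show "AE x in M. norm (exp (- q * (h * real (g x)))) \<le> 1" by simp
    show "(\<lambda>x. exp (- q * (h * real (g x)))) \<in> borel_measurable M"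
      by (rule measurable_compose[OF g]) simp
  qed
  have gb: "x \<le> h * real (g x)" "h * real (g x) \<le> x + h" if "0 \<le> x" for x
  proof -
    have "0 \<le> \<lceil>x / h\<rceil>" using that h by (simp add: order_less_le_trans[of "- 1" 0])
    then have gx: "real (g x) = of_int \<lceil>x / h\<rceil>" by (simp add: g_def)
    have "x / h \<le> real (g x)" "real (g x) \<le> x / h + 1"
      unfolding gx by linarith+
    then show "x \<le> h * real (g x)" "h * real (g x) \<le> x + h"
      using h by (auto simp: field_simps)
  qed
  show ?thesis
  proof
    have "AE x in M. g x \<noteq> 0"
      using pmin_AE[OF M(1)]
    proof eventually_elim
      case (elim x)
      then have "0 < h * real (g x)" using gb(1)[of x] M(2) by simp
      then show ?case by (intro notI) simp
    qed
    then have "AE k in N. k \<noteq> 0"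
      unfolding N_def by (subst AE_distr_iff[OF g]) auto
    then have "AE k in measure_pmf f. k \<noteq> 0"
      unfolding f_def Nf .
    then show "0 \<notin> set_pmf f"
      by (auto simp: AE_measure_pmf_iff)
    fix q :: real assume q: "0 < q"
    show "exp (- q * h) * lap M q \<le> lap (lattice_measure h f) q"
    proof -
      have "exp (- q * h) * lap M q = (LINT x|M. exp (- q * h) * exp (- q * x))"
        by (simp add: lap_def)
      also have "\<dots> \<le> (LINT x|M. exp (- q * (h * real (g x))))"
      proof (rule integral_mono_AE[OF _ int[OF q]])
        show "integrable M (\<lambda>x. exp (- q * h) * exp (- q * x))"
          by (intro integrable_mult_right lap_integrable M) (use q in simp)
        show "AE x in M. exp (- q * h) * exp (- q * x) \<le> exp (- q * (h * real (g x)))"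
          using prob_RplusD(5)[OF M(1)]
        proof eventually_elim
          case (elim x)
          have "q * (h * real (g x)) \<le> q * (x + h)"
            using gb(2)[OF elim] q by (intro mult_left_mono) auto
          then show ?case by (simp add: exp_add[symmetric] algebra_simps)
        qed
      qed
      finally show ?thesis by (simp add: lap_f)
    qed
    show "lap (lattice_measure h f) q \<le> lap M q"
      unfolding lap_f unfolding lap_def
    proof (rule integral_mono_AE[OF int[OF q]])
      show "integrable M (\<lambda>x. exp (- q * x))"
        using lap_integrable[OF M(1)] q by simp
      show "AE x in M. exp (- q * (h * real (g x))) \<le> exp (- q * x)"
        using prob_RplusD(5)[OF M(1)] by eventually_elim (use gb(1) q in simp)
    qed
  qed
qed

section \<open>Interpolation in time and convergence of the scheme\<close>

context min_clustering
begin

context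
  fixes t0 h eps :: real and f0 :: "nat pmf"
  assumes t0: "0 < t0" and h: "0 < h" and eps: "0 < eps" and f0: "0 \<notin> set_pmf f0"
begin

text \<open>Each step lasts \<open>eps\<close> on the clock, so the time grid is geometric. With
  \<open>max t0 t\<close> the chain stays at its start before \<open>t0\<close>, which keeps the
  path of its min monotone on the whole line.\<close>

definition step_index :: "real \<Rightarrow> nat" where
  "step_index t = nat \<lfloor>ln (max t0 t / t0) / (Q1 p * eps)\<rfloor>"

definition step_time :: "nat \<Rightarrow> real" where
  "step_time i = t0 * exp (Q1 p * eps * real i)"

definition euler_measure :: "real \<Rightarrow> real measure" where
  "euler_measure t = lattice_measure h (chain eps f0 (step_index t))"

definition euler_min :: "real \<Rightarrow> real" where
  "euler_min t = h * real (min_pmf (chain eps f0 (step_index t)))"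

lemma Qe: "0 < Q1 p * eps"
  using Q1_pos eps by simp

lemma step_arg_nonneg: "0 \<le> ln (max t0 t / t0) / (Q1 p * eps)"
  using t0 Qe by (intro divide_nonneg_pos ln_ge_zero) (auto simp: field_simps)

lemma step_index_bounds:
  "real (step_index t) \<le> ln (max t0 t / t0) / (Q1 p * eps)"
  "ln (max t0 t / t0) / (Q1 p * eps) < real (step_index t) + 1"
  using step_arg_nonneg[of t] by (auto simp: step_index_def)

lemma step_time_pos: "0 < step_time i"
  using t0 by (simp add: step_time_def)

lemma step_time_ge: "t0 \<le> step_time i"
  using t0 Qe by (simp add: step_time_def)

lemma step_time_0 [simp]: "step_time 0 = t0"
  by (simp add: step_time_def)

lemma step_time_le_Suc: "step_time i \<le> step_time (Suc i)"
  unfolding step_time_def using t0 Qe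
  by (intro mult_left_mono exp_le_cancel_iff[THEN iffD2]) auto

lemma step_index_bracket:
  assumes "t0 \<le> t"
  shows "step_time (step_index t) \<le> t" "t < step_time (Suc (step_index t))"
proof -
  define y where "y = ln (t / t0) / (Q1 p * eps)"
  have m: "max t0 t = t" using assms by simp
  have t: "t = t0 * exp (Q1 p * eps * y)"
    using t0 assms Q1_pos eps by (simp add: y_def)
  have "real (step_index t) \<le> y" "y < real (Suc (step_index t))"
    using step_index_bounds[of t] by (auto simp: y_def m)
  then show "step_time (step_index t) \<le> t" "t < step_time (Suc (step_index t))"
    using t0 Qe by (auto simp: step_time_def t intro!: mult_left_mono mult_strict_left_mono simp del: of_nat_Suc)
qed

lemma mono_step_index: "mono step_index"
proof (rule monoI)
  fix s t :: real assume "s \<le> t"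
  then have "ln (max t0 s / t0) / (Q1 p * eps) \<le> ln (max t0 t / t0) / (Q1 p * eps)"
    using t0 Qe by (intro divide_right_mono) (auto simp: divide_right_mono)
  then show "step_index s \<le> step_index t"
    unfolding step_index_def by (intro nat_mono floor_mono)
qed

lemma step_index_eqI:
  assumes "step_time i \<le> t" "t < step_time (Suc i)"
  shows "step_index t = i"
proof -
  have t: "t0 \<le> t" using assms(1) step_time_ge[of i] by simp
  have cmp: "step_time a < step_time b \<longleftrightarrow> a < b" for a b
    using t0 Q1_pos eps by (simp add: step_time_def)
  have "step_time i < step_time (Suc (step_index t))" "step_time (step_index t) < step_time (Suc i)"
    using step_index_bracket[OF t] assms by auto
  then show ?thesis
    unfolding cmp by simp
qed

lemma step_index_right: "\<exists>u>t. \<forall>s\<in>{t..<u}. step_index s = step_index t"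
proof (cases "t < t0")
  case True
  then show ?thesis
    by (intro exI[of _ t0]) (auto simp: step_index_def)
next
  case False
  then have t: "t0 \<le> t" by simp
  show ?thesis
    using step_index_bracket[OF t]
    by (intro exI[of _ "step_time (Suc (step_index t))"] conjI ballI step_index_eqI) auto
qed

lemma euler_min_mono: "mono euler_min"
  unfolding euler_min_def using h chain_min_mono[OF eps f0 monoD[OF mono_step_index]]
  by (intro monoI mult_left_mono) auto

lemma euler_min_pos: "0 < euler_min t"
  using h chain_min_ge_1[OF eps f0, of "step_index t"] by (simp add: euler_min_def)

lemma euler_min_right_continuous: "continuous (at_right t) euler_min"
proof -
  obtain u where u: "t < u" "\<forall>s\<in>{t..<u}. step_index s = step_index t"
    using step_index_right[of t] by blast
  have "\<forall>\<^sub>F s in at_right t. euler_min t = euler_min s"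
    using eventually_at_right_real[OF u(1)]
  proof eventually_elim
    case (elim s)
    then have "step_index s = step_index t"
      by (intro bspec[OF u(2)]) simp
    then show ?case by (simp only: euler_min_def)
  qed
  then have "(euler_min \<longlongrightarrow> euler_min t) (at_right t)"
    by (rule Lim_transform_eventually[OF tendsto_const])
  then show ?thesis by (simp add: continuous_within)
qed

lemma euler_measure_prob: "prob_Rplus (euler_measure t)"
  unfolding euler_measure_def by (rule lattice_measure_prob) (use h in simp)

lemma lap_euler: "lap (euler_measure t) q = pgf (chain eps f0 (step_index t)) (exp (- q * h))"
  by (simp add: euler_measure_def lap_lattice_measure)

lemma lap_euler_le:
  assumes "0 < q"
  shows "lap (euler_measure t) q \<le> exp (- q * euler_min t)"
proof -
  have "pgf (chain eps f0 (step_index t)) (exp (- q * h)) \<le> exp (- q * h) ^ min_pmf (chain eps f0 (step_index t))"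
    by (rule pgf_le_min) (use assms h in auto)
  also have "\<dots> = exp (- q * euler_min t)"
    by (simp add: euler_min_def exp_of_nat_mult[symmetric] algebra_simps)
  finally show ?thesis by (simp add: lap_euler)
qed

lemma euler_clock_integral:
  assumes q: "0 < q"
  defines "x \<equiv> exp (- q * h)"
  shows "(LINT u|clock t0 (step_time i). exp (- q * euler_min u)) = (\<Sum>l<i. eps * x ^ min_pmf (chain eps f0 l))"
proof -
  have meas: "(\<lambda>u. exp (- q * euler_min u)) \<in> borel_measurable borel"
    using borel_measurable_mono[OF euler_min_mono] by measurable
  have b: "\<bar>exp (- q * euler_min u)\<bar> \<le> 1" for u
    using euler_min_pos[of u] q by simp
  show ?thesis
  proof (induction i)
    case 0
    \<comment> \<open>Splitting the degenerate interval at its only point gives I = I + I, so the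
      integral is 0.\<close>
    show ?case
      using integral_clock_combine[OF t0 order_refl order_refl meas b] by simp
  next
    case (Suc i)
    let ?c = "clock (step_time i) (step_time (Suc i))"
    \<comment> \<open>The index jumps at the right end of the step, a null set for the
      clock.\<close>
    have "AE u in ?c. u \<in> {step_time i..step_time (Suc i)}"
      "AE u in ?c. u \<notin> {step_time (Suc i)}"
      using AE_clock[of "step_time i" "step_time (Suc i)"] AE_clock_countable[of "{step_time (Suc i)}"] by simp_all
    then have "AE u in ?c. exp (- q * euler_min u) = x ^ min_pmf (chain eps f0 i)"
    proof eventually_elim
      case (elim u)
      then have "step_index u = i"
        by (intro step_index_eqI) auto
      then show ?case
        by (simp add: euler_min_def x_def exp_of_nat_mult[symmetric] algebra_simps)
    qed
    then have "(LINT u|?c. exp (- q * euler_min u)) =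
        (LINT u|?c. x ^ min_pmf (chain eps f0 i))"
      using meas by (intro integral_cong_AE) auto
    also have "\<dots> = x ^ min_pmf (chain eps f0 i) * (ln (step_time (Suc i) / step_time i) / Q1 p)"
      by (rule integral_clock_const[OF step_time_pos step_time_le_Suc])
    also have "step_time (Suc i) / step_time i = exp (Q1 p * eps)"
      using t0 by (simp add: step_time_def distrib_left exp_add)
    finally have "(LINT u|?c. exp (- q * euler_min u)) =
        eps * x ^ min_pmf (chain eps f0 i)"
      using Q1_pos by simp
    then show ?case
      using integral_clock_combine[OF t0 step_time_ge step_time_le_Suc meas b] Suc by simp
  qed
qed

text \<open>The three terms are the accumulated step errors, the shortfall of moved mass, and the
  clock time of the last, incomplete step.\<close>

lemma euler_error:
  assumes t: "t0 \<le> t" and q: "0 < q" and z: "pgf f0 (exp (- q * h)) \<le> z0" "z0 < 1"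
  shows "\<bar>phi (lap (euler_measure t) q) - phi (lap (euler_measure t0) q) + (LINT u|clock t0 t. exp (- q * euler_min u))\<bar>
    \<le> (ln (t / t0) / Q1 p) * (eps * (Q1 p / (1 - z0))) + eps / (1 - exp (- q * h)) + eps"
proof -
  define x where "x = exp (- q * h)"
  define i where "i = step_index t"
  have x: "0 \<le> x" "x < 1" using q h by (auto simp: x_def)
  have i0: "step_index t0 = 0" using t0 by (simp add: step_index_def)
  have meas: "(\<lambda>u. exp (- q * euler_min u)) \<in> borel_measurable borel"
    using borel_measurable_mono[OF euler_min_mono] by measurable
  have b: "\<bar>exp (- q * euler_min u)\<bar> \<le> 1" for u
    using euler_min_pos[of u] q by simp
  have br: "step_time i \<le> t" "t < step_time (Suc i)"
    using step_index_bracket[OF t] by (auto simp: i_def)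
  have split: "(LINT u|clock t0 t. exp (- q * euler_min u)) =
      (\<Sum>l<i. eps * x ^ min_pmf (chain eps f0 l)) + (LINT u|clock (step_time i) t. exp (- q * euler_min u))"
    using integral_clock_combine[OF t0 step_time_ge br(1) meas b] euler_clock_integral[OF q, of i] by (simp add: x_def)
  have "\<bar>LINT u|clock (step_time i) t. exp (- q * euler_min u)\<bar> \<le> 1 * (ln (t / step_time i) / Q1 p)"
    by (rule integral_clock_abs_le[OF step_time_pos br(1) meas b])
  also have "\<dots> \<le> ln (exp (Q1 p * eps)) / Q1 p"
  proof -
    have "t / step_time i \<le> step_time (Suc i) / step_time i"
      using br step_time_pos[of i] by (intro divide_right_mono) auto
    also have "\<dots> = exp (Q1 p * eps)"
      using t0 by (simp add: step_time_def distrib_left exp_add)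
    finally have "ln (t / step_time i) \<le> ln (exp (Q1 p * eps))"
      using br step_time_pos[of i] by (subst ln_le_cancel_iff) auto
    then show ?thesis
      unfolding mult_1 using Q1_pos by (intro divide_right_mono) auto
  qed
  finally have rest: "\<bar>LINT u|clock (step_time i) t. exp (- q * euler_min u)\<bar> \<le> eps"
    using Q1_pos by simp
  have "real i * eps \<le> ln (t / t0) / Q1 p"
    using step_index_bounds(1)[of t] t eps Q1_pos by (simp add: i_def field_simps)
  then have "real i * eps * (eps * (Q1 p / (1 - z0))) \<le> (ln (t / t0) / Q1 p) * (eps * (Q1 p / (1 - z0)))"
    using eps Q1_pos z by (intro mult_right_mono) auto
  with chain_phi[OF eps f0 x z[folded x_def], of i] rest show ?thesis
    unfolding split lap_euler i0 i_def[symmetric] x_def[symmetric] chain_simps[OF eps f0] by linarith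
qed

end

lemma weak_solution_exists:
  assumes Fh: "prob_Rplus Fh" "0 < pmin Fh" and t0: "0 < t0"
  obtains F where "weak_solution p {t0..} F" "F t0 = Fh"
proof -
  define h where "h n = inverse (real (Suc n))" for n
  \<comment> \<open>The step has to vanish faster than the mesh: the shortfall eps / (1 - exp (- q
    h)) is of order eps / (q h), which with this choice is h / q.\<close>
  define eps where "eps n = (h n)\<^sup>2" for n
  have h: "0 < h n" and e: "0 < eps n" for n
    by (auto simp: h_def eps_def)
  have h0: "h \<longlonglongrightarrow> 0"
    unfolding h_def by (rule LIMSEQ_inverse_real_of_nat)
  have "\<exists>f. 0 \<notin> set_pmf f \<and> (\<forall>q>0. exp (- q * h n) * lap Fh q \<le> lap (lattice_measure (h n) f) q
      \<and> lap (lattice_measure (h n) f) q \<le> lap Fh q)" for n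
    using lattice_approx[OF Fh h[of n]] by metis
  then obtain f where f1: "\<And>n. 0 \<notin> set_pmf (f n)"
    and f2: "\<And>n q. 0 < q \<Longrightarrow> exp (- q * h n) * lap Fh q \<le> lap (lattice_measure (h n) (f n)) q"
    and f3: "\<And>n q. 0 < q \<Longrightarrow> lap (lattice_measure (h n) (f n)) q \<le> lap Fh q"
    by metis
  note ctx = t0 h e f1
  define Fn where "Fn n = euler_measure t0 (h n) (eps n) (f n)" for n
  define en where "en n = euler_min t0 (h n) (eps n) (f n)" for n
  have Fn0: "Fn n t0 = lattice_measure (h n) (f n)" for n
    using t0 by (simp add: Fn_def euler_measure_def[OF ctx] step_index_def[OF ctx] chain_simps[OF e f1])
  show ?thesis
  proof (rule limit_weak_solution[OF t0, of Fn en Fh])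
    show "prob_Rplus (Fn n t)" for n t
      unfolding Fn_def by (rule euler_measure_prob[OF ctx])
    show "mono (en n)" "continuous (at_right x) (en n)" "0 < en n x" for n x
      unfolding en_def by (rule euler_min_mono[OF ctx] euler_min_right_continuous[OF ctx] euler_min_pos[OF ctx])+
    show "lap (Fn n t) q \<le> exp (- q * en n t)" if "0 < q" for n t q
      unfolding Fn_def en_def by (rule lap_euler_le[OF ctx that])
    show "prob_Rplus Fh" "0 < pmin Fh" by fact+
    fix q :: real assume q: "0 < q"
    show "(\<lambda>n. lap (Fn n t0) q) \<longlonglongrightarrow> lap Fh q"
    proof (rule tendsto_sandwich)
      have "(\<lambda>n. exp (- q * h n) * lap Fh q) \<longlonglongrightarrow> exp (- q * 0) * lap Fh q"
        by (intro tendsto_intros h0)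
      then show "(\<lambda>n. exp (- q * h n) * lap Fh q) \<longlonglongrightarrow> lap Fh q" by simp
    qed (use f2[OF q] f3[OF q] in \<open>auto simp: Fn0\<close>)
    fix t assume t: "t0 \<le> t"
    define z0 where "z0 = lap Fh q"
    have z0: "z0 < 1"
      unfolding z0_def by (rule lap_less_1[OF Fh(1) q Fh(2)])
    have z: "pgf (f n) (exp (- q * h n)) \<le> z0" for n
      using f3[OF q, of n] by (simp add: lap_lattice_measure z0_def)
    define d where "d n = (ln (t / t0) / Q1 p) * (eps n * (Q1 p / (1 - z0))) + (h n * (1 + q * h n) / q) + eps n" for n
    show "(\<lambda>n. phi (lap (Fn n t) q) - phi (lap (Fn n t0) q) + (LINT u|clock t0 t. exp (- q * en n u))) \<longlonglongrightarrow> 0"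
    proof (rule Lim_null_comparison)
      have "norm (phi (lap (Fn n t) q) - phi (lap (Fn n t0) q) + (LINT u|clock t0 t. exp (- q * en n u))) \<le> d n" for n
      proof -
        have "eps n / (1 - exp (- q * h n)) \<le> h n * (1 + q * h n) / q"
        proof -
          have y: "0 < q * h n" using q h by simp
          have "1 + q * h n \<le> exp (q * h n)" by (rule exp_ge_add_one_self)
          then have "exp (- q * h n) \<le> 1 / (1 + q * h n)"
            using y by (simp add: exp_minus inverse_eq_divide frac_le)
          then have "q * h n / (1 + q * h n) \<le> 1 - exp (- q * h n)"
            using y by (simp add: field_simps)
          then have "eps n / (1 - exp (- q * h n)) \<le> eps n / (q * h n / (1 + q * h n))"
            using y e[of n] by (intro divide_left_mono mult_pos_pos) auto
          also have "\<dots> = h n * (1 + q * h n) / q"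
            using q h[of n] by (simp add: eps_def power2_eq_square)
          finally show ?thesis .
        qed
        then show ?thesis
          using euler_error[OF t0 h[of n] e[of n] f1[of n] t q z[of n] z0] unfolding d_def Fn_def en_def real_norm_def by linarith
      qed
      then show "\<forall>\<^sub>F n in sequentially. norm (phi (lap (Fn n t) q) - phi (lap (Fn n t0) q) +
          (LINT u|clock t0 t. exp (- q * en n u))) \<le> d n"
        by (simp add: always_eventually)
      have "d \<longlonglongrightarrow> (ln (t / t0) / Q1 p) * (0\<^sup>2 * (Q1 p / (1 - z0))) + (0 * (1 + q * 0) / q) + 0\<^sup>2"
        unfolding d_def eps_def using q by (intro tendsto_intros h0) auto
      then show "d \<longlonglongrightarrow> 0" by simp
    qed
  next
    fix r F assume "weak_solution p {t0..} F" "F t0 = Fh"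
    then show ?thesis by (rule that)
  qed
qed

end

theorem theorem4p4:
  fixes p :: "nat \<Rightarrow> real" and t0 :: real
  assumes p_nonneg: "\<forall>k. 0 \<le> p (Suc k)"
    and p_sum: "(\<lambda>k. p (Suc k)) sums 1"
    and p_mean: "summable (\<lambda>k. real (Suc k) * p (Suc k))"
    and t0_pos: "0 < t0"
  shows
    "(\<forall>Fh. prob_Rplus Fh \<and> 0 < pmin Fh \<longrightarrow>
        (\<exists>F. weak_solution p {t0..} F \<and> F t0 = Fh \<and>
             (\<forall>t\<ge>t0. pmin (F t) / pmin (F t0) \<ge> (1/2) * (t / t0) powr (ln 2 / Q1 p))))
     \<and>
     (\<forall>Fh F G t1. prob_Rplus Fh \<and> 0 < pmin Fh \<and>
        weak_solution p {t0..} F \<and> F t0 = Fh \<and>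
        t0 < t1 \<and> weak_solution p {t0..t1} G \<and> G t0 = Fh \<longrightarrow>
        (\<forall>t\<in>{t0..t1}. G t = F t))
     \<and>
     (\<forall>(Fhn :: nat \<Rightarrow> real measure) Fn Fh F.
        (\<forall>n. prob_Rplus (Fhn n) \<and> 0 < pmin (Fhn n)) \<and>
        (\<forall>n. weak_solution p {t0..} (Fn n) \<and> Fn n t0 = Fhn n) \<and>
        prob_Rplus Fh \<and> 0 < pmin Fh \<and> weak_conv_m Fhn Fh \<and>
        weak_solution p {t0..} F \<and> F t0 = Fh \<longrightarrow>
        (\<forall>t>t0. weak_conv_m (\<lambda>n. Fn n t) (F t)))"
proof -
  interpret min_clustering p
    by unfold_locales (use assms in auto)
  show ?thesis
  proof (intro conjI allI impI ballI)
    fix Fh assume "prob_Rplus Fh \<and> 0 < pmin Fh"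
    then obtain F where F: "weak_solution p {t0..} F" "F t0 = Fh"
      using weak_solution_exists[OF _ _ t0_pos] by blast
    then show "\<exists>F. weak_solution p {t0..} F \<and> F t0 = Fh \<and>
        (\<forall>t\<ge>t0. pmin (F t) / pmin (F t0) \<ge> (1/2) * (t / t0) powr (ln 2 / Q1 p))"
      using weak_solution_pmin_growth[OF F(1) t0_pos] by blast
  next
    fix Fh F G t1 t
    assume "prob_Rplus Fh \<and> 0 < pmin Fh \<and> weak_solution p {t0..} F \<and> F t0 = Fh \<and>
        t0 < t1 \<and> weak_solution p {t0..t1} G \<and> G t0 = Fh" and t: "t \<in> {t0..t1}"
    then show "G t = F t"
      using weak_solution_unique[OF _ weak_solution_Icc[OF _ t0_pos] t0_pos _ t] by metis
  next
    fix Fhn :: "nat \<Rightarrow> real measure" and Fn Fh F t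
    assume *: "(\<forall>n. prob_Rplus (Fhn n) \<and> 0 < pmin (Fhn n)) \<and>
        (\<forall>n. weak_solution p {t0..} (Fn n) \<and> Fn n t0 = Fhn n) \<and>
        prob_Rplus Fh \<and> 0 < pmin Fh \<and> weak_conv_m Fhn Fh \<and>
        weak_solution p {t0..} F \<and> F t0 = Fh" and t: "t0 < t"
    have "(\<lambda>n. Fn n t0) = Fhn"
      using * by blast
    then have conv: "weak_conv_m (\<lambda>n. Fn n t0) (F t0)"
      using * by metis
    show "weak_conv_m (\<lambda>n. Fn n t) (F t)"
      by (rule weak_solution_stable[where F=F and Fn=Fn, OF t0_pos _ _ conv less_imp_le[OF t]]) (use * in blast)+
  qed
qed

end
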